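(* Let $1\le k\le n-1$ be integers, let $m$ be a positive integer and let $p_i,\alpha_i$, $i=1,\dots,m$, be real numbers with $p_i\neq 0$. Let $f_i$ be bounded functions on $\mathbb{R}^n$ with $f_i\in L^{p_i}(\mathbb{R}^n)$, $i=1,\dots,m$. Define $$ I(f_1,\dots,f_m)=\int_{G_{n,k}}\prod_{i=1}^m\big\|f_i|_E\big\|_{p_i}^{\alpha_i}\,d\mu_{n,k}(E). $$ If this quantity is finite and $\sum_{i=1}^m\frac{\alpha_i}{p_i}=n$, then for every volume-preserving linear transformation $g$ of $\mathbb{R}^n$, $$ I(g\cdot f_1,\dots,g\cdot f_m)=I(f_1,\dots,f_m), $$ where $(g\cdot f_i)(t)=f_i(g^{-1}t)$.
   Context: $G_{n,k}$ is the Grassmannian of $k$-dimensional linear subspaces of $\mathbb{R}^n$ with its Haar probability measure $\mu_{n,k}$. For $E\in G_{n,k}$, $f|_E$ is the restriction of $f$ to $E$ and $\|f|_E\|_p=\left(\int_E|f(t)|^p\,dt\right)^{1/p}$ with respect to $k$-dimensional Lebesgue measure on $E$. When a factor is $0$ with a negative exponent it is read as $+\infty$, with $0\cdot\infty=0$. *)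

theory Defs
  imports "HOL-Probability.Probability"
begin

definition grassmannian :: "nat \<Rightarrow> (real ^ 'n) set set" where
  "grassmannian k = {E. subspace E \<and> dim E = k}"

text \<open>The standard topology of the Grassmannian is the one that makes the identification of a
  subspace with its orthogonal projection an embedding.  For a subspace \<open>E\<close>, the map
  \<open>closest_point E\<close> is the orthogonal projection onto \<open>E\<close>.\<close>

definition grassmannian_topology :: "nat \<Rightarrow> (real ^ 'n) set topology" where
  "grassmannian_topology k =
     pullback_topology (grassmannian k) (\<lambda>E. matrix (closest_point E)) euclidean"

definition grassmannian_borel :: "nat \<Rightarrow> (real ^ 'n) set measure" where
  "grassmannian_borel k = sigma (grassmannian k) {U. openin (grassmannian_topology k) U}"

text \<open>The Haar probability measure is the unique Borel probability measure on the Grassmannian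
  that is invariant under the action of the orthogonal group.\<close>

definition is_haar_grassmannian :: "nat \<Rightarrow> (real ^ 'n) set measure \<Rightarrow> bool" where
  "is_haar_grassmannian k \<mu> \<longleftrightarrow>
     prob_space \<mu> \<and> space \<mu> = grassmannian k \<and>
     sets \<mu> = sets (grassmannian_borel k) \<and>
     (\<forall>U. orthogonal_transformation U \<longrightarrow>
        (\<forall>A\<in>sets \<mu>. emeasure \<mu> ((\<lambda>E. U ` E) ` A) = emeasure \<mu> A))"

definition onb :: "(real ^ 'n) set \<Rightarrow> (real ^ 'n) set" where
  "onb E = (SOME B. B \<subseteq> E \<and> pairwise orthogonal B \<and> (\<forall>b\<in>B. norm b = 1) \<and> span B = E)"

text \<open>Lebesgue measure of dimension \<open>dim E\<close> on a subspace \<open>E\<close>: as for \<open>lborel\<close>, the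
  completed product of one-dimensional Lebesgue measures in the coordinates of an orthonormal
  basis.  It does not depend on the basis chosen.\<close>

definition lebesgue_subspace :: "(real ^ 'n) set \<Rightarrow> (real ^ 'n) measure" where
  "lebesgue_subspace E =
     completion (distr (\<Pi>\<^sub>M b\<in>onb E. (lborel :: real measure)) (restrict_space borel E)
                  (\<lambda>c. \<Sum>b\<in>onb E. c b *\<^sub>R b))"

text \<open>Real powers of extended nonnegative reals.  For a negative exponent \<open>0\<close> is sent to
  \<open>\<infinity>\<close> and \<open>\<infinity>\<close> to \<open>0\<close> (on reals, \<open>0 powr a\<close> would be \<open>0\<close>); the power with exponent
  \<open>0\<close> is \<open>1\<close>.  In \<open>ennreal\<close> we have \<open>0 * \<infinity> = 0\<close>.\<close>

definition epowr :: "ennreal \<Rightarrow> real \<Rightarrow> ennreal"  (infixr "epowr" 80) where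
  "x epowr a =
     (if a = 0 then 1
      else if x = 0 then (if a > 0 then 0 else \<infinity>)
      else if x = \<infinity> then (if a > 0 then \<infinity> else 0)
      else ennreal (enn2real x powr a))"

definition Lp_norm :: "'a measure \<Rightarrow> real \<Rightarrow> ('a \<Rightarrow> real) \<Rightarrow> ennreal" where
  "Lp_norm M p f = (\<integral>\<^sup>+ t. ennreal \<bar>f t\<bar> epowr p \<partial>M) epowr (1 / p)"

definition in_Lp :: "'a measure \<Rightarrow> real \<Rightarrow> ('a \<Rightarrow> real) \<Rightarrow> bool" where
  "in_Lp M p f \<longleftrightarrow> f \<in> borel_measurable M \<and> (\<integral>\<^sup>+ t. ennreal \<bar>f t\<bar> epowr p \<partial>M) < \<infinity>"

definition grassmannian_functional ::
  "(real ^ 'n) set measure \<Rightarrow> nat \<Rightarrow> (nat \<Rightarrow> real) \<Rightarrow> (nat \<Rightarrow> real) \<Rightarrow>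
     (nat \<Rightarrow> real ^ 'n \<Rightarrow> real) \<Rightarrow> ennreal" where
  "grassmannian_functional \<mu> m p \<alpha> f =
     (\<integral>\<^sup>+ E. (\<Prod>i=1..m. Lp_norm (lebesgue_subspace E) (p i) (f i) epowr \<alpha> i) \<partial>\<mu>)"

definition volume_preserving_linear :: "(real ^ 'n \<Rightarrow> real ^ 'n) \<Rightarrow> bool" where
  "volume_preserving_linear g \<longleftrightarrow>
     linear g \<and> (\<forall>S\<in>sets lebesgue. emeasure lebesgue (g ` S) = emeasure lebesgue S)"

end

theory Submission
  imports Defs
begin

text \<open>Call \<open>J(g, E)\<close> the factor by which \<open>g\<close> multiplies Lebesgue measure on \<open>E\<close>.  Substituting
  \<open>t = g s\<close> shows that the integrand for \<open>g \<cdot> f\<close> at \<open>g E\<close> is \<open>J(g, E)\<^sup>n\<close> times the integrand for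
  \<open>f\<close> at \<open>E\<close>, because \<open>\<Sum> \<alpha>\<^sub>i / p\<^sub>i = n\<close>.  So everything rests on the quasi-invariance formula
  \<open>\<integral> \<Phi>(g E) J(g, E)\<^bsup>-n\<^esup> d\<mu>(E) = \<integral> \<Phi> d\<mu>\<close>, and in fact, with the factor \<open>\<bar>det g\<bar>\<^bsup>-k\<^esup>\<close> on the right, on
  this formula for all invertible \<open>g\<close>.  As \<open>J\<close> is a cocycle, the formula is stable under composition,
  and it is trivial for orthogonal \<open>g\<close>; a general \<open>g\<close> is a product of orthogonal maps and
  scalings of one coordinate.

  For the scaling by \<open>t\<close> along \<open>e\<close> let \<open>P\<close> be the orthogonal projection onto \<open>E\<close>, \<open>u = P e\<close> and
  \<open>q = \<langle>e, u\<rangle>\<close>.  The new projection is a rational function of \<open>P\<close>, and \<open>J\<^sup>2 = 1 + (t\<^sup>2 - 1) q\<close>.  By the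
  flow property it suffices to differentiate at \<open>t = 1\<close>.  The velocity of \<open>P\<close> there is a combination of
  the fields \<open>[a, P]\<close> of infinitesimal rotations \<open>a\<close> with coefficients depending on \<open>P\<close>, and
  invariance of \<open>\<mu>\<close> under rotations gives integration by parts for each of them.  The divergence of
  the coefficients is \<open>n q - k\<close>, which is what the derivative of the weight compensates.  Test
  functions polynomial in \<open>P\<close> determine the measure.\<close>

subsection \<open>Differentiating integrals; test functions\<close>

text \<open>The measure \<open>\<mu>\<close> is known only through its invariance under the
  orthogonal group: there is no density and no parametrisation in which to compute a Jacobian. This
  invariance still suffices, because rotations act transitively on the Grassmannian: at each point
  the velocity of any flow is that of some rotation, only the generator varies with the point, and
  integration by parts turns this variation into a divergence term. Two regularity obstacles shape
  the rest. Moving the derivative from \<open>t = 1\<close> to other \<open>t\<close> produces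
  integrands that are a polynomial composed with a rational map, times a real power, so a class of
  test functions wider than the polynomials is carried along. And a subspace \<open>E\<close> of
  dimension below \<open>n\<close> is a null set, so the restriction to it of a Lebesgue measurable
  function can fail to be measurable. For such integrands each change of variables yields one
  inequality, and equality comes from using the map and its inverse.\<close>

lemma (in finite_measure) has_real_derivative_integral:
  fixes f :: "real \<Rightarrow> 'a \<Rightarrow> real"
  assumes "\<delta> > 0"
    and int: "\<And>h. \<bar>h - s\<bar> < \<delta> \<Longrightarrow> integrable M (f h)"
    and deriv: "\<And>x. x \<in> space M \<Longrightarrow> ((\<lambda>h. f h x) has_real_derivative f' x) (at s)"
    and bound: "\<And>x h. x \<in> space M \<Longrightarrow> \<bar>h - s\<bar> < \<delta> \<Longrightarrow> \<bar>f h x - f s x\<bar> \<le> C * \<bar>h - s\<bar>"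
  shows "integrable M f'" (is ?int)
    and "((\<lambda>h. \<integral>x. f h x \<partial>M) has_real_derivative (\<integral>x. f' x \<partial>M)) (at s)" (is ?deriv)
proof -
  have *: "integrable M f' \<and> (\<lambda>n. ((\<integral>x. f (s + u n) x \<partial>M) - (\<integral>x. f s x \<partial>M)) / u n) \<longlonglongrightarrow> (\<integral>x. f' x \<partial>M)"
    if u: "u \<longlonglongrightarrow> 0" "\<And>n. u n \<noteq> 0" for u :: "nat \<Rightarrow> real"
  proof -
    have "eventually (\<lambda>n. \<bar>u n\<bar> < \<delta>) sequentially"
      using order_tendstoD(2)[OF tendsto_rabs_zero[OF u(1)] \<open>\<delta> > 0\<close>] .
    then obtain N where N: "\<And>n. n \<ge> N \<Longrightarrow> \<bar>u n\<bar> < \<delta>"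
      by (auto simp: eventually_sequentially)
    \<comment> \<open>The hypotheses hold only within \<open>\<delta>\<close> of \<open>s\<close>,
      so dominated convergence is run along a tail of \<open>u\<close>.\<close>
    define v where "v n = u (n + N)" for n
    have v: "v \<longlonglongrightarrow> 0" "v n \<noteq> 0" "\<bar>v n\<bar> < \<delta>" for n
    proof -
      have "v = (\<lambda>n. u (n + N))" by (auto simp: v_def)
      then show "v \<longlonglongrightarrow> 0" using LIMSEQ_ignore_initial_segment[OF u(1), of N] by simp
    qed (use u N in \<open>auto simp: v_def\<close>)
    have intv: "integrable M (f (s + v n))" for n
      using int[of "s + v n"] v(3)[of n] by simp
    have ints: "integrable M (f s)" using int[of s] \<open>\<delta> > 0\<close> by simp
    have lim: "(\<lambda>n. (f (s + v n) x - f s x) / v n) \<longlonglongrightarrow> f' x" if "x \<in> space M" for x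
    proof -
      have "((\<lambda>h. (f (s + h) x - f s x) / h) \<longlongrightarrow> f' x) (at 0)"
        using deriv[OF that] by (simp add: DERIV_def)
      then show ?thesis
        using v(1,2) by (auto simp: tendsto_at_iff_sequentially comp_def)
    qed
    have m: "(\<lambda>x. (f (s + v n) x - f s x) / v n) \<in> borel_measurable M" for n
      using intv ints by measurable
    \<comment> \<open>A pointwise limit of measurable difference quotients.\<close>
    have f'm: "f' \<in> borel_measurable M"
      by (rule borel_measurable_LIMSEQ_real[OF lim m])
    have bd: "norm ((f (s + v n) x - f s x) / v n) \<le> C" if "x \<in> space M" for n x
      using bound[OF that, of "s + v n"] v(2,3)[of n] by (simp add: divide_simps)
    have 1: "integrable M f'" "(\<lambda>n. \<integral>x. (f (s + v n) x - f s x) / v n \<partial>M) \<longlonglongrightarrow> (\<integral>x. f' x \<partial>M)"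
      using integrable_dominated_convergence[where w="\<lambda>_. C", OF f'm m _ AE_I2[OF lim] AE_I2[OF bd]]
        integral_dominated_convergence[where w="\<lambda>_. C", OF f'm m _ AE_I2[OF lim] AE_I2[OF bd]]
      by simp_all
    have eq: "(\<integral>x. (f (s + v n) x - f s x) / v n \<partial>M) = ((\<integral>x. f (s + v n) x \<partial>M) - (\<integral>x. f s x \<partial>M)) / v n" for n
      using intv ints by simp
    have "(\<lambda>n. ((\<integral>x. f (s + u (n + N)) x \<partial>M) - (\<integral>x. f s x \<partial>M)) / u (n + N)) \<longlonglongrightarrow> (\<integral>x. f' x \<partial>M)"
      using 1(2) unfolding eq unfolding v_def .
    then show ?thesis
      using 1(1) LIMSEQ_offset[of "\<lambda>n. ((\<integral>x. f (s + u n) x \<partial>M) - (\<integral>x. f s x \<partial>M)) / u n" N] by auto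
  qed
  \<comment> \<open>Integrability of \<open>f'\<close> falls out of any single admissible
    sequence.\<close>
  have "(\<lambda>n. 1 / real (Suc n)) \<longlonglongrightarrow> 0" by (rule LIMSEQ_Suc[OF lim_1_over_n])
  from *[OF this] show ?int by auto
  show ?deriv
    unfolding DERIV_def tendsto_at_iff_sequentially using * by (auto simp: comp_def)
qed

lemma has_vector_derivative_vec_componentwise:
  fixes f :: "real \<Rightarrow> real ^ 'm ^ 'n"
  assumes "\<And>i j. ((\<lambda>t. f t $ i $ j) has_real_derivative f' $ i $ j) (at s)"
  shows "(f has_vector_derivative f') (at s)"
proof -
  have "((\<lambda>h. (f (s + h) - f s) /\<^sub>R h) \<longlongrightarrow> f') (at 0)"
    using assms by (intro vec_tendstoI) (auto simp: DERIV_def divide_inverse_commute)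
  then have "((\<lambda>h. norm ((f (s + h) - f s) /\<^sub>R h - f')) \<longlongrightarrow> 0) (at 0)"
    by (simp add: tendsto_norm_zero_iff LIM_zero_iff)
  moreover have "norm ((f (s + h) - f s) /\<^sub>R h - f') = norm (f (s + h) - f s - h *\<^sub>R f') / norm h"
    if "h \<noteq> 0" for h
  proof -
    have "(f (s + h) - f s) /\<^sub>R h - f' = (f (s + h) - f s - h *\<^sub>R f') /\<^sub>R h"
      using that by (simp add: scaleR_diff_right)
    then show ?thesis by (simp add: divide_inverse_commute)
  qed
  ultimately have "((\<lambda>h. norm (f (s + h) - f s - h *\<^sub>R f') / norm h) \<longlongrightarrow> 0) (at 0)"
    by (metis (no_types, lifting) LIM_equal)
  then show ?thesis
    unfolding has_vector_derivative_def has_derivative_at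
    by (simp add: bounded_linear_scaleR_left)
qed

text \<open>A class that contains polynomials composed with \<open>scaling_action\<close>, times
  \<open>scaling_weight\<close>, which polynomials themselves do not. Differentiability is required
  in the ambient matrix space, so that the chain rule applies to every curve through
  \<open>K\<close>; the Lipschitz bound on \<open>K\<close> supplies the domination for
  differentiating under the integral.\<close>

definition test_function :: "'a::euclidean_space set \<Rightarrow> ('a \<Rightarrow> real) \<Rightarrow> bool" where
  "test_function K \<psi> \<longleftrightarrow>
     \<psi> \<in> borel_measurable borel \<and> (\<forall>P\<in>K. \<psi> differentiable (at P)) \<and> (\<exists>L. L-lipschitz_on K \<psi>)"

lemma test_function_bounded:
  assumes "test_function K \<psi>" "bounded K"
  obtains B where "\<And>P. P \<in> K \<Longrightarrow> \<bar>\<psi> P\<bar> \<le> B" "B \<ge> 0"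
proof -
  obtain L where L: "L-lipschitz_on K \<psi>" using assms by (auto simp: test_function_def)
  from bounded_uniformly_continuous_image[OF lipschitz_on_uniformly_continuous[OF L] assms(2)]
  obtain B where B: "B > 0" "\<forall>x\<in>K. norm (\<psi> x) \<le> B"
    unfolding bounded_pos by auto
  then show ?thesis using that[of B] by auto
qed

lemma test_function_const: "test_function K (\<lambda>_. c)"
  unfolding test_function_def by (auto intro!: exI[of _ 0] lipschitz_on_constant)

lemma test_function_linear:
  assumes "bounded_linear \<psi>" shows "test_function K \<psi>"
  unfolding test_function_def
proof (intro conjI ballI)
  show "\<psi> \<in> borel_measurable borel"
    by (intro borel_measurable_continuous_onI linear_continuous_on assms)
  show "\<psi> differentiable at P" for P
    using assms by (rule bounded_linear_imp_differentiable)
  show "\<exists>L. L-lipschitz_on K \<psi>"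
    by (rule bounded_linear.lipschitz_boundE[OF assms, of K]) blast
qed

lemma test_function_add:
  assumes "test_function K \<psi>" "test_function K \<phi>"
  shows "test_function K (\<lambda>x. \<psi> x + \<phi> x)"
  unfolding test_function_def
proof (intro conjI ballI)
  show "(\<lambda>x. \<psi> x + \<phi> x) differentiable at P" if "P \<in> K" for P
    using assms that by (auto simp: test_function_def)
  show "(\<lambda>x. \<psi> x + \<phi> x) \<in> borel_measurable borel"
    using assms by (auto simp: test_function_def)
  show "\<exists>L. L-lipschitz_on K (\<lambda>x. \<psi> x + \<phi> x)"
    using assms lipschitz_on_add unfolding test_function_def by metis
qed

lemma test_function_mult:
  assumes "test_function K \<psi>" "test_function K \<phi>" "bounded K"
  shows "test_function K (\<lambda>x. \<psi> x * \<phi> x)"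
proof -
  obtain B where B: "\<And>P. P \<in> K \<Longrightarrow> \<bar>\<psi> P\<bar> \<le> B" "B \<ge> 0"
    using test_function_bounded assms by metis
  obtain B' where B': "\<And>P. P \<in> K \<Longrightarrow> \<bar>\<phi> P\<bar> \<le> B'" "B' \<ge> 0"
    using test_function_bounded assms by metis
  obtain L L' where L: "L-lipschitz_on K \<psi>" "L'-lipschitz_on K \<phi>"
    using assms by (auto simp: test_function_def)
  have "(B * L' + B' * L)-lipschitz_on K (\<lambda>x. \<psi> x * \<phi> x)"
  proof (rule lipschitz_onI)
    fix x y assume xy: "x \<in> K" "y \<in> K"
    have 1: "\<bar>\<psi> x - \<psi> y\<bar> \<le> L * dist x y" "\<bar>\<phi> x - \<phi> y\<bar> \<le> L' * dist x y"
      using lipschitz_onD[OF L(1) xy] lipschitz_onD[OF L(2) xy] by (auto simp: dist_real_def)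
    have "\<psi> x * \<phi> x - \<psi> y * \<phi> y = \<psi> x * (\<phi> x - \<phi> y) + \<phi> y * (\<psi> x - \<psi> y)" by (simp add: algebra_simps)
    then have "\<bar>\<psi> x * \<phi> x - \<psi> y * \<phi> y\<bar> \<le> \<bar>\<psi> x\<bar> * \<bar>\<phi> x - \<phi> y\<bar> + \<bar>\<phi> y\<bar> * \<bar>\<psi> x - \<psi> y\<bar>"
      by (metis abs_mult abs_triangle_ineq)
    also have "\<dots> \<le> B * (L' * dist x y) + B' * (L * dist x y)"
      using xy B B' 1 by (intro add_mono mult_mono) auto
    finally show "dist (\<psi> x * \<phi> x) (\<psi> y * \<phi> y) \<le> (B * L' + B' * L) * dist x y"
      by (simp add: dist_real_def algebra_simps)
  next
    show "0 \<le> B * L' + B' * L" using B B' lipschitz_on_nonneg[OF L(1)] lipschitz_on_nonneg[OF L(2)] by simp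
  qed
  moreover have "(\<lambda>x. \<psi> x * \<phi> x) \<in> borel_measurable borel"
    using assms by (auto simp: test_function_def)
  moreover have "(\<lambda>x. \<psi> x * \<phi> x) differentiable at P" if "P \<in> K" for P
    using assms that by (auto simp: test_function_def)
  ultimately show ?thesis unfolding test_function_def by blast
qed

lemma test_function_sum:
  assumes "\<And>i. i \<in> I \<Longrightarrow> test_function K (\<psi> i)"
  shows "test_function K (\<lambda>x. \<Sum>i\<in>I. \<psi> i x)"
  using assms
proof (induction I rule: infinite_finite_induct)
  case (insert x F)
  then show ?case by (auto intro: test_function_add)
qed (auto intro: test_function_const)

text \<open>By compactness the values of \<open>\<psi>\<close> lie in an interval bounded away from
  0, where the power function has a bounded derivative.\<close>

lemma test_function_powr:
  assumes \<psi>: "test_function K \<psi>" and pos: "\<And>x. x \<in> K \<Longrightarrow> \<psi> x > 0" and "compact K"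
  shows "test_function K (\<lambda>x. \<psi> x powr a)"
proof (cases "K = {}")
  case True
  then show ?thesis using \<psi> lipschitz_on_empty_iff[of 0] by (auto simp: test_function_def)
next
  case False
  obtain L where L: "L-lipschitz_on K \<psi>" using \<psi> by (auto simp: test_function_def)
  have cont: "continuous_on K \<psi>" using L lipschitz_on_continuous_on by blast
  obtain x0 where x0: "x0 \<in> K" "\<And>x. x \<in> K \<Longrightarrow> \<psi> x0 \<le> \<psi> x"
    using continuous_attains_inf[OF \<open>compact K\<close> False cont] by auto
  obtain x1 where x1: "x1 \<in> K" "\<And>x. x \<in> K \<Longrightarrow> \<psi> x \<le> \<psi> x1"
    using continuous_attains_sup[OF \<open>compact K\<close> False cont] by auto
  define J where "J = {\<psi> x0..\<psi> x1}"
  have Jpos: "y > 0" if "y \<in> J" for y using that pos[OF x0(1)] by (auto simp: J_def)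
  have "continuous_on J (\<lambda>y. a * y powr (a - 1))"
    using Jpos by (intro continuous_intros) (auto simp: less_le)
  then have "compact ((\<lambda>y. a * y powr (a - 1)) ` J)"
    by (intro compact_continuous_image) (auto simp: J_def)
  then obtain C where C: "C > 0" "\<And>y. y \<in> J \<Longrightarrow> norm (a * y powr (a - 1)) \<le> C"
    using compact_imp_bounded bounded_pos by (metis (no_types, lifting) imageI)
  have "C-lipschitz_on J (\<lambda>y. y powr a)"
  proof (rule bounded_derivative_imp_lipschitz)
    show "((\<lambda>y. y powr a) has_derivative (\<lambda>h. a * y powr (a - 1) * h)) (at y within J)" if "y \<in> J" for y
      using DERIV_subset[OF has_real_derivative_powr[OF Jpos[OF that], of a], of J]
      by (simp add: has_field_derivative_def)
    show "convex J" by (simp add: J_def)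
    show "onorm ((*) (a * y powr (a - 1))) \<le> C" if "y \<in> J" for y
      using C(2)[OF that] by (intro onorm_bound) (auto simp: abs_mult mult_right_mono C(1) less_imp_le)
  qed (use C in auto)
  then have "\<exists>L. L-lipschitz_on K (\<lambda>x. \<psi> x powr a)"
    using lipschitz_on_compose2[OF L lipschitz_on_subset[of C J "\<lambda>y. y powr a" "\<psi> ` K"]] x0 x1
    by (auto simp: J_def image_subset_iff)
  moreover have "(\<lambda>x. \<psi> x powr a) differentiable (at P)" if "P \<in> K" for P
  proof -
    obtain \<psi>' where "(\<psi> has_derivative \<psi>') (at P)" using \<psi> \<open>P \<in> K\<close> by (auto simp: test_function_def differentiable_def)
    from has_derivative_powr[OF this has_derivative_const[of a] pos[OF that]] show ?thesis
      by (auto simp: differentiable_def)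
  qed
  moreover have "(\<lambda>x. \<psi> x powr a) \<in> borel_measurable borel"
    using \<psi> by (auto simp: test_function_def)
  ultimately show ?thesis unfolding test_function_def by blast
qed

text \<open>Only the position and the velocity of the curve enter. This is what allows the scaling
  flow to be traded for rotations that have the same velocity.\<close>

lemma test_function_along_curve:
  fixes \<gamma> :: "real \<Rightarrow> 'a::euclidean_space"
  assumes "test_function K \<psi>" "\<gamma> s = P" "P \<in> K" "(\<gamma> has_vector_derivative H) (at s)"
  shows "((\<lambda>t. \<psi> (\<gamma> t)) has_real_derivative frechet_derivative \<psi> (at P) H) (at s)"
proof -
  have d: "(\<psi> has_derivative frechet_derivative \<psi> (at P)) (at (\<gamma> s))"
    using assms by (auto simp: test_function_def frechet_derivative_works[symmetric])
  have 1: "((\<lambda>t. \<psi> (\<gamma> t)) has_derivative (\<lambda>t. frechet_derivative \<psi> (at P) (t *\<^sub>R H))) (at s)"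
    using has_derivative_compose[OF assms(4)[unfolded has_vector_derivative_def] d] .
  have "frechet_derivative \<psi> (at P) (t *\<^sub>R H) = frechet_derivative \<psi> (at P) H * t" for t
    using linear_cmul[OF has_derivative_linear[OF d], of t H] by simp
  with 1 show ?thesis by (simp add: has_field_derivative_def)
qed

subsection \<open>Projection matrices and rotations\<close>

text \<open>The trace encodes the rank of a projection by a polynomial equation, so the set is
  visibly closed.\<close>

definition projection_matrices :: "nat \<Rightarrow> (real ^ 'n ^ 'n) set" where
  "projection_matrices k = {P. transpose P = P \<and> P ** P = P \<and> (\<Sum>i\<in>UNIV. P $ i $ i) = real k}"

lemma projection_matrices_iff:
  "P \<in> projection_matrices k \<longleftrightarrow>
     (\<forall>i j. P $ j $ i = P $ i $ j) \<and> (\<forall>i j. (\<Sum>l\<in>UNIV. P $ i $ l * P $ l $ j) = P $ i $ j) \<and>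
     (\<Sum>i\<in>UNIV. P $ i $ i) = real k"
  unfolding projection_matrices_def
  by (simp only: mem_Collect_eq vec_eq_iff transpose_def matrix_matrix_mult_def vec_lambda_beta)

text \<open>Symmetry and idempotence make \<open>P $ i $ i\<close> the sum of the squares of row
  \<open>i\<close>; all the bounds follow from this.\<close>

lemma projection_matrices_entries:
  assumes "P \<in> projection_matrices k"
  shows "P $ j $ i = P $ i $ j" "(\<Sum>l\<in>UNIV. P $ i $ l * P $ l $ j) = P $ i $ j"
    "(\<Sum>i\<in>UNIV. P $ i $ i) = real k" "0 \<le> P $ i $ i" "P $ i $ i \<le> 1" "\<bar>P $ i $ j\<bar> \<le> 1"
proof -
  show sym: "P $ j $ i = P $ i $ j" and idem: "(\<Sum>l\<in>UNIV. P $ i $ l * P $ l $ j) = P $ i $ j"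
    and "(\<Sum>i\<in>UNIV. P $ i $ i) = real k" for i j
    using assms unfolding projection_matrices_iff by blast+
  have sq: "(P $ i $ j)\<^sup>2 \<le> P $ i $ i" for i j
  proof -
    have "(P $ i $ j)\<^sup>2 = P $ i $ j * P $ j $ i" by (simp add: sym[of j i] power2_eq_square)
    also have "\<dots> \<le> (\<Sum>l\<in>UNIV. P $ i $ l * P $ l $ i)"
      by (rule member_le_sum[of j UNIV "\<lambda>l. P $ i $ l * P $ l $ i"]) (simp_all add: sym[of _ i])
    finally show ?thesis by (simp add: idem)
  qed
  show nonneg: "0 \<le> P $ i $ i" for i using sq[of i i] by (meson order_trans zero_le_power2)
  show le1: "P $ i $ i \<le> 1" for i
  proof (rule ccontr)
    assume "\<not> P $ i $ i \<le> 1"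
    then have "P $ i $ i * 1 < P $ i $ i * P $ i $ i" by (intro mult_strict_left_mono) auto
    with sq[of i i] show False by (simp add: power2_eq_square)
  qed
  show "\<bar>P $ i $ j\<bar> \<le> 1"
    using order_trans[OF sq[of i j] le1[of i]] by (simp add: abs_square_le_1)
qed

lemma norm_matrix_le:
  fixes A :: "real ^ 'm ^ 'n"
  assumes "\<And>i j. \<bar>A $ i $ j\<bar> \<le> C"
  shows "norm A \<le> real CARD('n) * real CARD('m) * C"
proof -
  have "norm (A $ i) \<le> real CARD('m) * C" for i
    using order_trans[OF norm_le_l1_cart sum_bounded_above[of UNIV "\<lambda>j. \<bar>A $ i $ j\<bar>" C]] assms
    by simp
  then have "(\<Sum>i\<in>UNIV. norm (A $ i)) \<le> real CARD('n) * (real CARD('m) * C)"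
    using sum_bounded_above[of UNIV "\<lambda>i. norm (A $ i)"] by simp
  moreover have "norm A \<le> (\<Sum>i\<in>UNIV. norm (A $ i))"
    unfolding norm_vec_def by (rule L2_set_le_sum) simp
  ultimately show ?thesis by (simp add: mult.assoc)
qed

lemma compact_projection_matrices: "compact (projection_matrices k :: (real ^ 'n ^ 'n) set)"
proof -
  have "bounded (projection_matrices k :: (real ^ 'n ^ 'n) set)"
    unfolding bounded_iff by (blast intro: norm_matrix_le projection_matrices_entries(6))
  moreover have "projection_matrices k =
     {P :: real ^ 'n ^ 'n. (\<forall>i j. P $ j $ i = P $ i $ j) \<and>
       (\<forall>i j. (\<Sum>l\<in>UNIV. P $ i $ l * P $ l $ j) = P $ i $ j) \<and> (\<Sum>i\<in>UNIV. P $ i $ i) = real k}" (is "_ = ?S")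
    using projection_matrices_iff by blast
  moreover have "closed ?S"
    by (intro closed_Collect_conj closed_Collect_all closed_Collect_eq continuous_intros)
  ultimately show ?thesis by (simp add: compact_eq_bounded_closed)
qed

lemma test_function_entry: "test_function K (\<lambda>P::real^'m^'n. P $ i $ j)"
  by (intro test_function_linear bounded_linear_compose[OF bounded_linear_vec_nth bounded_linear_vec_nth])

lemma sum_delta_mult:
  fixes f :: "'n::finite \<Rightarrow> real"
  shows "(\<Sum>m\<in>UNIV. (if j = m then 1 else 0) * f m) = f j" "(\<Sum>m\<in>UNIV. f m * (if j = m then 1 else 0)) = f j"
proof -
  have "(\<Sum>m\<in>UNIV. (if j = m then 1 else 0) * f m) = (\<Sum>m\<in>UNIV. if j = m then f m else 0)"
    "(\<Sum>m\<in>UNIV. f m * (if j = m then 1 else 0)) = (\<Sum>m\<in>UNIV. if j = m then f m else 0)"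
    by (rule sum.cong; simp)+
  then show "(\<Sum>m\<in>UNIV. (if j = m then 1 else 0) * f m) = f j" "(\<Sum>m\<in>UNIV. f m * (if j = m then 1 else 0)) = f j"
    by simp_all
qed
text \<open>Written as the identity plus multiples of \<open>sin \<theta>\<close> and
  \<open>cos \<theta> - 1\<close>, so that the derivative at 0 is the coefficient of the
  sine.\<close>

definition rotation_matrix :: "'n \<Rightarrow> 'n \<Rightarrow> real \<Rightarrow> real ^ 'n ^ 'n" where
  "rotation_matrix a b \<theta> = (\<chi> i j.
     (if i = j then 1 else 0) +
     sin \<theta> * ((if i = b \<and> j = a then 1 else 0) - (if i = a \<and> j = b then 1 else 0)) +
     (cos \<theta> - 1) * (if i = j \<and> (i = a \<or> i = b) then 1 else 0))"

lemma rotation_matrix_entry: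
  assumes "a \<noteq> b"
  shows "rotation_matrix a b \<theta> $ i $ j =
    (if i = j then (if i = a \<or> i = b then cos \<theta> else 1)
     else if i = b \<and> j = a then sin \<theta> else if i = a \<and> j = b then - sin \<theta> else 0)"
  using assms unfolding rotation_matrix_def vec_lambda_beta by (simp split: if_split)

lemma orthogonal_rotation_matrix:
  assumes "a \<noteq> b"
  shows "orthogonal_matrix (rotation_matrix a b \<theta>)"
proof -
  let ?Q = "rotation_matrix a b \<theta>"
  have "(\<Sum>l\<in>UNIV. ?Q $ l $ i * ?Q $ l $ j) = (if i = j then 1 else 0)" for i j
  proof -
    have "(\<Sum>l\<in>UNIV. ?Q $ l $ i * ?Q $ l $ j) =
      ?Q $ a $ i * ?Q $ a $ j + (?Q $ b $ i * ?Q $ b $ j + (\<Sum>l\<in>UNIV - {a} - {b}. ?Q $ l $ i * ?Q $ l $ j))"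
      using assms by (subst sum.remove[of UNIV a], simp, simp, subst sum.remove[of "UNIV - {a}" b], auto)
    also have "(\<Sum>l\<in>UNIV - {a} - {b}. ?Q $ l $ i * ?Q $ l $ j) =
       (\<Sum>l\<in>UNIV - {a} - {b}. if l = i then (if i = j then 1 else 0) else 0)"
      by (intro sum.cong) (auto simp: rotation_matrix_def)
    also have "\<dots> = (if i \<noteq> a \<and> i \<noteq> b \<and> i = j then 1 else 0)"
      by (subst sum.delta) auto
    also have "?Q $ a $ i * ?Q $ a $ j + (?Q $ b $ i * ?Q $ b $ j + \<dots>) = (if i = j then 1 else 0)"
      unfolding rotation_matrix_entry[OF assms]
      using assms sin_cos_squared_add3[of \<theta>] sin_cos_squared_add3[of \<theta>, unfolded add.commute[of "cos \<theta> * cos \<theta>"]]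
      by (cases "i = a"; cases "i = b"; cases "j = a"; cases "j = b"; simp)
    finally show ?thesis .
  qed
  then show ?thesis
    by (simp add: orthogonal_matrix vec_eq_iff matrix_matrix_mult_def transpose_def mat_def)
qed

lemma rotation_matrix_bounds:
  assumes "a \<noteq> b"
  shows "\<bar>rotation_matrix a b \<theta> $ i $ j - (if i = j then 1 else 0)\<bar> \<le> \<bar>\<theta>\<bar>"
    "\<bar>rotation_matrix a b \<theta> $ i $ j\<bar> \<le> 1"
proof -
  have s: "\<bar>sin \<theta>\<bar> \<le> \<bar>\<theta>\<bar>" by (rule abs_sin_x_le_abs_x)
  have "1 - cos \<theta> \<le> \<bar>\<theta>\<bar>"
  proof -
    have "1 - cos \<theta> = 2 * (sin (\<theta>/2) * sin (\<theta>/2))"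
      using cos_double_sin[of "\<theta>/2"] by (simp add: power2_eq_square)
    also have "sin (\<theta>/2) * sin (\<theta>/2) \<le> \<bar>\<theta>/2\<bar> * 1"
      using mult_mono[OF abs_sin_x_le_abs_x[of "\<theta>/2"] abs_sin_le_one[of "\<theta>/2"]] by (simp add: abs_mult_self)
    finally show ?thesis by simp
  qed
  then have c: "\<bar>cos \<theta> - 1\<bar> \<le> \<bar>\<theta>\<bar>" by (simp add: abs_le_iff)
  show "\<bar>rotation_matrix a b \<theta> $ i $ j - (if i = j then 1 else 0)\<bar> \<le> \<bar>\<theta>\<bar>"
    "\<bar>rotation_matrix a b \<theta> $ i $ j\<bar> \<le> 1"
    using s c unfolding rotation_matrix_entry[OF assms]
    by (cases "i = j"; simp_all only: if_True if_False simp_thms diff_0_right abs_minus_cancel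
        diff_self abs_zero abs_ge_zero abs_sin_le_one abs_cos_le_one abs_one order_refl zero_le_one
        split: if_split)+
qed

lemma rotation_matrix_0: "rotation_matrix a b 0 = mat 1"
  by (auto simp: rotation_matrix_def vec_eq_iff mat_def)

text \<open>The commutator \<open>A ** P - P ** A\<close>, where \<open>A\<close> has entry 1 at
  \<open>(b, a)\<close>, entry -1 at \<open>(a, b)\<close> and 0 elsewhere.\<close>

definition rotation_field :: "'n \<Rightarrow> 'n \<Rightarrow> real ^ 'n ^ 'n \<Rightarrow> real ^ 'n ^ 'n" where
  "rotation_field a b P = (\<chi> i j.
     (if i = b then P $ a $ j else 0) - (if i = a then P $ b $ j else 0) +
     ((if j = b then P $ i $ a else 0) - (if j = a then P $ i $ b else 0)))"

lemma conj_entry: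
  "(Q ** P ** transpose Q) $ i $ j = (\<Sum>l\<in>UNIV. \<Sum>m\<in>UNIV. Q $ i $ l * P $ l $ m * Q $ j $ (m::'n::finite))"
  by (simp add: matrix_matrix_mult_def transpose_def sum_distrib_right) (rule sum.swap)

lemma rotation_curve_derivative:
  fixes P :: "real ^ 'n ^ 'n"
  assumes "a \<noteq> b"
  shows "((\<lambda>\<theta>. rotation_matrix a b \<theta> ** P ** transpose (rotation_matrix a b \<theta>)) has_vector_derivative
           rotation_field a b P) (at 0)"
proof (rule has_vector_derivative_vec_componentwise)
  fix i j
  define D where "D i l = (if i = b \<and> l = a then 1 else 0) - (if i = a \<and> l = b then 1 else 0::real)" for i l
  have Q: "((\<lambda>\<theta>. rotation_matrix a b \<theta> $ i $ l) has_real_derivative D i l) (at 0)" for i l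
    unfolding rotation_matrix_def D_def vec_lambda_beta
    by (rule DERIV_cong, (rule derivative_intros)+) simp
  have "((\<lambda>\<theta>. \<Sum>l\<in>UNIV. \<Sum>m\<in>UNIV. rotation_matrix a b \<theta> $ i $ l * P $ l $ m * rotation_matrix a b \<theta> $ j $ m)
     has_real_derivative (\<Sum>l\<in>UNIV. \<Sum>m\<in>UNIV. D i l * P $ l $ m * (if j = m then 1 else 0) +
        D j m * ((if i = l then 1 else 0) * P $ l $ m))) (at 0)"
  proof (intro DERIV_sum)
    fix l m
    show "((\<lambda>\<theta>. rotation_matrix a b \<theta> $ i $ l * P $ l $ m * rotation_matrix a b \<theta> $ j $ m)
       has_real_derivative D i l * P $ l $ m * (if j = m then 1 else 0) +
        D j m * ((if i = l then 1 else 0) * P $ l $ m)) (at 0)"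
      using DERIV_mult[OF DERIV_cmult_right[OF Q[of i l], of "P $ l $ m"] Q[of j m]]
      by (simp add: rotation_matrix_0 mat_def)
  qed
  moreover have "(\<Sum>l\<in>UNIV. \<Sum>m\<in>UNIV. D i l * P $ l $ m * (if j = m then 1 else 0) +
        D j m * ((if i = l then 1 else 0) * P $ l $ m)) = (\<Sum>l\<in>UNIV. D i l * P $ l $ j) + (\<Sum>m\<in>UNIV. D j m * P $ i $ m)"
  proof -
    have "(\<Sum>l\<in>UNIV. \<Sum>m\<in>UNIV. D j m * ((if i = l then 1 else 0) * P $ l $ m)) = (\<Sum>m\<in>UNIV. D j m * P $ i $ m)"
      by (subst sum.swap) (simp only: sum_distrib_left[symmetric] sum_delta_mult)
    moreover have "(\<Sum>l\<in>UNIV. \<Sum>m\<in>UNIV. D i l * P $ l $ m * (if j = m then 1 else 0)) = (\<Sum>l\<in>UNIV. D i l * P $ l $ j)"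
      by (simp only: sum_delta_mult)
    ultimately show ?thesis by (simp add: sum.distrib)
  qed
  moreover have "(\<Sum>l\<in>UNIV. D i l * P $ l $ j) = (\<Sum>l\<in>UNIV. if l = a then (if i = b then P $ a $ j else 0) else 0) -
       (\<Sum>l\<in>UNIV. if l = b then (if i = a then P $ b $ j else 0) else 0)"
    unfolding sum_subtractf[symmetric] using assms by (intro sum.cong) (simp_all add: D_def)
  moreover have "(\<Sum>l\<in>UNIV. D j l * P $ i $ l) = (\<Sum>l\<in>UNIV. if l = a then (if j = b then P $ i $ a else 0) else 0) -
       (\<Sum>l\<in>UNIV. if l = b then (if j = a then P $ i $ b else 0) else 0)"
    unfolding sum_subtractf[symmetric] using assms by (intro sum.cong) (simp_all add: D_def)
  ultimately show "((\<lambda>\<theta>. (rotation_matrix a b \<theta> ** P ** transpose (rotation_matrix a b \<theta>)) $ i $ j)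
        has_real_derivative rotation_field a b P $ i $ j) (at 0)"
    unfolding conj_entry rotation_field_def vec_lambda_beta by (simp only: sum.delta finite_class.finite_UNIV UNIV_I if_True)
qed

text \<open>Each entry is a double sum of \<open>CARD('n)\<close> squared terms of size at most
  \<open>2 * \<bar>\<theta>\<bar>\<close>, and passing from entries to the norm costs the same
  factor again. What matters is that the constant is uniform in \<open>P\<close>.\<close>

lemma rotation_curve_lipschitz:
  fixes P :: "real ^ 'n ^ 'n"
  assumes "a \<noteq> b" "P \<in> projection_matrices k"
  shows "norm (rotation_matrix a b \<theta> ** P ** transpose (rotation_matrix a b \<theta>) - P)
     \<le> 2 * real CARD('n) ^ 4 * \<bar>\<theta>\<bar>"
proof -
  define Q where "Q = rotation_matrix a b \<theta>"
  have "\<bar>(Q ** P ** transpose Q - P) $ i $ j\<bar> \<le> real CARD('n) * (real CARD('n) * (2 * \<bar>\<theta>\<bar>))" for i j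
  proof -
    define \<delta> :: "'n \<Rightarrow> 'n \<Rightarrow> real" where "\<delta> i l = (if i = l then 1 else 0)" for i l
    have "P $ i $ j = (\<Sum>l\<in>UNIV. \<Sum>m\<in>UNIV. \<delta> i l * P $ l $ m * \<delta> j m)"
      by (simp only: \<delta>_def sum_delta_mult)
    then have "\<bar>(Q ** P ** transpose Q - P) $ i $ j\<bar> =
       \<bar>\<Sum>l\<in>UNIV. \<Sum>m\<in>UNIV. Q $ i $ l * P $ l $ m * Q $ j $ m - \<delta> i l * P $ l $ m * \<delta> j m\<bar>"
      by (simp add: conj_entry sum_subtractf)
    also have "\<dots> \<le> (\<Sum>l\<in>UNIV. \<Sum>m\<in>UNIV. \<bar>Q $ i $ l * P $ l $ m * Q $ j $ m - \<delta> i l * P $ l $ m * \<delta> j m\<bar>)"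
      by (intro order_trans[OF sum_abs] sum_mono sum_abs)
    also have "\<dots> \<le> (\<Sum>l\<in>(UNIV::'n set). \<Sum>m\<in>(UNIV::'n set). 2 * \<bar>\<theta>\<bar>)"
    proof (intro sum_mono)
      fix l m
      have alg: "x * p * y - u * p * v = p * ((x - u) * y + u * (y - v))" for x p y u v :: real
        by (simp add: algebra_simps)
      have "\<bar>Q $ i $ l * P $ l $ m * Q $ j $ m - \<delta> i l * P $ l $ m * \<delta> j m\<bar> =
        \<bar>P $ l $ m\<bar> * \<bar>(Q $ i $ l - \<delta> i l) * Q $ j $ m + \<delta> i l * (Q $ j $ m - \<delta> j m)\<bar>"
        by (subst alg) (simp only: abs_mult)
      also have "\<dots> \<le> 1 * (\<bar>\<theta>\<bar> * 1 + 1 * \<bar>\<theta>\<bar>)"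
      proof (rule mult_mono)
        have "\<bar>(Q $ i $ l - \<delta> i l) * Q $ j $ m\<bar> \<le> \<bar>\<theta>\<bar> * 1" "\<bar>\<delta> i l * (Q $ j $ m - \<delta> j m)\<bar> \<le> 1 * \<bar>\<theta>\<bar>"
          unfolding abs_mult \<delta>_def Q_def
          by (rule mult_mono; use rotation_matrix_bounds[OF assms(1), of \<theta>] in simp)+
        then show "\<bar>(Q $ i $ l - \<delta> i l) * Q $ j $ m + \<delta> i l * (Q $ j $ m - \<delta> j m)\<bar> \<le> \<bar>\<theta>\<bar> * 1 + 1 * \<bar>\<theta>\<bar>"
          by (rule order_trans[OF abs_triangle_ineq add_mono])
      qed (use projection_matrices_entries(6)[OF assms(2)] in simp_all)
      finally show "\<bar>Q $ i $ l * P $ l $ m * Q $ j $ m - \<delta> i l * P $ l $ m * \<delta> j m\<bar> \<le> 2 * \<bar>\<theta>\<bar>" by simp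
    qed
    finally show ?thesis by simp
  qed
  from norm_matrix_le[OF this] show ?thesis
    by (simp add: Q_def power4_eq_xxxx mult_ac)
qed

lemma conj_projection_matrices:
  assumes "orthogonal_matrix Q" "P \<in> projection_matrices k"
  shows "Q ** P ** transpose Q \<in> projection_matrices k"
proof -
  have tr: "(\<Sum>i\<in>UNIV. A $ i $ i) = trace A" for A :: "real^'n^'n" by (simp add: trace_def)
  have Q: "transpose Q ** Q = mat 1" using assms(1) by (simp add: orthogonal_matrix)
  have P: "transpose P = P" "P ** P = P" "trace P = real k"
    using assms(2) by (auto simp: projection_matrices_def tr)
  have "(Q ** P ** transpose Q) ** (Q ** P ** transpose Q) = Q ** P ** (transpose Q ** Q) ** P ** transpose Q"
    by (simp add: matrix_mul_assoc)
  also have "\<dots> = Q ** (P ** P) ** transpose Q" by (simp add: Q matrix_mul_assoc)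
  finally have 1: "(Q ** P ** transpose Q) ** (Q ** P ** transpose Q) = Q ** P ** transpose Q" by (simp add: P)
  have "trace (Q ** P ** transpose Q) = trace (transpose Q ** (Q ** P))"
    by (rule trace_mul_sym)
  also have "\<dots> = real k" by (simp add: matrix_mul_assoc Q P)
  finally have 2: "trace (Q ** P ** transpose Q) = real k" .
  show ?thesis unfolding projection_matrices_def tr
    using 1 2 by (simp add: matrix_transpose_mul P) (simp add: matrix_mul_assoc)
qed

text \<open>All that the analytic part needs of the Haar measure: a random projection matrix whose
  law is invariant under orthogonal conjugation. Matrices, unlike subspaces, live in a vector space
  in which one can differentiate.\<close>

locale projection_law = prob_space M for M :: "'a measure" +
  fixes X :: "'a \<Rightarrow> real ^ 'n ^ 'n" and k :: nat
  assumes X_measurable [measurable]: "X \<in> borel_measurable M"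
    and X_projection: "x \<in> space M \<Longrightarrow> X x \<in> projection_matrices k"
    and X_invariant: "orthogonal_matrix Q \<Longrightarrow>
      distr M borel (\<lambda>x. Q ** X x ** transpose Q) = distr M borel X"
begin

abbreviation "K \<equiv> projection_matrices k :: (real ^ 'n ^ 'n) set"

lemma integrable_test_function:
  assumes \<psi>: "test_function K \<psi>" and Y [measurable]: "Y \<in> borel_measurable M" and "\<And>x. x \<in> space M \<Longrightarrow> Y x \<in> K"
  shows "integrable M (\<lambda>x. \<psi> (Y x))"
proof -
  have [measurable]: "\<psi> \<in> borel_measurable borel" using \<psi> by (simp add: test_function_def)
  obtain B where "\<And>P. P \<in> K \<Longrightarrow> \<bar>\<psi> P\<bar> \<le> B"
    using test_function_bounded[OF \<psi> compact_imp_bounded[OF compact_projection_matrices]] by metis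
  with assms(3) show ?thesis
    by (intro integrable_const_bound[where B=B] AE_I2) auto
qed

text \<open>By invariance the integral of \<open>\<psi>\<close> over the rotated projection does not
  depend on the angle; differentiating under the integral at angle 0 gives the claim.\<close>

lemma integral_rotation_field:
  assumes \<psi>: "test_function K \<psi>"
  shows "integrable M (\<lambda>x. frechet_derivative \<psi> (at (X x)) (rotation_field a b (X x)))"
    and "(\<integral>x. frechet_derivative \<psi> (at (X x)) (rotation_field a b (X x)) \<partial>M) = 0"
proof -
  have "integrable M (\<lambda>x. frechet_derivative \<psi> (at (X x)) (rotation_field a b (X x))) \<and>
    (\<integral>x. frechet_derivative \<psi> (at (X x)) (rotation_field a b (X x)) \<partial>M) = 0"
  proof (cases "a = b")
    \<comment> \<open>The degenerate field is 0; including it lets later sums over \<open>b\<close>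
      run over all indices.\<close>
    case True
    have "rotation_field a b P = 0" for P using True by (simp add: rotation_field_def vec_eq_iff)
    moreover have "frechet_derivative \<psi> (at (X x)) 0 = 0" if "x \<in> space M" for x
      using \<psi> X_projection[OF that]
      by (intro linear_0 linear_frechet_derivative) (auto simp: test_function_def)
    ultimately show ?thesis by (simp cong: Bochner_Integration.integral_cong Bochner_Integration.integrable_cong)
  next
    case False
    have [measurable]: "\<psi> \<in> borel_measurable borel" using \<psi> by (simp add: test_function_def)
    obtain L where L: "L-lipschitz_on K \<psi>" using \<psi> by (auto simp: test_function_def)
    define Y where "Y \<theta> x = rotation_matrix a b \<theta> ** X x ** transpose (rotation_matrix a b \<theta>)" for \<theta> x
    have Y0: "Y 0 x = X x" for x by (simp add: Y_def rotation_matrix_0 transpose_mat)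
    have YK: "Y \<theta> x \<in> K" if "x \<in> space M" for \<theta> x
      unfolding Y_def by (intro conj_projection_matrices orthogonal_rotation_matrix X_projection False that)
    have Ym [measurable]: "Y \<theta> \<in> borel_measurable M" for \<theta>
    proof -
      have "continuous_on UNIV (\<lambda>P. rotation_matrix a b \<theta> ** P ** transpose (rotation_matrix a b \<theta>))"
        unfolding matrix_matrix_mult_def by (intro continuous_intros)
      from measurable_compose[OF X_measurable borel_measurable_continuous_onI[OF this]]
      show ?thesis by (simp add: Y_def[abs_def])
    qed
    have const: "(\<integral>x. \<psi> (Y \<theta> x) \<partial>M) = (\<integral>x. \<psi> (X x) \<partial>M)" for \<theta>
    proof -
      have "Y \<theta> = (\<lambda>x. rotation_matrix a b \<theta> ** X x ** transpose (rotation_matrix a b \<theta>))"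
        by (simp add: Y_def[abs_def])
      then have "distr M borel (Y \<theta>) = distr M borel X"
        using X_invariant[OF orthogonal_rotation_matrix[OF False, of \<theta>]] by simp
      from arg_cong[OF this, of "\<lambda>N. integral\<^sup>L N \<psi>"] show ?thesis
        by (simp add: integral_distr)
    qed
    note * = has_real_derivative_integral[where f="\<lambda>\<theta> x. \<psi> (Y \<theta> x)" and s=0 and \<delta>=1
        and f'="\<lambda>x. frechet_derivative \<psi> (at (X x)) (rotation_field a b (X x))"
        and C="L * (2 * real CARD('n) ^ 4)"]
    have deriv: "((\<lambda>\<theta>. \<psi> (Y \<theta> x)) has_real_derivative frechet_derivative \<psi> (at (X x)) (rotation_field a b (X x))) (at 0)"
      if "x \<in> space M" for x
      using rotation_curve_derivative[OF False, of "X x"] Y0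
      by (intro test_function_along_curve[OF \<psi>] X_projection that) (simp_all add: Y_def[abs_def])
    have bound: "\<bar>\<psi> (Y \<theta> x) - \<psi> (Y 0 x)\<bar> \<le> L * (2 * real CARD('n) ^ 4) * \<bar>\<theta> - 0\<bar>"
      if x: "x \<in> space M" for x \<theta>
    proof -
      have "\<bar>\<psi> (Y \<theta> x) - \<psi> (X x)\<bar> \<le> L * norm (Y \<theta> x - X x)"
        using lipschitz_onD[OF L YK[OF x] X_projection[OF x], of \<theta>] by (simp add: dist_real_def dist_norm)
      also have "\<dots> \<le> L * (2 * real CARD('n) ^ 4 * \<bar>\<theta>\<bar>)"
        unfolding Y_def
        by (intro mult_left_mono rotation_curve_lipschitz[OF False X_projection[OF x]] lipschitz_on_nonneg[OF L])
      finally show ?thesis by (simp add: Y0 mult.assoc)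
    qed
    have int: "integrable M (\<lambda>x. \<psi> (Y \<theta> x))" for \<theta>
      by (intro integrable_test_function \<psi> Ym YK)
    have 1: "integrable M (\<lambda>x. frechet_derivative \<psi> (at (X x)) (rotation_field a b (X x)))"
      by (rule *(1)[OF _ int deriv bound]) simp
    have "((\<lambda>\<theta>. \<integral>x. \<psi> (Y \<theta> x) \<partial>M) has_real_derivative
        (\<integral>x. frechet_derivative \<psi> (at (X x)) (rotation_field a b (X x)) \<partial>M)) (at 0)"
      by (rule *(2)[OF _ int deriv bound]) simp
    then have "(\<integral>x. frechet_derivative \<psi> (at (X x)) (rotation_field a b (X x)) \<partial>M) = 0"
      unfolding const using DERIV_unique DERIV_const by blast
    with 1 show ?thesis ..
  qed
  then show "integrable M (\<lambda>x. frechet_derivative \<psi> (at (X x)) (rotation_field a b (X x)))"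
    and "(\<integral>x. frechet_derivative \<psi> (at (X x)) (rotation_field a b (X x)) \<partial>M) = 0" by auto
qed

end

section \<open>The velocity of the scaling flow in terms of rotations\<close>

definition scaling_field :: "'n \<Rightarrow> real ^ 'n ^ 'n \<Rightarrow> real ^ 'n ^ 'n" where
  "scaling_field a P = (\<chi> i j.
     (if i = a then P $ a $ j else 0) + (if j = a then P $ i $ a else 0) - 2 * P $ i $ a * P $ a $ j)"

text \<open>Let \<open>D\<close> be the diagonal matrix unit at \<open>a\<close>, so that the
  scaling field is \<open>D P + P D - 2 P D P\<close>. The generators of
  \<open>rotation_field a b\<close>, weighted by \<open>P $ b $ a\<close>, add up to
  \<open>P D - D P\<close>, whose commutator with \<open>P\<close> is
  \<open>2 P D P - D P - P D\<close> because \<open>P\<close> is idempotent.\<close>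

lemma scaling_field_eq:
  assumes "P \<in> projection_matrices k"
  shows "scaling_field a P = - (\<Sum>b\<in>UNIV. P $ b $ a *\<^sub>R rotation_field a b P)"
proof (unfold vec_eq_iff, intro allI)
  fix i j
  note P = projection_matrices_entries(1,2)[OF assms]
  have 1: "(\<Sum>b\<in>UNIV. P $ b $ a * (if i = b then P $ a $ j else 0)) = P $ i $ a * P $ a $ j"
    using sum_delta_mult(2)[of "\<lambda>b. P $ b $ a * P $ a $ j" i]
    by (simp add: if_distrib[of "\<lambda>x. _ * x"] cong: if_cong)
  have 2: "(\<Sum>b\<in>UNIV. P $ b $ a * (if j = b then P $ i $ a else 0)) = P $ j $ a * P $ i $ a"
    using sum_delta_mult(2)[of "\<lambda>b. P $ b $ a * P $ i $ a" j]
    by (simp add: if_distrib[of "\<lambda>x. _ * x"] cong: if_cong)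
  have 3: "(\<Sum>b\<in>UNIV. P $ b $ a * (if i = a then P $ b $ j else 0)) = (if i = a then P $ a $ j else 0)"
    using P(2)[where i=a and j=j] by (simp add: P(1)[of _ a])
  have 4: "(\<Sum>b\<in>UNIV. P $ b $ a * (if j = a then P $ i $ b else 0)) = (if j = a then P $ i $ a else 0)"
    using P(2)[where i=i and j=a] by (simp add: mult.commute)
  have "(\<Sum>b\<in>UNIV. P $ b $ a *\<^sub>R rotation_field a b P) $ i $ j =
    (\<Sum>b\<in>UNIV. P $ b $ a * (if i = b then P $ a $ j else 0)) -
    (\<Sum>b\<in>UNIV. P $ b $ a * (if i = a then P $ b $ j else 0)) +
    ((\<Sum>b\<in>UNIV. P $ b $ a * (if j = b then P $ i $ a else 0)) -
    (\<Sum>b\<in>UNIV. P $ b $ a * (if j = a then P $ i $ b else 0)))"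
    unfolding sum_subtractf[symmetric] sum.distrib[symmetric]
    by (simp only: sum_component vector_scaleR_component rotation_field_def vec_lambda_beta real_scaleR_def
        ring_distribs)
  then show "scaling_field a P $ i $ j = (- (\<Sum>b\<in>UNIV. P $ b $ a *\<^sub>R rotation_field a b P)) $ i $ j"
    unfolding 1 2 3 4 by (simp add: scaling_field_def P(1)[of j a])
qed

context projection_law
begin

text \<open>Integration by parts: \<open>integral_rotation_field\<close> is applied to
  \<open>\<psi>\<close> times the coefficient \<open>P $ b $ a\<close> and summed over
  \<open>b\<close>. The derivative of that coefficient along its own field is
  \<open>P $ a $ a - P $ b $ b\<close>, and the sum of these, the divergence, is
  \<open>CARD('n) * P $ a $ a - k\<close> by the trace condition.\<close>

lemma integral_scaling_field:
  assumes \<psi>: "test_function K \<psi>"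
  shows "(\<integral>x. frechet_derivative \<psi> (at (X x)) (scaling_field a (X x))
             + (real k - real CARD('n) * X x $ a $ a) * \<psi> (X x) \<partial>M) = 0"
proof -
  define F where "F b P = \<psi> P * P $ b $ a" for b and P :: "real ^ 'n ^ 'n"
  have F: "test_function K (F b)" for b
    unfolding F_def[abs_def]
    by (intro test_function_mult \<psi> test_function_entry compact_imp_bounded compact_projection_matrices)
  have lin: "linear (frechet_derivative \<psi> (at P))" if "P \<in> K" for P
    using \<psi> that by (intro linear_frechet_derivative) (auto simp: test_function_def)
  have dF: "frechet_derivative (F b) (at P) (rotation_field a b P) =
      (P $ a $ a - P $ b $ b) * \<psi> P + P $ b $ a * frechet_derivative \<psi> (at P) (rotation_field a b P)"
    if "P \<in> K" for P b
  proof -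
    have 1: "(\<psi> has_derivative frechet_derivative \<psi> (at P)) (at P)"
      using \<psi> that by (auto simp: test_function_def frechet_derivative_works[symmetric])
    have 2: "((\<lambda>P. P $ b $ a) has_derivative (\<lambda>H. H $ b $ a)) (at P)"
      by (intro bounded_linear_imp_has_derivative bounded_linear_compose[OF bounded_linear_vec_nth bounded_linear_vec_nth])
    have "rotation_field a b P $ b $ a = P $ a $ a - P $ b $ b" by (auto simp: rotation_field_def)
    then show ?thesis
      using fun_cong[OF frechet_derivative_at[OF has_derivative_mult[OF 1 2]], of "rotation_field a b P", symmetric]
      by (simp add: F_def[abs_def] mult.commute)
  qed
  have "(\<Sum>b\<in>UNIV. frechet_derivative (F b) (at P) (rotation_field a b P)) =
     - (frechet_derivative \<psi> (at P) (scaling_field a P) + (real k - real CARD('n) * P $ a $ a) * \<psi> P)"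
    if P: "P \<in> K" for P
  proof -
    have "(\<Sum>b\<in>UNIV. frechet_derivative (F b) (at P) (rotation_field a b P)) =
      (\<Sum>b\<in>UNIV. P $ a $ a - P $ b $ b) * \<psi> P + (\<Sum>b\<in>UNIV. P $ b $ a * frechet_derivative \<psi> (at P) (rotation_field a b P))"
      by (simp add: dF[OF P] sum.distrib sum_distrib_right)
    also have "(\<Sum>b\<in>UNIV. P $ a $ a - P $ b $ b) = real CARD('n) * P $ a $ a - real k"
      by (simp add: sum_subtractf projection_matrices_entries(3)[OF P])
    also have "(\<Sum>b\<in>UNIV. P $ b $ a * frechet_derivative \<psi> (at P) (rotation_field a b P)) =
       - frechet_derivative \<psi> (at P) (scaling_field a P)"
      unfolding scaling_field_eq[OF P]
      by (simp add: linear_neg[OF lin[OF P]] linear_sum[OF lin[OF P]] linear_cmul[OF lin[OF P]])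
    finally show ?thesis by (simp add: algebra_simps)
  qed
  note sum_eq = this
  have "(\<integral>x. - (\<Sum>b\<in>UNIV. frechet_derivative (F b) (at (X x)) (rotation_field a b (X x))) \<partial>M) = 0"
    using integral_rotation_field[OF F] by (simp add: Bochner_Integration.integral_sum)
  then show ?thesis
    by (simp add: sum_eq X_projection add.commute cong: Bochner_Integration.integral_cong)
qed

end

subsection \<open>Scaling one coordinate\<close>

text \<open>The Gram determinant of the scaled vectors of an orthonormal basis of \<open>E\<close>:
  the square of the scaling matrix is the identity plus \<open>(t\<^sup>2 - 1)\<close> times a
  rank-one projection, so the determinant is that of a rank-one perturbation of the
  identity.\<close>

definition scaling_det :: "'n \<Rightarrow> real \<Rightarrow> real ^ 'n ^ 'n \<Rightarrow> real" where
  "scaling_det a t P = 1 + (t\<^sup>2 - 1) * P $ a $ a"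

definition scaling_factor :: "'n \<Rightarrow> real \<Rightarrow> 'n \<Rightarrow> real" where
  "scaling_factor a t i = (if i = a then t else 1)"

text \<open>The projection onto the image of a subspace under the scaling \<open>D\<close> along \<open>e\<close> is
  \<open>D (P - (t\<^sup>2 - 1) u u\<^sup>T / d) D\<close> with \<open>u = P e\<close> and \<open>d = scaling_det a t P\<close> (a Sherman--Morrison
  formula).  The exponent \<open>- 1\<close> in place of a division is convenient for \<open>test_function_powr\<close>;
  the two agree for \<open>d > 0\<close>.\<close>

definition scaling_action :: "'n \<Rightarrow> real \<Rightarrow> real ^ 'n ^ 'n \<Rightarrow> real ^ 'n ^ 'n" where
  "scaling_action a t P = (\<chi> i j. scaling_factor a t i * scaling_factor a t j *
     (P $ i $ j - (t\<^sup>2 - 1) * (P $ i $ a * P $ a $ j * scaling_det a t P powr (- 1))))"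

text \<open>Since \<open>scaling_det\<close> is the square of the factor J of the overview and
  \<open>t\<close> is the determinant of the scaling, this is J to the power
  \<open>- CARD('n)\<close> times the \<open>k\<close>-th power of the determinant.\<close>

definition scaling_weight :: "nat \<Rightarrow> 'n \<Rightarrow> real \<Rightarrow> real ^ 'n ^ 'n \<Rightarrow> real" where
  "scaling_weight k a t P = scaling_det a t P powr (- real CARD('n) / 2) * t powr real k"

text \<open>The diagonal entry lies between 0 and 1, so \<open>scaling_det\<close> is a convex
  combination of 1 and \<open>t\<^sup>2\<close>.\<close>

lemma scaling_det_ge:
  assumes "P \<in> projection_matrices k"
  shows "min 1 (t\<^sup>2) \<le> scaling_det a t P" "scaling_det a t P \<le> max 1 (t\<^sup>2)"
proof -
  note P = projection_matrices_entries[OF assms]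
  have "scaling_det a t P = (1 - P $ a $ a) * 1 + P $ a $ a * t\<^sup>2"
    by (simp add: scaling_det_def algebra_simps)
  moreover have "(1 - P $ a $ a) * min 1 (t\<^sup>2) + P $ a $ a * min 1 (t\<^sup>2) \<le> (1 - P $ a $ a) * 1 + P $ a $ a * t\<^sup>2"
    "(1 - P $ a $ a) * 1 + P $ a $ a * t\<^sup>2 \<le> (1 - P $ a $ a) * max 1 (t\<^sup>2) + P $ a $ a * max 1 (t\<^sup>2)"
    using P(4,5) by (intro add_mono mult_left_mono; simp)+
  ultimately show "min 1 (t\<^sup>2) \<le> scaling_det a t P" "scaling_det a t P \<le> max 1 (t\<^sup>2)"
    by (simp_all add: algebra_simps)
qed

lemma scaling_det_pos:
  assumes "P \<in> projection_matrices k" "t > 0"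
  shows "scaling_det a t P > 0"
proof -
  have "0 < min 1 (t\<^sup>2)" using assms(2) by simp
  then show ?thesis using scaling_det_ge(1)[OF assms(1), of t a] by linarith
qed

lemma scaling_action_entry:
  assumes "P \<in> projection_matrices k" "t > 0"
  shows "scaling_action a t P $ i $ j = scaling_factor a t i * scaling_factor a t j *
     (P $ i $ j - (t\<^sup>2 - 1) * (P $ i $ a * P $ a $ j) / scaling_det a t P)"
  using scaling_det_pos[OF assms, of a] by (simp add: scaling_action_def powr_minus divide_inverse mult.assoc)

text \<open>In row and column \<open>a\<close> the rank-one correction collapses to a division,
  since \<open>1 - (d - 1) / d = 1 / d\<close> for \<open>d = scaling_det a t P\<close>. The
  composition laws below rest on this.\<close>

lemma scaling_action_column:
  assumes "P \<in> projection_matrices k" "t > 0"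
  shows "scaling_action a t P $ i $ a = scaling_factor a t i * t * P $ i $ a / scaling_det a t P"
    "scaling_action a t P $ a $ i = scaling_factor a t i * t * P $ a $ i / scaling_det a t P"
proof -
  have d: "scaling_det a t P \<noteq> 0" using scaling_det_pos[OF assms, of a] by simp
  have "P $ i $ a - (t\<^sup>2 - 1) * (P $ i $ a * P $ a $ a) / scaling_det a t P = P $ i $ a / scaling_det a t P"
    "P $ a $ i - (t\<^sup>2 - 1) * (P $ a $ a * P $ a $ i) / scaling_det a t P = P $ a $ i / scaling_det a t P"
    using d by (simp_all add: field_simps) (simp_all add: scaling_det_def algebra_simps)
  then show "scaling_action a t P $ i $ a = scaling_factor a t i * t * P $ i $ a / scaling_det a t P"
    "scaling_action a t P $ a $ i = scaling_factor a t i * t * P $ a $ i / scaling_det a t P"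
    unfolding scaling_action_entry[OF assms] by (simp_all add: scaling_factor_def)
qed

lemma sum_scaling_factor:
  fixes f :: "'n::finite \<Rightarrow> real"
  shows "(\<Sum>i\<in>UNIV. (scaling_factor a t i)\<^sup>2 * f i) = (\<Sum>i\<in>UNIV. f i) + (t\<^sup>2 - 1) * f a"
  by (subst (1 2) sum.remove[of UNIV a]) (simp_all add: scaling_factor_def algebra_simps)

text \<open>A purely algebraic check for matrices, which keeps \<open>projection_law\<close>
  independent of subspaces. The squared scaling factors split each sum into the unscaled sum plus
  \<open>s\<close> times its term at \<open>a\<close>; idempotence of \<open>P\<close> evaluates the
  former.\<close>

lemma scaling_action_projection:
  assumes P: "P \<in> projection_matrices k" and t: "t > 0"
  shows "scaling_action a t P \<in> projection_matrices k"
proof -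
  define d s where "d = scaling_det a t P" and "s = t\<^sup>2 - 1"
  have d: "d > 0" unfolding d_def by (rule scaling_det_pos[OF P t])
  note e = projection_matrices_entries(1,2,3)[OF P]
  have deq: "s * P $ a $ a = d - 1" by (simp add: d_def s_def scaling_det_def)
  note entry = scaling_action_entry[OF P t, of a, folded d_def s_def]
  let ?\<tau> = "scaling_factor a t"
  show ?thesis unfolding projection_matrices_iff
  proof (intro conjI allI)
    show "scaling_action a t P $ j $ i = scaling_action a t P $ i $ j" for i j
      unfolding entry by (simp add: e(1)[of j i] e(1)[of j a] e(1)[of i a])
    show "(\<Sum>i\<in>UNIV. scaling_action a t P $ i $ i) = real k"
    proof -
      have col: "(\<Sum>i\<in>UNIV. P $ i $ a * P $ a $ i) = P $ a $ a"
        using e(2)[of a a] by (simp add: mult.commute)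
      have "(\<Sum>i\<in>UNIV. scaling_action a t P $ i $ i) =
          (\<Sum>i\<in>UNIV. (?\<tau> i)\<^sup>2 * (P $ i $ i - s / d * (P $ i $ a * P $ a $ i)))"
        unfolding entry by (simp add: power2_eq_square)
      also have "\<dots> = (\<Sum>i\<in>UNIV. P $ i $ i - s / d * (P $ i $ a * P $ a $ i)) +
          s * (P $ a $ a - s / d * (P $ a $ a * P $ a $ a))"
        unfolding sum_scaling_factor s_def ..
      also have "(\<Sum>i\<in>UNIV. P $ i $ i - s / d * (P $ i $ a * P $ a $ i)) = real k - s / d * P $ a $ a"
        unfolding sum_subtractf sum_distrib_left[symmetric] col e(3) ..
      also have "real k - s / d * P $ a $ a + s * (P $ a $ a - s / d * (P $ a $ a * P $ a $ a)) =
          real k + (s * P $ a $ a) * (1 - 1 / d - (s * P $ a $ a) / d)"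
        by (simp add: algebra_simps)
      also have "1 - 1 / d - (s * P $ a $ a) / d = 0"
        unfolding deq using d by (simp add: field_simps)
      finally show ?thesis by simp
    qed
    show "(\<Sum>l\<in>UNIV. scaling_action a t P $ i $ l * scaling_action a t P $ l $ j) = scaling_action a t P $ i $ j" for i j
    proof -
      have "(\<Sum>l\<in>UNIV. scaling_action a t P $ i $ l * scaling_action a t P $ l $ j) =
        ?\<tau> i * ?\<tau> j * (\<Sum>l\<in>UNIV. (?\<tau> l)\<^sup>2 * ((P $ i $ l - s / d * (P $ i $ a * P $ a $ l)) *
            (P $ l $ j - s / d * (P $ l $ a * P $ a $ j))))"
        unfolding entry sum_distrib_left by (intro sum.cong) (simp_all add: power2_eq_square)
      also have "(\<Sum>l\<in>UNIV. (?\<tau> l)\<^sup>2 * ((P $ i $ l - s / d * (P $ i $ a * P $ a $ l)) *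
            (P $ l $ j - s / d * (P $ l $ a * P $ a $ j)))) =
          (\<Sum>l\<in>UNIV. (P $ i $ l - s / d * (P $ i $ a * P $ a $ l)) *
            (P $ l $ j - s / d * (P $ l $ a * P $ a $ j))) + s * ((P $ i $ a - s / d * (P $ i $ a * P $ a $ a)) *
            (P $ a $ j - s / d * (P $ a $ a * P $ a $ j)))"
        unfolding sum_scaling_factor s_def ..
      also have "(\<Sum>l\<in>UNIV. (P $ i $ l - s / d * (P $ i $ a * P $ a $ l)) *
            (P $ l $ j - s / d * (P $ l $ a * P $ a $ j))) =
          (\<Sum>l\<in>UNIV. P $ i $ l * P $ l $ j) - s / d * P $ a $ j * (\<Sum>l\<in>UNIV. P $ i $ l * P $ l $ a)
          - s / d * P $ i $ a * (\<Sum>l\<in>UNIV. P $ a $ l * P $ l $ j)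
          + (s / d)\<^sup>2 * P $ i $ a * P $ a $ j * (\<Sum>l\<in>UNIV. P $ a $ l * P $ l $ a)"
        unfolding sum_distrib_left sum_subtractf[symmetric] sum.distrib[symmetric]
        by (intro sum.cong) (simp_all add: algebra_simps power2_eq_square)
      also have "\<dots> = P $ i $ j - 2 * (s / d) * (P $ i $ a * P $ a $ j) + (s / d)\<^sup>2 * P $ i $ a * P $ a $ j * P $ a $ a"
        unfolding e(2) by simp
      also have "P $ i $ j - 2 * (s / d) * (P $ i $ a * P $ a $ j) + (s / d)\<^sup>2 * P $ i $ a * P $ a $ j * P $ a $ a +
          s * ((P $ i $ a - s / d * (P $ i $ a * P $ a $ a)) * (P $ a $ j - s / d * (P $ a $ a * P $ a $ j))) =
          P $ i $ j + s * (P $ i $ a * P $ a $ j) * (- 2 / d + (s * P $ a $ a) / d\<^sup>2 + (1 - (s * P $ a $ a) / d)\<^sup>2)"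
        by (simp add: field_simps power2_eq_square)
      \<comment> \<open>With \<open>s * P $ a $ a = d - 1\<close> the last square is
        \<open>1 / d\<^sup>2\<close>, and the three terms leave exactly the coefficient of the
        original correction.\<close>
      also have "- 2 / d + (s * P $ a $ a) / d\<^sup>2 + (1 - (s * P $ a $ a) / d)\<^sup>2 = - 1 / d"
        unfolding deq using d by (simp add: field_simps power2_eq_square)
      finally show ?thesis unfolding entry by (simp add: mult.assoc)
    qed
  qed
qed

text \<open>The cocycle identity of J, squared; it makes the weights multiply along the
  flow.\<close>

lemma scaling_det_mult:
  assumes P: "P \<in> projection_matrices k" and t: "t > 0"
  shows "scaling_det a r (scaling_action a t P) * scaling_det a t P = scaling_det a (r * t) P"
proof -
  have d: "scaling_det a t P \<noteq> 0" using scaling_det_pos[OF assms, of a] by simp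
  have "scaling_det a r (scaling_action a t P) * scaling_det a t P =
     scaling_det a t P + (r\<^sup>2 - 1) * (t * t * P $ a $ a)"
    using d by (simp add: scaling_det_def[of a r] scaling_action_column[OF P t] scaling_factor_def field_simps)
  also have "\<dots> = scaling_det a (r * t) P" by (simp add: scaling_det_def power2_eq_square algebra_simps)
  finally show ?thesis .
qed

lemma scaling_action_mult:
  assumes P: "P \<in> projection_matrices k" and t: "t > 0" and r: "r > 0"
  shows "scaling_action a r (scaling_action a t P) = scaling_action a (r * t) P"
proof (unfold vec_eq_iff, intro allI)
  fix i j
  define d d' where "d = scaling_det a t P" and "d' = scaling_det a r (scaling_action a t P)"
  note Q = scaling_action_projection[OF P t, of a]
  have pos: "d > 0" "d' > 0"
    unfolding d_def d'_def using scaling_det_pos[OF P t] scaling_det_pos[OF Q r] by auto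
  have dd: "scaling_det a (r * t) P = d' * d" using scaling_det_mult[OF P t, of a r] by (simp add: d_def d'_def)
  have q: "d = 1 + (t\<^sup>2 - 1) * P $ a $ a" "d' * d = 1 + ((r * t)\<^sup>2 - 1) * P $ a $ a"
    using dd by (simp_all add: d_def scaling_det_def)
  have \<tau>: "scaling_factor a r i * scaling_factor a t i = scaling_factor a (r * t) i" for i
    by (simp add: scaling_factor_def)
  have rt: "r * t > 0" using r t by simp
  \<comment> \<open>Both corrections are multiples of the same rank-one term
    \<open>P $ i $ a * P $ a $ j\<close>, so the composition law reduces to this identity between
    their coefficients.\<close>
  have key: "(t\<^sup>2 - 1) / d + (r\<^sup>2 - 1) * t\<^sup>2 / (d\<^sup>2 * d') = ((r * t)\<^sup>2 - 1) / (d' * d)"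
  proof -
    have "(t\<^sup>2 - 1) * (d' * d) + (r\<^sup>2 - 1) * t\<^sup>2 = ((r * t)\<^sup>2 - 1) * d"
      unfolding q(2) unfolding q(1) by (simp add: algebra_simps power_mult_distrib)
    moreover have "A / d + B / (d\<^sup>2 * d') = (A * (d' * d) + B) / (d\<^sup>2 * d')" "C * d / (d\<^sup>2 * d') = C / (d' * d)" for A B C
      using pos by (simp_all add: field_simps power2_eq_square)
    ultimately show ?thesis by (simp only:)
  qed
  have "scaling_action a r (scaling_action a t P) $ i $ j = scaling_factor a r i * scaling_factor a r j *
     (scaling_factor a t i * scaling_factor a t j * (P $ i $ j - (t\<^sup>2 - 1) * (P $ i $ a * P $ a $ j) / d) -
      (r\<^sup>2 - 1) * ((scaling_factor a t i * t * P $ i $ a / d) * (scaling_factor a t j * t * P $ a $ j / d)) / d')"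
    unfolding scaling_action_entry[OF Q r] scaling_action_column[OF P t] scaling_action_entry[OF P t] d_def d'_def ..
  also have "\<dots> = (scaling_factor a r i * scaling_factor a t i) * (scaling_factor a r j * scaling_factor a t j) *
     (P $ i $ j - (P $ i $ a * P $ a $ j) * ((t\<^sup>2 - 1) / d + (r\<^sup>2 - 1) * t\<^sup>2 / (d\<^sup>2 * d')))"
    using pos by (simp add: field_simps power2_eq_square)
  also have "\<dots> = scaling_action a (r * t) P $ i $ j"
    unfolding key \<tau> scaling_action_entry[OF P rt] dd by (simp add: mult.commute)
  finally show "scaling_action a r (scaling_action a t P) $ i $ j = scaling_action a (r * t) P $ i $ j" .
qed

lemma scaling_weight_mult:
  assumes P: "P \<in> projection_matrices k" and t: "t > 0" and r: "r > 0"
  shows "scaling_weight m a r (scaling_action a t P) * scaling_weight m a t P = scaling_weight m a (r * t) P"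
proof -
  have pos: "scaling_det a t P > 0" "scaling_det a r (scaling_action a t P) > 0"
    using scaling_det_pos[OF P t] scaling_det_pos[OF scaling_action_projection[OF P t] r] by auto
  show ?thesis
    unfolding scaling_weight_def scaling_det_mult[OF P t, symmetric]
    using pos r t by (simp add: powr_mult)
qed

lemma scaling_one: "scaling_action a 1 P = P" "scaling_weight m a 1 P = 1" "scaling_det a 1 P = 1"
  by (simp_all add: scaling_action_def scaling_weight_def scaling_det_def scaling_factor_def vec_eq_iff)

lemma test_function_scaling_det:
  assumes "bounded K" shows "test_function K (scaling_det a t)"
  unfolding scaling_det_def[abs_def]
  by (rule test_function_add[OF test_function_const
        test_function_mult[OF test_function_const test_function_entry assms]])

lemma test_function_scaling_weight:
  assumes "t > 0"
  shows "test_function (projection_matrices k) (scaling_weight m a t)"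
proof -
  note c = compact_projection_matrices[of k]
  note b = compact_imp_bounded[OF c]
  show ?thesis
    unfolding scaling_weight_def[abs_def]
    by (rule test_function_mult[OF test_function_powr[OF test_function_scaling_det[OF b] _ c]
        test_function_const b]) (rule scaling_det_pos[OF _ assms])
qed

lemma test_function_scaling_action:
  assumes "t > 0"
  shows "test_function (projection_matrices k) (\<lambda>P. scaling_action a t P $ i $ j)"
proof -
  have b: "bounded (projection_matrices k :: (real ^ 'n ^ 'n) set)"
    by (intro compact_imp_bounded compact_projection_matrices)
  have "test_function (projection_matrices k) (\<lambda>P. scaling_factor a t i * scaling_factor a t j *
     (P $ i $ j + (- (t\<^sup>2 - 1)) * (P $ i $ a * P $ a $ j * scaling_det a t P powr (- 1))))"
    by (intro test_function_mult test_function_add test_function_const test_function_entry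
      test_function_powr test_function_scaling_det b compact_projection_matrices scaling_det_pos[OF _ assms])
  then show ?thesis
    by (simp only: scaling_action_def vec_lambda_beta diff_conv_add_uminus mult_minus_left)
qed

text \<open>Induction over polynomials; in the linear case the functional is expanded in matrix
  units, which leaves a combination of entries of \<open>scaling_action\<close>.\<close>

lemma test_function_polynomial_scaling_action:
  fixes a :: "'n::finite"
  assumes t: "t > 0" and "real_polynomial_function \<phi>"
  shows "test_function (projection_matrices k) (\<lambda>P. \<phi> (scaling_action a t P))"
  using assms(2)
proof (induction rule: real_polynomial_function.induct)
  case (linear f)
  have lin: "linear f" using linear by (rule bounded_linear.linear)
  define E where "E i j = axis i (axis j (1::real))" for i j :: 'n
  have f_eq: "f A = (\<Sum>i\<in>UNIV. \<Sum>j\<in>UNIV. A $ i $ j * f (E i j))" for A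
  proof -
    have "A = (\<Sum>i\<in>UNIV. \<Sum>j\<in>UNIV. A $ i $ j *\<^sub>R E i j)"
    proof (unfold vec_eq_iff, intro allI)
      fix l m
      have "(A $ i $ j *\<^sub>R E i j) $ l $ m = (if l = i then 1 else 0) * ((if m = j then 1 else 0) * A $ i $ j)" for i j
        by (simp add: E_def axis_def)
      then show "A $ l $ m = (\<Sum>i\<in>UNIV. \<Sum>j\<in>UNIV. A $ i $ j *\<^sub>R E i j) $ l $ m"
        by (simp only: sum_component sum_distrib_left[symmetric] sum_delta_mult)
    qed
    from arg_cong[OF this, of f] show ?thesis
      by (simp only: linear_sum[OF lin] linear_cmul[OF lin] real_scaleR_def)
  qed
  have "test_function (projection_matrices k)
      (\<lambda>P. \<Sum>i\<in>UNIV. \<Sum>j\<in>UNIV. scaling_action a t P $ i $ j * f (E i j))"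
    by (intro test_function_sum test_function_mult test_function_const
      test_function_scaling_action[OF t] compact_imp_bounded[OF compact_projection_matrices])
  moreover have "(\<lambda>P. f (scaling_action a t P)) =
      (\<lambda>P. \<Sum>i\<in>UNIV. \<Sum>j\<in>UNIV. scaling_action a t P $ i $ j * f (E i j))"
    by (rule ext) (rule f_eq)
  ultimately show ?case by (simp only:)
next
  case (mult f g)
  then show ?case by (intro test_function_mult compact_imp_bounded[OF compact_projection_matrices])
qed (auto intro: test_function_const test_function_add)

lemma scaling_action_derivative:
  fixes P :: "real ^ 'n ^ 'n"
  shows "((\<lambda>t. scaling_action a t P) has_vector_derivative scaling_field a P) (at 1)"
proof (rule has_vector_derivative_vec_componentwise)
  fix i j
  have \<tau>: "((\<lambda>t. scaling_factor a t i) has_real_derivative (if i = a then 1 else 0)) (at 1)" for i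
    by (simp add: scaling_factor_def)
  have d: "((\<lambda>t. scaling_det a t P) has_real_derivative 2 * P $ a $ a) (at 1)"
    unfolding scaling_det_def by (auto intro!: derivative_eq_intros)
  have d': "((\<lambda>t. scaling_det a t P powr (- 1)) has_real_derivative - 2 * P $ a $ a) (at 1)"
    using DERIV_fun_powr[OF d, of "- 1"] by (simp add: scaling_one mult.commute)
  have "((\<lambda>t. P $ i $ j - (t\<^sup>2 - 1) * (P $ i $ a * P $ a $ j * scaling_det a t P powr (- 1)))
     has_real_derivative - 2 * P $ i $ a * P $ a $ j) (at 1)"
    by (rule derivative_eq_intros d' refl)+ (simp_all add: scaling_one)
  note DERIV_mult[OF DERIV_mult[OF \<tau>[of i] \<tau>[of j]] this]
  then have "((\<lambda>t. scaling_action a t P $ i $ j) has_real_derivative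
      ((if i = a then 1 else 0) * scaling_factor a 1 j + (if j = a then 1 else 0) * scaling_factor a 1 i) *
      (P $ i $ j - (1\<^sup>2 - 1) * (P $ i $ a * P $ a $ j * scaling_det a 1 P powr (- 1))) +
      - 2 * P $ i $ a * P $ a $ j * (scaling_factor a 1 i * scaling_factor a 1 j)) (at 1)"
    unfolding scaling_action_def vec_lambda_beta .
  then show "((\<lambda>t. scaling_action a t P $ i $ j) has_real_derivative scaling_field a P $ i $ j) (at 1)"
    by (rule back_subst[of "\<lambda>D. (_ has_real_derivative D) (at 1)"])
      (simp add: scaling_field_def scaling_factor_def)
qed

text \<open>This value is minus the divergence found in \<open>integral_scaling_field\<close>; both
  exponents in \<open>scaling_weight\<close> are fixed by this cancellation.\<close>

lemma scaling_weight_derivative: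
  fixes P :: "real ^ 'n ^ 'n"
  shows "((\<lambda>t. scaling_weight k a t P) has_real_derivative real k - real CARD('n) * P $ a $ a) (at 1)"
proof -
  have d: "((\<lambda>t. scaling_det a t P) has_real_derivative 2 * P $ a $ a) (at 1)"
    unfolding scaling_det_def by (auto intro!: derivative_eq_intros)
  have "((\<lambda>t. scaling_det a t P powr (- real CARD('n) / 2)) has_real_derivative - real CARD('n) * P $ a $ a) (at 1)"
    using DERIV_fun_powr[OF d, of "- real CARD('n) / 2"] by (simp add: scaling_one)
  moreover have "((\<lambda>t::real. t powr real k) has_real_derivative real k) (at 1)"
    by (rule DERIV_cong[OF has_real_derivative_powr]) auto
  ultimately have "((\<lambda>t. scaling_weight k a t P) has_real_derivative
     - real CARD('n) * P $ a $ a * 1 powr real k + real k * scaling_det a 1 P powr (- real CARD('n) / 2)) (at 1)"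
    unfolding scaling_weight_def by (rule DERIV_mult)
  then show ?thesis by (simp add: scaling_one)
qed

lemma scaling_action_lipschitz_at_1:
  fixes P :: "real ^ 'n ^ 'n"
  assumes P: "P \<in> projection_matrices k" and t: "\<bar>t - 1\<bar> < 1 / 2"
  shows "norm (scaling_action a t P - P) \<le> 26 * real CARD('n) ^ 2 * \<bar>t - 1\<bar>"
proof -
  define h where "h = \<bar>t - 1\<bar>"
  have t': "1 / 2 < t" "t < 3 / 2" using t unfolding abs_less_iff by linarith+
  have s: "\<bar>t\<^sup>2 - 1\<bar> \<le> 5 / 2 * h"
  proof -
    have "\<bar>t\<^sup>2 - 1\<bar> = \<bar>t + 1\<bar> * h"
      unfolding h_def abs_mult[symmetric] by (simp add: power2_eq_square algebra_simps)
    also have "\<dots> \<le> 5 / 2 * h" using t' by (intro mult_right_mono) (auto simp: h_def)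
    finally show ?thesis .
  qed
  have d: "scaling_det a t P \<ge> 1 / 4"
  proof -
    have "(1 / 2)\<^sup>2 \<le> t\<^sup>2" using t' by (intro power_mono) auto
    then show ?thesis using scaling_det_ge(1)[OF P, of t a] by (simp add: power2_eq_square)
  qed
  note Pb = projection_matrices_entries(6)[OF P]
  \<comment> \<open>Any constant from \<open>5/2 + 9/4 * 10 = 25\<close> on would do:
    \<open>5/2\<close> bounds \<open>\<bar>t + 1\<bar>\<close>, \<open>9/4\<close> is the square of
    \<open>3/2\<close>, and \<open>10\<close> is \<open>5/2\<close> divided by the lower bound
    \<open>1/4\<close> of the determinant.\<close>
  have "\<bar>(scaling_action a t P - P) $ i $ j\<bar> \<le> 26 * h" for i j
  proof -
    define \<tau> x where "\<tau> = scaling_factor a t i * scaling_factor a t j"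
      and "x = (t\<^sup>2 - 1) * (P $ i $ a * P $ a $ j) / scaling_det a t P"
    have "\<bar>\<tau> - 1\<bar> \<le> 5 / 2 * h" "\<bar>\<tau>\<bar> \<le> 9 / 4"
    proof -
      have "t * t \<le> 3 / 2 * (3 / 2)" using t' by (intro mult_mono) auto
      then show "\<bar>\<tau>\<bar> \<le> 9 / 4"
        using t' by (auto simp: \<tau>_def scaling_factor_def abs_mult)
      show "\<bar>\<tau> - 1\<bar> \<le> 5 / 2 * h"
        using s by (auto simp: \<tau>_def scaling_factor_def h_def power2_eq_square)
    qed
    moreover have "\<bar>x\<bar> \<le> 10 * h"
    proof -
      have "\<bar>P $ i $ a * P $ a $ j\<bar> \<le> 1 * 1" unfolding abs_mult using Pb by (intro mult_mono) auto
      then have "\<bar>t\<^sup>2 - 1\<bar> * \<bar>P $ i $ a * P $ a $ j\<bar> \<le> 5 / 2 * h * 1"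
        using s by (intro mult_mono) (auto simp: h_def)
      then have "\<bar>t\<^sup>2 - 1\<bar> * \<bar>P $ i $ a * P $ a $ j\<bar> / scaling_det a t P \<le> (5 / 2 * h) / (1 / 4)"
        using d by (intro frac_le) (auto simp: h_def)
      then show ?thesis using d by (simp add: x_def abs_mult)
    qed
    moreover have "(scaling_action a t P - P) $ i $ j = (\<tau> - 1) * P $ i $ j - \<tau> * x"
      using t' by (simp add: scaling_action_entry[OF P] \<tau>_def x_def algebra_simps)
    moreover have "\<bar>\<tau> - 1\<bar> * \<bar>P $ i $ j\<bar> \<le> 5 / 2 * h * 1" "\<bar>\<tau>\<bar> * \<bar>x\<bar> \<le> 9 / 4 * (10 * h)"
      using calculation(1-3) Pb[of i j] by (intro mult_mono; simp add: h_def)+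
    moreover have "\<bar>(\<tau> - 1) * P $ i $ j - \<tau> * x\<bar> \<le> \<bar>\<tau> - 1\<bar> * \<bar>P $ i $ j\<bar> + \<bar>\<tau>\<bar> * \<bar>x\<bar>"
      unfolding abs_mult[symmetric] by (rule abs_triangle_ineq4)
    ultimately have "\<bar>(scaling_action a t P - P) $ i $ j\<bar> \<le> 5 / 2 * h * 1 + 9 / 4 * (10 * h)"
      by linarith
    then show ?thesis by (simp add: h_def)
  qed
  from norm_matrix_le[OF this] show ?thesis by (simp add: h_def power2_eq_square mult_ac)
qed

lemma borel_measurable_matrixI:
  fixes F :: "'a \<Rightarrow> real ^ 'm ^ 'n"
  assumes "\<And>i j. (\<lambda>x. F x $ i $ j) \<in> borel_measurable M"
  shows "F \<in> borel_measurable M"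
  unfolding borel_measurable_euclidean_space[of F]
proof
  fix b :: "real ^ 'm ^ 'n" assume "b \<in> Basis"
  then obtain i j where "b = axis i (axis j 1)" by (auto simp: Basis_vec_def)
  then show "(\<lambda>x. F x \<bullet> b) \<in> borel_measurable M" using assms by (simp add: inner_axis)
qed

lemma borel_measurable_scaling_action [measurable]:
  assumes "t > 0" shows "scaling_action a t \<in> borel_measurable borel"
  using test_function_scaling_action[OF assms] unfolding test_function_def
  by (intro borel_measurable_matrixI) blast

lemma borel_measurable_scaling_weight [measurable]:
  assumes "t > 0" shows "scaling_weight k a t \<in> borel_measurable borel"
  using test_function_scaling_weight[OF assms] unfolding test_function_def by blast

lemma scaling_weight_nonneg: "scaling_weight k a t P \<ge> 0"
  by (simp add: scaling_weight_def)

lemma powr_lipschitz: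
  fixes c C a :: real assumes "0 < c"
  obtains L where "L-lipschitz_on {c..C} (\<lambda>y. y powr a)" "L \<ge> 0"
proof -
  have "test_function {c..C} (\<lambda>y. y powr a)"
    using assms by (intro test_function_powr test_function_linear bounded_linear_ident) auto
  then show ?thesis using that lipschitz_on_nonneg unfolding test_function_def by blast
qed

lemma scaling_weight_lipschitz_at_1:
  obtains C where
    "\<And>P t. P \<in> projection_matrices k \<Longrightarrow> \<bar>t - 1\<bar> < 1 / 2 \<Longrightarrow> \<bar>scaling_weight m a t P - 1\<bar> \<le> C * \<bar>t - 1\<bar>"
    "C \<ge> 0"
proof -
  let ?p = "- real CARD('a) / 2"
  \<comment> \<open>For \<open>t\<close> within \<open>1/2\<close> of 1 this interval contains both
    \<open>t\<close> and the determinant, which lies between \<open>1/4\<close> and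
    \<open>9/4\<close>.\<close>
  obtain L where L: "L-lipschitz_on {1/4..4::real} (\<lambda>y. y powr ?p)" "L \<ge> 0"
    using powr_lipschitz[of "1/4"] by auto
  obtain L' where L': "L'-lipschitz_on {1/4..4::real} (\<lambda>y. y powr real m)" "L' \<ge> 0"
    using powr_lipschitz[of "1/4"] by auto
  have "\<bar>scaling_weight m a t P - 1\<bar> \<le> (L * (5 / 2) * (1 + L') + L') * \<bar>t - 1\<bar>"
    if P: "P \<in> projection_matrices k" and t: "\<bar>t - 1\<bar> < 1 / 2" for P t
  proof -
    define h where "h = \<bar>t - 1\<bar>"
    have t': "1 / 2 < t" "t < 3 / 2" using t unfolding abs_less_iff by linarith+
    have h: "0 \<le> h" "h \<le> 1" using t by (auto simp: h_def)
    have "(1 / 2)\<^sup>2 \<le> t\<^sup>2" "t\<^sup>2 \<le> (3 / 2)\<^sup>2" using t' by (intro power_mono; simp)+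
    then have d: "scaling_det a t P \<in> {1/4..4}"
      using scaling_det_ge[OF P, where t=t and a=a] unfolding min_def max_def
      by (auto simp: power2_eq_square split: if_splits)
    have s: "\<bar>scaling_det a t P - 1\<bar> \<le> 5 / 2 * h"
    proof -
      have "\<bar>scaling_det a t P - 1\<bar> = \<bar>t + 1\<bar> * h * P $ a $ a"
        unfolding h_def abs_mult[symmetric] scaling_det_def
        using projection_matrices_entries(4)[OF P, of a]
        by (simp add: abs_mult) (simp add: abs_mult[symmetric] power2_eq_square algebra_simps)
      also have "\<dots> \<le> 5 / 2 * h * 1" using t' h projection_matrices_entries(4,5)[OF P, of a]
        by (intro mult_mono) auto
      finally show ?thesis by simp
    qed
    define A B where "A = scaling_det a t P powr ?p" and "B = t powr real m"
    have A: "\<bar>A - 1\<bar> \<le> L * (5 / 2 * h)"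
      using lipschitz_onD[OF L(1) d, of 1] mult_left_mono[OF s L(2)] by (simp add: A_def dist_real_def)
    have B: "\<bar>B - 1\<bar> \<le> L' * h"
      using lipschitz_onD[OF L'(1), of t 1] t' by (simp add: B_def dist_real_def h_def)
    have "L' * h \<le> L' * 1" using L'(2) h by (intro mult_left_mono)
    with B have B': "\<bar>B\<bar> \<le> 1 + L'" by linarith
    have "A * B - 1 = (A - 1) * B + (B - 1)" by (simp add: algebra_simps)
    then have "\<bar>A * B - 1\<bar> \<le> \<bar>A - 1\<bar> * \<bar>B\<bar> + \<bar>B - 1\<bar>" by (metis abs_mult abs_triangle_ineq)
    moreover have "\<bar>A - 1\<bar> * \<bar>B\<bar> \<le> (L * (5 / 2 * h)) * (1 + L')"
      using A B' L(2) h by (intro mult_mono) auto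
    ultimately have "\<bar>A * B - 1\<bar> \<le> (L * (5 / 2 * h)) * (1 + L') + L' * h" using B by linarith
    also have "\<dots> = (L * (5 / 2) * (1 + L') + L') * h" by (simp add: algebra_simps)
    finally show ?thesis by (simp only: A_def B_def scaling_weight_def h_def)
  qed
  then show ?thesis using that[of "L * (5 / 2) * (1 + L') + L'"] L L' by simp
qed

section \<open>Weighted integrals along the scaling flow\<close>

context projection_law
begin

text \<open>The product rule under the integral produces exactly the integrand of
  \<open>integral_scaling_field\<close>.\<close>

lemma scaling_integral_derivative_at_1:
  assumes \<psi>: "test_function K \<psi>"
  shows "((\<lambda>t. \<integral>x. \<psi> (scaling_action a t (X x)) * scaling_weight k a t (X x) \<partial>M) has_real_derivative 0) (at 1)"
proof -
  have [measurable]: "\<psi> \<in> borel_measurable borel" using \<psi> by (simp add: test_function_def)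
  obtain L where L: "L-lipschitz_on K \<psi>" using \<psi> by (auto simp: test_function_def)
  have L0: "L \<ge> 0" using L by (rule lipschitz_on_nonneg)
  obtain B where B: "\<And>P. P \<in> K \<Longrightarrow> \<bar>\<psi> P\<bar> \<le> B" "B \<ge> 0"
    using test_function_bounded[OF \<psi> compact_imp_bounded[OF compact_projection_matrices]] by metis
  obtain C where C: "\<And>P t. P \<in> K \<Longrightarrow> \<bar>t - 1\<bar> < 1 / 2 \<Longrightarrow> \<bar>scaling_weight k a t P - 1\<bar> \<le> C * \<bar>t - 1\<bar>" "C \<ge> 0"
    using scaling_weight_lipschitz_at_1 by metis
  define f where "f t x = \<psi> (scaling_action a t (X x)) * scaling_weight k a t (X x)" for t x
  define D where "D = (26 * real CARD('n) ^ 2)"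
  have bound: "\<bar>f t x - f 1 x\<bar> \<le> (B * C + L * D) * \<bar>t - 1\<bar>" if x: "x \<in> space M" and t: "\<bar>t - 1\<bar> < 1 / 2" for x t
  proof -
    have t0: "t > 0" using t unfolding abs_less_iff by linarith
    note XK = X_projection[OF x]
    note Q = scaling_action_projection[OF XK t0, of a]
    define u v w where "u = \<psi> (scaling_action a t (X x))" and "v = \<psi> (X x)" and "w = scaling_weight k a t (X x)"
    have 1: "\<bar>w - 1\<bar> \<le> C * \<bar>t - 1\<bar>" unfolding w_def by (rule C(1)[OF XK t])
    have "\<bar>u - v\<bar> \<le> L * norm (scaling_action a t (X x) - X x)"
      using lipschitz_onD[OF L Q XK] by (simp add: u_def v_def dist_real_def dist_norm)
    also have "\<dots> \<le> L * (D * \<bar>t - 1\<bar>)"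
      unfolding D_def by (intro mult_left_mono scaling_action_lipschitz_at_1[OF XK t] L0)
    finally have 2: "\<bar>u - v\<bar> \<le> L * (D * \<bar>t - 1\<bar>)" .
    have 3: "\<bar>u\<bar> \<le> B" unfolding u_def by (rule B(1)[OF Q])
    have "u * w - v = u * (w - 1) + (u - v)" by (simp add: algebra_simps)
    then have "\<bar>u * w - v\<bar> \<le> \<bar>u\<bar> * \<bar>w - 1\<bar> + \<bar>u - v\<bar>" by (metis abs_mult abs_triangle_ineq)
    moreover have "\<bar>u\<bar> * \<bar>w - 1\<bar> \<le> B * (C * \<bar>t - 1\<bar>)" using 1 3 B(2) by (intro mult_mono) auto
    ultimately show ?thesis using 2 by (simp add: f_def u_def v_def w_def scaling_one algebra_simps)
  qed
  \<comment> \<open>The composition of a general \<open>\<psi>\<close> with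
    \<open>scaling_action\<close> has not been shown to be a test function, so integrability is
    drawn from the bound on the distance to \<open>f 1\<close>.\<close>
  have int: "integrable M (f t)" if t: "\<bar>t - 1\<bar> < 1 / 2" for t
  proof (rule integrable_const_bound[where B="(B * C + L * D) + B"])
    have t0: "t > 0" using t unfolding abs_less_iff by linarith
    show "f t \<in> borel_measurable M"
      unfolding f_def using t0 by measurable
    show "AE x in M. norm (f t x) \<le> (B * C + L * D) + B"
    proof (rule AE_I2)
      fix x assume x: "x \<in> space M"
      have "(B * C + L * D) * \<bar>t - 1\<bar> \<le> (B * C + L * D) * 1"
        using B(2) C(2) L0 t by (intro mult_left_mono) (auto simp: D_def)
      moreover have "\<bar>f 1 x\<bar> \<le> B" using B(1)[OF X_projection[OF x]] by (simp add: f_def scaling_one)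
      ultimately show "norm (f t x) \<le> (B * C + L * D) + B" using bound[OF x t] by simp
    qed
  qed
  have deriv: "((\<lambda>t. f t x) has_real_derivative
      frechet_derivative \<psi> (at (X x)) (scaling_field a (X x)) + (real k - real CARD('n) * X x $ a $ a) * \<psi> (X x)) (at 1)"
    if x: "x \<in> space M" for x
    using DERIV_mult[OF test_function_along_curve[OF \<psi> scaling_one(1) X_projection[OF x] scaling_action_derivative]
        scaling_weight_derivative[of k a "X x"]]
    by (simp add: f_def scaling_one)
  have "((\<lambda>t. \<integral>x. f t x \<partial>M) has_real_derivative (\<integral>x. frechet_derivative \<psi> (at (X x)) (scaling_field a (X x)) +
      (real k - real CARD('n) * X x $ a $ a) * \<psi> (X x) \<partial>M)) (at 1)"
    by (rule has_real_derivative_integral(2)[OF _ int deriv bound, where \<delta>="1/2"]) simp_all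
  then show ?thesis unfolding integral_scaling_field[OF \<psi>] f_def .
qed

text \<open>The flow property carries the vanishing derivative at 1 to every \<open>t > 0\<close>,
  so the integral is constant in \<open>t\<close> and equals its value at
  \<open>t = 1\<close>.\<close>

lemma integral_polynomial_scaling:
  assumes \<phi>: "real_polynomial_function \<phi>" and "t > 0"
  shows "(\<integral>x. \<phi> (scaling_action a t (X x)) * scaling_weight k a t (X x) \<partial>M) = (\<integral>x. \<phi> (X x) \<partial>M)"
proof -
  define G where "G t = (\<integral>x. \<phi> (scaling_action a t (X x)) * scaling_weight k a t (X x) \<partial>M)" for t
  have "(G has_real_derivative 0) (at t)" if t: "t > 0" for t
  proof -
    \<comment> \<open>Absorbing the first stage of the flow, together with its weight, into the test
      function turns the integral at \<open>t * r\<close> into one at \<open>r\<close>. This is the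
      place where polynomials alone would not suffice.\<close>
    define \<psi> where "\<psi> P = \<phi> (scaling_action a t P) * scaling_weight k a t P" for P
    have "test_function K \<psi>"
      unfolding \<psi>_def[abs_def]
      by (intro test_function_mult test_function_polynomial_scaling_action test_function_scaling_weight t \<phi>
          compact_imp_bounded[OF compact_projection_matrices])
    note D = scaling_integral_derivative_at_1[OF this, of a]
    have eq: "(\<integral>x. \<psi> (scaling_action a r (X x)) * scaling_weight k a r (X x) \<partial>M) = G (t * r)" if r: "r > 0" for r
      unfolding G_def
    proof (rule Bochner_Integration.integral_cong[OF refl])
      fix x assume x: "x \<in> space M"
      note XK = X_projection[OF x]
      show "\<psi> (scaling_action a r (X x)) * scaling_weight k a r (X x) =
        \<phi> (scaling_action a (t * r) (X x)) * scaling_weight k a (t * r) (X x)"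
        unfolding \<psi>_def scaling_action_mult[OF XK r t] scaling_weight_mult[OF XK r t, symmetric]
        by (simp only: mult.assoc)
    qed
    have "((\<lambda>r. G (t * r)) has_real_derivative 0) (at 1)"
    proof (rule has_field_derivative_transform_within_open[OF D])
      show "open {0<..<2::real}" "1 \<in> {0<..<2::real}" by auto
    qed (use eq in auto)
    \<comment> \<open>The point 1 is written as \<open>t / t\<close> so that the chain rule with
      inner function \<open>s / t\<close>, taken at \<open>s = t\<close>, undoes the factor
      \<open>t\<close>.\<close>
    then have "((\<lambda>r. G (t * r)) has_real_derivative 0) (at (t / t))" using t by simp
    from DERIV_chain2[where f="\<lambda>r. G (t * r)" and g="\<lambda>s. s / t", OF this DERIV_cdivide[OF DERIV_ident]]
    show ?thesis using t by simp
  qed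
  then have "\<exists>c. \<forall>x\<in>{0<..}. G x = c"
    by (intro has_field_derivative_zero_constant) (auto intro: has_field_derivative_at_within)
  then have "G t = G 1" using \<open>t > 0\<close> by force
  then show ?thesis by (simp add: G_def scaling_one)
qed

end

text \<open>Stone-Weierstrass on \<open>K\<close> passes from polynomials to continuous functions;
  cut-offs built from the distance pass on to closed sets, which form an intersection-stable
  generator of the Borel sets.\<close>

lemma measure_eqI_polynomial:
  fixes N N' :: "'a::euclidean_space measure"
  assumes N: "finite_measure N" "sets N = sets borel" "AE x in N. x \<in> K"
    and N': "finite_measure N'" "sets N' = sets borel" "AE x in N'. x \<in> K"
    and "compact K"
    and eq: "\<And>\<phi>. real_polynomial_function \<phi> \<Longrightarrow> (\<integral>x. \<phi> x \<partial>N) = (\<integral>x. \<phi> x \<partial>N')"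
  shows "N = N'"
proof -
  interpret N: finite_measure N by (rule N)
  interpret N': finite_measure N' by (rule N')
  have [measurable_cong]: "sets N = sets borel" "sets N' = sets borel" using N N' by auto
  have int: "integrable N f" "integrable N' f" if f: "continuous_on UNIV f" for f :: "'a \<Rightarrow> real"
  proof -
    have [measurable]: "f \<in> borel_measurable borel" using f by (rule borel_measurable_continuous_onI)
    have "bounded (f ` K)"
      by (intro compact_imp_bounded compact_continuous_image continuous_on_subset[OF f] \<open>compact K\<close>) auto
    then obtain B where "\<forall>x\<in>K. norm (f x) \<le> B" unfolding bounded_iff by auto
    then have "AE x in N. norm (f x) \<le> B" "AE x in N'. norm (f x) \<le> B"
      using N(3) N'(3) by (fast elim!: eventually_mono)+
    moreover have "f \<in> borel_measurable N" "f \<in> borel_measurable N'" by measurable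
    ultimately show "integrable N f" "integrable N' f"
      by (blast intro: N.integrable_const_bound N'.integrable_const_bound)+
  qed
  have cont_eq: "(\<integral>x. f x \<partial>N) = (\<integral>x. f x \<partial>N')" if f: "continuous_on UNIV f" for f :: "'a \<Rightarrow> real"
  proof -
    have close: "\<bar>(\<integral>x. f x \<partial>N) - (\<integral>x. f x \<partial>N')\<bar> \<le> e * (measure N UNIV + measure N' UNIV)" if "e > 0" for e
    proof -
      obtain g where g: "real_polynomial_function g" "\<And>x. x \<in> K \<Longrightarrow> \<bar>f x - g x\<bar> < e"
        by (rule Stone_Weierstrass_real_polynomial_function[OF \<open>compact K\<close>
              continuous_on_subset[OF f subset_UNIV] \<open>e > 0\<close>]) blast
      have gc: "continuous_on UNIV g"
        using g(1) by (simp add: continuous_on_polymonial_function real_polynomial_function_eq)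
      have b: "\<bar>(\<integral>x. f x \<partial>L) - (\<integral>x. g x \<partial>L)\<bar> \<le> e * measure L UNIV"
        if L: "finite_measure L" "sets L = sets borel" "AE x in L. x \<in> K" "integrable L f" "integrable L g" for L
      proof -
        interpret L: finite_measure L by (rule L)
        have sp: "space L = UNIV" using sets_eq_imp_space_eq[OF L(2)] by simp
        have "\<bar>(\<integral>x. f x \<partial>L) - (\<integral>x. g x \<partial>L)\<bar> = \<bar>\<integral>x. f x - g x \<partial>L\<bar>" using L by simp
        also have "\<dots> \<le> (\<integral>x. \<bar>f x - g x\<bar> \<partial>L)" by (rule integral_abs_bound)
        also have "\<dots> \<le> (\<integral>x. e \<partial>L)"
        proof (rule integral_mono_AE)
          show "AE x in L. \<bar>f x - g x\<bar> \<le> e"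
            using L(3) by (rule eventually_mono) (rule less_imp_le[OF g(2)])
        qed (use L(4,5) in simp_all)
        finally show ?thesis by (simp add: sp mult.commute)
      qed
      have "\<bar>(\<integral>x. f x \<partial>N) - (\<integral>x. g x \<partial>N)\<bar> \<le> e * measure N UNIV"
        by (rule b[OF N int(1)[OF f] int(1)[OF gc]])
      moreover have "\<bar>(\<integral>x. f x \<partial>N') - (\<integral>x. g x \<partial>N')\<bar> \<le> e * measure N' UNIV"
        by (rule b[OF N' int(2)[OF f] int(2)[OF gc]])
      ultimately show ?thesis using eq[OF g(1)] by (simp add: algebra_simps)
    qed
    show ?thesis
    proof (rule ccontr)
      \<comment> \<open>The added 1 keeps \<open>S\<close> positive even if both measures vanish;
        \<open>close\<close> with \<open>r / (2 * S)\<close> then forces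
        \<open>r \<le> r / 2\<close>.\<close>
      define S where "S = measure N UNIV + measure N' UNIV + 1"
      define r where "r = \<bar>(\<integral>x. f x \<partial>N) - (\<integral>x. f x \<partial>N')\<bar>"
      assume "(\<integral>x. f x \<partial>N) \<noteq> (\<integral>x. f x \<partial>N')"
      then have r: "r > 0" by (simp add: r_def)
      have S: "S > 0" by (simp add: S_def add_nonneg_pos)
      have "r \<le> r / (2 * S) * (S - 1)" using close[of "r / (2 * S)"] r S by (simp add: r_def S_def)
      also have "\<dots> \<le> r / (2 * S) * S" using r S by (intro mult_left_mono) auto
      also have "\<dots> = r / 2" using S by simp
      finally show False using r by simp
    qed
  qed
  \<comment> \<open>The empty set is treated apart: \<open>infdist\<close> to it is 0 by convention,
    so the cut-offs would be constantly 1 instead of tending to its indicator.\<close>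
  have "measure N C = measure N' C" if "closed C" for C
  proof (cases "C = {}")
    case False
    define f where "f n x = max 0 (1 - real n * infdist x C)" for n and x :: 'a
    have fc: "continuous_on UNIV (f n)" for n unfolding f_def by (intro continuous_intros)
    have [measurable]: "C \<in> sets borel" "f n \<in> borel_measurable borel" for n
      using that fc by (auto intro: borel_measurable_continuous_onI)
    have lim: "(\<lambda>n. f n x) \<longlonglongrightarrow> indicator C x" for x
    proof (cases "x \<in> C")
      case True
      then show ?thesis by (simp add: f_def)
    next
      case notin: False
      have pos: "infdist x C > 0"
        using infdist_pos_not_in_closed[OF that False notin] .
      obtain n0 where n0: "1 < real n0 * infdist x C" using reals_Archimedean3[OF pos] by blast
      have "f n x = 0" if "n \<ge> n0" for n
      proof -
        have "real n0 * infdist x C \<le> real n * infdist x C" using that pos by (intro mult_right_mono) auto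
        then show ?thesis using n0 by (simp add: f_def)
      qed
      then have "eventually (\<lambda>n. f n x = indicator C x) sequentially"
        using notin by (auto simp: eventually_sequentially)
      then show ?thesis by (rule tendsto_eventually)
    qed
    have m: "(\<lambda>n. \<integral>x. f n x \<partial>L) \<longlonglongrightarrow> measure L C" if L: "finite_measure L" "sets L = sets borel" for L
    proof -
      interpret L: finite_measure L by (rule L)
      have [measurable_cong]: "sets L = sets borel" by (rule L)
      have sp: "space L = UNIV" using sets_eq_imp_space_eq[OF L(2)] by simp
      have "(\<lambda>n. \<integral>x. f n x \<partial>L) \<longlonglongrightarrow> (\<integral>x. indicator C x \<partial>L)"
      proof (rule integral_dominated_convergence[where w="\<lambda>_. 1"])
        show "AE x in L. norm (f n x) \<le> 1" for n by (auto simp: f_def infdist_nonneg)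
        show "AE x in L. (\<lambda>n. f n x) \<longlonglongrightarrow> indicator C x" using lim by simp
      qed auto
      then show ?thesis by (simp add: sp)
    qed
    have "(\<lambda>n. \<integral>x. f n x \<partial>N) \<longlonglongrightarrow> measure N C" by (rule m[OF N(1,2)])
    moreover have "(\<lambda>n. \<integral>x. f n x \<partial>N) \<longlonglongrightarrow> measure N' C"
      unfolding cont_eq[OF fc] by (rule m[OF N'(1,2)])
    ultimately show ?thesis by (rule LIMSEQ_unique)
  qed simp
  then have em: "emeasure N C = emeasure N' C" if "closed C" for C
    using that by (simp add: N.emeasure_eq_measure N'.emeasure_eq_measure)
  show ?thesis
  proof (rule measure_eqI_generator_eq[where E="Collect closed" and \<Omega>=UNIV and A="\<lambda>_. UNIV"])
    show "sets N = sigma_sets UNIV (Collect closed)" "sets N' = sigma_sets UNIV (Collect closed)"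
      using N N' by (simp_all add: borel_eq_closed)
  qed (use em in \<open>auto simp: Int_stable_def\<close>)
qed

section \<open>The law of the scaled projection\<close>

context projection_law
begin

text \<open>Both laws are finite and carried by the compact set \<open>K\<close>, so the identity
  for polynomials determines them and extends to all Borel functions.\<close>

lemma scaling_law:
  assumes t: "t > 0"
  shows "distr (density M (\<lambda>x. ennreal (scaling_weight k a t (X x)))) borel (\<lambda>x. scaling_action a t (X x))
    = distr M borel X"
proof (rule measure_eqI_polynomial[where K=K])
  let ?w = "\<lambda>x. scaling_weight k a t (X x)"
  have wm [measurable]: "?w \<in> borel_measurable M" using t by measurable
  have am [measurable]: "(\<lambda>x. scaling_action a t (X x)) \<in> borel_measurable M" using t by measurable
  have wi: "integrable M ?w"
    by (intro integrable_test_function test_function_scaling_weight t X_measurable X_projection)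
  have "emeasure (density M ?w) (space M) = (\<integral>\<^sup>+x. ennreal (?w x) \<partial>M)"
    by (subst emeasure_density) (auto intro!: nn_integral_cong)
  also have "\<dots> = ennreal (\<integral>x. ?w x \<partial>M)"
    using wi by (rule nn_integral_eq_integral) (simp add: scaling_weight_nonneg)
  finally have "finite_measure (density M ?w)" by (intro finite_measureI) simp
  then show "finite_measure (distr (density M ?w) borel (\<lambda>x. scaling_action a t (X x)))"
    by (rule finite_measure.finite_measure_distr) simp
  show "finite_measure (distr M borel X)" by (rule finite_measure_distr) simp
  have Kb [measurable]: "K \<in> sets borel"
    using compact_imp_closed[OF compact_projection_matrices] by (rule borel_closed)
  show "AE y in distr (density M ?w) borel (\<lambda>x. scaling_action a t (X x)). y \<in> K"
    by (subst AE_distr_iff) (auto simp: AE_density intro!: AE_I2 scaling_action_projection X_projection t)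
  show "AE y in distr M borel X. y \<in> K"
    by (subst AE_distr_iff) (auto intro!: AE_I2 X_projection)
  show "compact K" by (rule compact_projection_matrices)
  fix \<phi> :: "real ^ 'n ^ 'n \<Rightarrow> real" assume \<phi>: "real_polynomial_function \<phi>"
  then have [measurable]: "\<phi> \<in> borel_measurable borel"
    by (intro borel_measurable_continuous_onI continuous_on_polymonial_function)
      (simp add: real_polynomial_function_eq)
  show "(\<integral>y. \<phi> y \<partial>distr (density M ?w) borel (\<lambda>x. scaling_action a t (X x))) = (\<integral>y. \<phi> y \<partial>distr M borel X)"
    using integral_polynomial_scaling[OF \<phi> t, of a]
    by (simp add: integral_distr integral_density scaling_weight_nonneg mult.commute)
qed simp_all

lemma nn_integral_scaling:
  assumes t: "t > 0" and h [measurable]: "h \<in> borel_measurable borel"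
  shows "(\<integral>\<^sup>+x. h (scaling_action a t (X x)) * ennreal (scaling_weight k a t (X x)) \<partial>M) = (\<integral>\<^sup>+x. h (X x) \<partial>M)"
proof -
  have [measurable]: "(\<lambda>x. scaling_weight k a t (X x)) \<in> borel_measurable M"
    "(\<lambda>x. scaling_action a t (X x)) \<in> borel_measurable M" using t by measurable
  show ?thesis
    using arg_cong[OF scaling_law[OF t, of a], of "\<lambda>N. integral\<^sup>N N h"]
    by (simp add: nn_integral_distr nn_integral_density mult.commute)
qed

end

subsection \<open>Orthogonal projections and the Borel structure of the Grassmannian\<close>

definition orthonormal_basis :: "'a::euclidean_space set \<Rightarrow> 'a set \<Rightarrow> bool" where
  "orthonormal_basis E B \<longleftrightarrow>
     B \<subseteq> E \<and> pairwise orthogonal B \<and> (\<forall>b\<in>B. norm b = 1) \<and> span B = E"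

lemma orthonormal_basis_exists:
  assumes "subspace E" obtains B where "orthonormal_basis E B"
  using orthonormal_basis_subspace[OF assms] unfolding orthonormal_basis_def by metis

lemma orthonormal_basis_inner:
  assumes "orthonormal_basis E B" "b \<in> B" "c \<in> B"
  shows "b \<bullet> c = (if b = c then 1 else 0)"
  using assms by (auto simp: orthonormal_basis_def pairwise_def orthogonal_def norm_eq_1)

lemma orthonormal_basis_independent:
  assumes "orthonormal_basis E B"
  shows "independent B" "finite B" "card B = dim E"
proof -
  have "0 \<notin> B" using assms by (auto simp: orthonormal_basis_def)
  then show "independent B" using assms pairwise_orthogonal_independent by (auto simp: orthonormal_basis_def)
  then show "finite B" by (rule independent_imp_finite)
  show "card B = dim E" using \<open>independent B\<close> assms dim_span_eq_card_independent[of B]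
    by (simp add: orthonormal_basis_def)
qed

lemma orthonormal_basis_expansion:
  assumes B: "orthonormal_basis E B" and "x \<in> E"
  shows "x = (\<Sum>b\<in>B. (x \<bullet> b) *\<^sub>R b)"
proof -
  let ?y = "\<Sum>b\<in>B. (x \<bullet> b) *\<^sub>R b"
  have sub: "subspace E" using B by (metis orthonormal_basis_def subspace_span)
  have "(x - ?y) \<bullet> c = 0" if "c \<in> B" for c
    using that orthonormal_basis_independent(2)[OF B]
    by (simp add: inner_diff_left inner_sum_left orthonormal_basis_inner[OF B] if_distrib[of "\<lambda>t. _ * t"] cong: if_cong)
  then have "orthogonal (x - ?y) z" if "z \<in> span B" for z
    by (intro orthogonal_to_span[OF that]) (simp add: orthogonal_def)
  moreover have "x - ?y \<in> span B"
    using assms B unfolding orthonormal_basis_def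
    by (auto intro!: span_diff span_sum span_mul intro: span_base)
  ultimately have "x - ?y = 0" using orthogonal_self by blast
  then show ?thesis by simp
qed

lemma orthonormal_basis_extend:
  fixes E :: "'a::euclidean_space set"
  assumes B: "orthonormal_basis E B"
  obtains C where "orthonormal_basis UNIV (B \<union> C)" "B \<inter> C = {}"
    "\<And>x c. x \<in> E \<Longrightarrow> c \<in> C \<Longrightarrow> x \<bullet> c = 0"
proof -
  have sub: "subspace E" using B by (metis orthonormal_basis_def subspace_span)
  obtain C where C: "orthonormal_basis (orthogonal_comp E) C"
    using orthonormal_basis_exists[OF subspace_orthogonal_comp] by blast
  have orth: "x \<bullet> c = 0" if "x \<in> E" "c \<in> C" for x c
    using that C by (auto simp: orthonormal_basis_def orthogonal_comp_def orthogonal_def subset_iff inner_commute)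
  have span: "span (B \<union> C) = UNIV"
  proof -
    have "span (B \<union> C) = {x + y |x y. x \<in> E \<and> y \<in> orthogonal_comp E}"
      using B C by (simp add: span_Un orthonormal_basis_def)
    also have "\<dots> = UNIV"
      using subspace_sum_orthogonal_comp[OF sub] unfolding set_plus_def by blast
    finally show ?thesis .
  qed
  have "orthonormal_basis UNIV (B \<union> C)"
  proof -
    have "orthogonal x y" "orthogonal y x" if "x \<in> B" "y \<in> C" for x y
      using orth[of x y] that B by (auto simp: orthonormal_basis_def orthogonal_def inner_commute)
    then show ?thesis using B C span unfolding orthonormal_basis_def
      by (auto simp: pairwise_def)
  qed
  moreover have "B \<inter> C = {}"
    using orth B unfolding orthonormal_basis_def by fastforce
  ultimately show ?thesis using that orth by blast
qed

lemma orthonormal_basis_onb: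
  assumes "subspace E" shows "orthonormal_basis E (onb E)"
proof -
  obtain B where "orthonormal_basis E B" using orthonormal_basis_exists[OF assms] .
  then show ?thesis unfolding orthonormal_basis_def onb_def by (rule someI2)
qed

lemma closest_point_subspaceI:
  fixes E :: "'a::euclidean_space set"
  assumes E: "subspace E" and y: "y \<in> E" "\<And>z. z \<in> E \<Longrightarrow> (x - y) \<bullet> z = 0"
  shows "closest_point E x = y"
proof (rule closest_point_unique[symmetric])
  show "convex E" "closed E" "y \<in> E" using E y by (auto intro: subspace_imp_convex closed_subspace)
  show "\<forall>z\<in>E. dist x y \<le> dist x z"
  proof
    fix z assume "z \<in> E"
    then have "(x - y) \<bullet> (y - z) = 0" using y subspace_diff[OF E] by blast
    then have "(norm (x - z))\<^sup>2 = (norm (x - y))\<^sup>2 + (norm (y - z))\<^sup>2"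
      using norm_add_Pythagorean[of "x - y" "y - z"] by (simp add: orthogonal_def)
    then have "(norm (x - y))\<^sup>2 \<le> (norm (x - z))\<^sup>2" by simp
    then show "dist x y \<le> dist x z" unfolding dist_norm by (rule power2_le_imp_le) simp
  qed
qed

lemma closest_point_orthonormal_basis:
  assumes B: "orthonormal_basis E B"
  shows "closest_point E x = (\<Sum>b\<in>B. (x \<bullet> b) *\<^sub>R b)"
proof (rule closest_point_subspaceI)
  show sub: "subspace E" using B by (metis orthonormal_basis_def subspace_span)
  show "(\<Sum>b\<in>B. (x \<bullet> b) *\<^sub>R b) \<in> E"
    using B sub by (intro subspace_sum subspace_mul) (auto simp: orthonormal_basis_def)
  fix z assume "z \<in> E"
  then have z: "z = (\<Sum>b\<in>B. (z \<bullet> b) *\<^sub>R b)" by (rule orthonormal_basis_expansion[OF B])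
  have "x \<bullet> z = (\<Sum>b\<in>B. (x \<bullet> b) * (b \<bullet> z))"
    by (subst z) (simp add: inner_sum_right mult.commute inner_commute[of _ z])
  then show "(x - (\<Sum>b\<in>B. (x \<bullet> b) *\<^sub>R b)) \<bullet> z = 0"
    by (simp add: inner_diff_left inner_sum_left)
qed

lemma closest_point_subspace:
  fixes E :: "'a::euclidean_space set"
  assumes E: "subspace E"
  shows "closest_point E x \<in> E" "linear (closest_point E)" "x \<in> E \<Longrightarrow> closest_point E x = x"
    "closest_point E x \<bullet> y = x \<bullet> closest_point E y"
proof -
  obtain B where B: "orthonormal_basis E B" using orthonormal_basis_exists[OF E] .
  show "closest_point E x \<in> E"
    using E by (intro closest_point_in_set closed_subspace) (auto dest: subspace_0)
  show "linear (closest_point E)"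
    unfolding closest_point_orthonormal_basis[OF B]
    by (intro linearI) (simp_all add: inner_add_left scaleR_add_left sum.distrib scaleR_sum_right)
  show "closest_point E x = x" if "x \<in> E" using that E by (simp add: closest_point_self)
  show "closest_point E x \<bullet> y = x \<bullet> closest_point E y"
    unfolding closest_point_orthonormal_basis[OF B]
    by (simp add: inner_sum_left inner_sum_right inner_commute mult.commute)
qed

section \<open>Subspaces as projection matrices\<close>

definition projection_matrix :: "(real ^ 'n) set \<Rightarrow> real ^ 'n ^ 'n" where
  "projection_matrix E = matrix (closest_point E)"

lemma projection_matrix_entry:
  "projection_matrix E $ i $ j = closest_point E (axis j 1) $ i"
  by (simp add: projection_matrix_def matrix_def)

lemma projection_matrix_entry_inner:
  "projection_matrix E $ i $ j = axis i 1 \<bullet> closest_point E (axis j 1)"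
  by (simp add: projection_matrix_entry inner_axis')

lemma projection_matrix_mult:
  assumes "subspace E" shows "projection_matrix E *v x = closest_point E x"
  unfolding projection_matrix_def
  by (simp add: closest_point_subspace(2)[OF assms])

lemma linear_image_grassmannian:
  fixes g :: "real ^ 'n \<Rightarrow> real ^ 'n"
  assumes "linear g" "inj g" "E \<in> grassmannian k"
  shows "g ` E \<in> grassmannian k"
  using assms dim_image_eq[OF assms(1), of E]
  by (auto simp: grassmannian_def linear_subspace_image inj_on_subset)

lemma projection_matrix_orthogonal_image:
  fixes U :: "real ^ 'n \<Rightarrow> real ^ 'n"
  assumes U: "orthogonal_transformation U" and E: "subspace E"
  shows "projection_matrix (U ` E) = matrix U ** projection_matrix E ** transpose (matrix U)"
proof -
  have lin: "linear U" using U by (rule orthogonal_transformation_linear)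
  have isom: "U x \<bullet> U y = x \<bullet> y" for x y using U by (simp add: orthogonal_transformation_def)
  have inv: "U (inv U y) = y" for y
    using orthogonal_transformation_surj[OF U] by (rule surj_f_inv_f)
  have cp: "closest_point (U ` E) y = U (closest_point E (inv U y))" for y
  proof (rule closest_point_subspaceI)
    show "subspace (U ` E)" using lin E by (rule linear_subspace_image)
    show "U (closest_point E (inv U y)) \<in> U ` E" using closest_point_subspace(1)[OF E] by blast
    fix z assume "z \<in> U ` E"
    then obtain w where w: "w \<in> E" "z = U w" by auto
    have "(y - U (closest_point E (inv U y))) \<bullet> z = U (inv U y - closest_point E (inv U y)) \<bullet> U w"
      by (simp add: w linear_diff[OF lin] inv)
    also have "\<dots> = 0"
      using closest_point_subspace(4)[OF E, of "inv U y" w] closest_point_subspace(3)[OF E w(1)]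
      by (simp add: isom inner_diff_left)
    finally show "(y - U (closest_point E (inv U y))) \<bullet> z = 0" .
  qed
  have mat: "matrix U *v x = U x" for x by (simp add: lin)
  have tr: "transpose (matrix U) *v y = inv U y" for y
  proof -
    have "orthogonal_matrix (matrix U)" using U orthogonal_transformation_matrix by blast
    then have "transpose (matrix U) *v (matrix U *v inv U y) = inv U y"
      by (simp add: matrix_vector_mul_assoc orthogonal_matrix)
    then show ?thesis by (simp add: mat inv)
  qed
  show ?thesis
    by (simp add: matrix_eq matrix_vector_mul_assoc[symmetric] tr projection_matrix_mult E
        linear_subspace_image[OF lin] cp mat del: transpose_matrix_vector)
qed

definition axis_scaling :: "'n \<Rightarrow> real \<Rightarrow> real ^ 'n \<Rightarrow> real ^ 'n" where
  "axis_scaling a t x = x + ((t - 1) * x $ a) *\<^sub>R axis a 1"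

lemma axis_scaling_component: "axis_scaling a t x $ i = (if i = a then t else 1) * x $ i"
  by (simp add: axis_scaling_def axis_def algebra_simps)

lemma linear_axis_scaling: "linear (axis_scaling a t)"
  by (intro linearI) (simp_all add: vec_eq_iff axis_scaling_component algebra_simps)

lemma axis_scaling_inner: "axis_scaling a t x \<bullet> y = x \<bullet> axis_scaling a t y"
  by (simp add: inner_vec_def axis_scaling_component mult_ac)

lemma axis_scaling_mult: "axis_scaling a s (axis_scaling a t x) = axis_scaling a (s * t) x"
  by (simp add: vec_eq_iff axis_scaling_component)

lemma inj_axis_scaling: "t \<noteq> 0 \<Longrightarrow> inj (axis_scaling a t)"
  by (auto simp: inj_def vec_eq_iff axis_scaling_component split: if_splits)

text \<open>The open sets are the preimages of open sets of matrices, hence so are the generated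
  sigma-algebras. Measurability and equality of measures on the Grassmannian can therefore be
  checked on matrices.\<close>

lemma sets_grassmannian_borel:
  "sets (grassmannian_borel k :: (real ^ 'n) set measure) =
     sets (vimage_algebra (grassmannian k) projection_matrix borel)"
proof -
  have *: "{U. openin (grassmannian_topology k) U} =
      {projection_matrix -` A \<inter> grassmannian k |A. A \<in> {S. open S}}"
    by (auto simp: grassmannian_topology_def openin_pullback_topology projection_matrix_def[abs_def])
  show ?thesis
    unfolding grassmannian_borel_def * borel_def by (subst vimage_algebra_sigma) auto
qed

lemma projection_matrix_in:
  fixes E :: "(real ^ 'n) set"
  assumes "E \<in> grassmannian k"
  shows "projection_matrix E \<in> projection_matrices k"
proof -
  have E: "subspace E" "dim E = k" using assms by (auto simp: grassmannian_def)
  obtain B where B: "orthonormal_basis E B" using orthonormal_basis_exists[OF E(1)] .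
  have "projection_matrix E $ j $ i = projection_matrix E $ i $ j" for i j
    unfolding projection_matrix_entry_inner
    using closest_point_subspace(4)[OF E(1), of "axis i 1" "axis j 1"] by (simp add: inner_commute)
  moreover have "projection_matrix E ** projection_matrix E = projection_matrix E"
    by (simp add: matrix_eq matrix_vector_mul_assoc[symmetric] projection_matrix_mult E
        closest_point_subspace(1,3)[OF E(1)])
  moreover have "(\<Sum>i\<in>UNIV. projection_matrix E $ i $ i) = real k"
  proof -
    have "(\<Sum>i\<in>UNIV. projection_matrix E $ i $ i) = (\<Sum>i\<in>UNIV. \<Sum>b\<in>B. b $ i * b $ i)"
      by (simp add: projection_matrix_entry closest_point_orthonormal_basis[OF B] inner_axis')
    also have "\<dots> = (\<Sum>b\<in>B. b \<bullet> b)"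
      unfolding inner_vec_def by (subst sum.swap) simp
    also have "\<dots> = real k"
      using orthonormal_basis_independent(3)[OF B] E by (simp add: orthonormal_basis_inner[OF B])
    finally show ?thesis .
  qed
  ultimately show ?thesis
    unfolding projection_matrices_def by (simp add: vec_eq_iff transpose_def)
qed

text \<open>The candidate projection clearly lands in the scaled subspace, so only orthogonality of
  the residual remains. Tested against the scaling of \<open>x\<close>, it moves by self-adjointness
  to the double scaling of \<open>x\<close>, which differs from \<open>x\<close> by a multiple of
  the axis vector; that vector projects to \<open>u\<close>.\<close>

lemma projection_matrix_axis_scaling_image:
  fixes E :: "(real ^ 'n) set"
  assumes E: "E \<in> grassmannian k" and t: "t > 0"
  shows "projection_matrix (axis_scaling a t ` E) = scaling_action a t (projection_matrix E)"
proof -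
  have sub: "subspace E" using E by (simp add: grassmannian_def)
  define s u d where "s = t\<^sup>2 - 1" and "u = closest_point E (axis a 1)" and "d = scaling_det a t (projection_matrix E)"
  let ?D = "axis_scaling a t" and ?\<pi> = "closest_point E"
  have d: "d > 0" unfolding d_def by (rule scaling_det_pos[OF projection_matrix_in[OF E] t])
  have d_eq: "d = 1 + s * u $ a" by (simp add: d_def scaling_det_def s_def u_def projection_matrix_entry)
  have lin: "linear ?\<pi>" by (rule closest_point_subspace(2)[OF sub])
  note D = linear_axis_scaling[of a t]
  have u: "u \<in> E" unfolding u_def by (rule closest_point_subspace(1)[OF sub])
  have inner_u: "u \<bullet> x = x $ a" if "x \<in> E" for x
    using closest_point_subspace(4)[OF sub, of "axis a 1" x] closest_point_subspace(3)[OF sub that]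
    by (simp add: u_def inner_axis')
  have cp: "closest_point (?D ` E) y = ?D (?\<pi> (?D y) - (s / d * (u \<bullet> ?D y)) *\<^sub>R u)" for y
  proof (rule closest_point_subspaceI)
    show "subspace (?D ` E)" by (rule linear_subspace_image[OF D sub])
    show "?D (?\<pi> (?D y) - (s / d * (u \<bullet> ?D y)) *\<^sub>R u) \<in> ?D ` E"
      using u closest_point_subspace(1)[OF sub] by (intro imageI subspace_diff[OF sub] subspace_mul[OF sub])
    let ?Q = "\<lambda>y. ?\<pi> (?D y) - (s / d * (u \<bullet> ?D y)) *\<^sub>R u"
    fix z assume "z \<in> ?D ` E"
    then obtain x where x: "x \<in> E" "z = ?D x" by auto
    have DDx: "?D (?D x) = x + (s * x $ a) *\<^sub>R axis a 1"
      unfolding axis_scaling_mult by (simp add: axis_scaling_def s_def power2_eq_square)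
    have \<pi>DD: "?\<pi> (?D (?D x)) = x + (s * x $ a) *\<^sub>R u"
      unfolding DDx by (simp add: linear_add[OF lin] linear_cmul[OF lin] closest_point_subspace(3)[OF sub x(1)] u_def)
    have uDD: "u \<bullet> ?D (?D x) = x $ a * d"
      unfolding DDx by (simp add: inner_add_right inner_u[OF x(1)] inner_axis d_eq algebra_simps)
    have "?D (?Q y) \<bullet> z = ?Q y \<bullet> ?D (?D x)" by (simp add: x axis_scaling_inner)
    also have "\<dots> = ?D y \<bullet> ?\<pi> (?D (?D x)) - s / d * (u \<bullet> ?D y) * (x $ a * d)"
      by (simp add: inner_diff_left uDD closest_point_subspace(4)[OF sub])
    also have "\<dots> = ?D y \<bullet> x"
      using d by (simp add: \<pi>DD inner_add_right inner_commute)
    also have "\<dots> = y \<bullet> z" by (simp add: x axis_scaling_inner)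
    finally show "(y - ?D (?Q y)) \<bullet> z = 0" by (simp add: inner_diff_left)
  qed
  have P: "projection_matrix E \<in> projection_matrices k" by (rule projection_matrix_in[OF E])
  have D_axis: "?D (axis j 1) = scaling_factor a t j *\<^sub>R axis j 1" for j
    by (simp add: vec_eq_iff axis_scaling_component axis_def scaling_factor_def)
  have "projection_matrix (?D ` E) $ i $ j = scaling_action a t (projection_matrix E) $ i $ j" for i j
  proof -
    have "u $ i = projection_matrix E $ i $ a" "u $ j = projection_matrix E $ a $ j"
      using projection_matrices_entries(1)[OF P, of a j] by (simp_all add: u_def projection_matrix_entry)
    then show ?thesis
      unfolding projection_matrix_entry[of "?D ` E"] cp D_axis scaling_action_entry[OF P t] axis_scaling_component
      by (simp add: linear_cmul[OF lin] inner_axis projection_matrix_entry[symmetric] scaling_factor_def[of a t i]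
          s_def[symmetric] d_def[symmetric] algebra_simps)
  qed
  then show ?thesis by (simp add: vec_eq_iff)
qed

subsection \<open>Lebesgue measure on subspaces\<close>

lemma borel_measurable_linear:
  fixes g :: "'a::euclidean_space \<Rightarrow> 'a"
  assumes "linear g" shows "g \<in> borel_measurable borel"
  using assms by (intro borel_measurable_continuous_onI linear_continuous_on) (simp add: linear_conv_bounded_linear)

lemma nn_integral_lborel_translate:
  fixes h :: "'a::euclidean_space \<Rightarrow> ennreal"
  assumes [measurable]: "h \<in> borel_measurable borel"
  shows "(\<integral>\<^sup>+x. h (c + x) \<partial>lborel) = (\<integral>\<^sup>+x. h x \<partial>lborel)"
  using arg_cong[OF lborel_distr_plus[of c], of "\<lambda>N. integral\<^sup>N N h"]
  by (simp add: nn_integral_distr)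

text \<open>The proof is the usual uniqueness argument for Haar measures: by translation invariance and
  Fubini, the image measure and Lebesgue measure agree up to their values on the unit ball.\<close>

lemma lborel_distr_orthogonal_transformation:
  fixes U :: "'a::euclidean_space \<Rightarrow> 'a"
  assumes U: "orthogonal_transformation U"
  shows "distr lborel borel U = lborel"
proof (rule measure_eqI)
  have lin: "linear U" using U by (rule orthogonal_transformation_linear)
  have [measurable]: "U \<in> borel_measurable borel"
    using lin by (rule borel_measurable_linear)
  fix A assume "A \<in> sets (distr lborel borel U)"
  then have [measurable]: "A \<in> sets borel" by simp
  let ?B = "ball (0::'a) 1"
  have mB: "(indicator ?B :: 'a \<Rightarrow> ennreal) \<in> borel_measurable borel"
    by (intro borel_measurable_indicator) simp
  have [measurable]: "(\<lambda>y. indicator ?B (y - c) :: ennreal) \<in> borel_measurable borel" for c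
    by (intro measurable_compose[OF _ mB]) simp
  have mA: "(indicator A :: 'a \<Rightarrow> ennreal) \<in> borel_measurable borel" by simp
  have f1: "(\<lambda>(x, y). indicator A (U x) * indicator ?B (y - U x) :: ennreal) \<in> borel_measurable (lborel \<Otimes>\<^sub>M lborel)"
    and f2: "(\<lambda>(x, y). indicator A (U x + y) * indicator ?B x :: ennreal) \<in> borel_measurable (lborel \<Otimes>\<^sub>M lborel)"
    unfolding split_beta'
    by (intro borel_measurable_times_ennreal measurable_compose[OF _ mA] measurable_compose[OF _ mB]; measurable)+
  have "emeasure (distr lborel borel U) A * emeasure lborel ?B =
      (\<integral>\<^sup>+x. indicator A (U x) \<partial>lborel) * (\<integral>\<^sup>+y. indicator ?B y \<partial>lborel)"
    using nn_integral_distr[of U lborel borel "indicator A"] by simp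
  also have "\<dots> = (\<integral>\<^sup>+x. indicator A (U x) * (\<integral>\<^sup>+y. indicator ?B y \<partial>lborel) \<partial>lborel)"
    by (rule nn_integral_multc[symmetric]) measurable
  also have "\<dots> = (\<integral>\<^sup>+x. (\<integral>\<^sup>+y. indicator A (U x) * indicator ?B (y - U x) \<partial>lborel) \<partial>lborel)"
  proof (rule nn_integral_cong)
    fix x
    show "indicator A (U x) * (\<integral>\<^sup>+y. indicator ?B y \<partial>lborel) =
        (\<integral>\<^sup>+y. indicator A (U x) * indicator ?B (y - U x) \<partial>lborel)"
      using nn_integral_lborel_translate[OF mB, of "- U x"]
      by (simp add: nn_integral_cmult)
  qed
  also have "\<dots> = (\<integral>\<^sup>+y. (\<integral>\<^sup>+x. indicator A (U x) * indicator ?B (y - U x) \<partial>lborel) \<partial>lborel)"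
    by (rule lborel_pair.Fubini'[OF f1, symmetric])
  also have "\<dots> = (\<integral>\<^sup>+y. (\<integral>\<^sup>+x. indicator A (U x + y) * indicator ?B x \<partial>lborel) \<partial>lborel)"
  proof (rule nn_integral_cong)
    fix y
    have m: "(\<lambda>x. indicator A (U x) * indicator ?B (y - U x) :: ennreal) \<in> borel_measurable borel"
      by (intro borel_measurable_times_ennreal measurable_compose[OF _ mA] measurable_compose[OF _ mB]; measurable)
    \<comment> \<open>Replacing \<open>x\<close> by \<open>inv U y + x\<close> turns
      \<open>U x\<close> into \<open>y + U x\<close> and \<open>y - U x\<close> into
      \<open>- U x\<close>; the ball is invariant under \<open>U\<close> and under negation.\<close>
    have "U (inv U y) = y" using orthogonal_transformation_surj[OF U] by (rule surj_f_inv_f)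
    then have "U (inv U y + x) = y + U x" for x by (simp add: linear_add[OF lin])
    moreover have "indicator ?B (- U x) = (indicator ?B x :: ennreal)" for x
      by (simp add: indicator_def orthogonal_transformation_norm[OF U])
    ultimately show "(\<integral>\<^sup>+x. indicator A (U x) * indicator ?B (y - U x) \<partial>lborel) =
        (\<integral>\<^sup>+x. indicator A (U x + y) * indicator ?B x \<partial>lborel)"
      using nn_integral_lborel_translate[OF m, of "inv U y"]
      by (simp add: add.commute)
  qed
  also have "\<dots> = (\<integral>\<^sup>+x. (\<integral>\<^sup>+y. indicator A (U x + y) * indicator ?B x \<partial>lborel) \<partial>lborel)"
    by (rule lborel_pair.Fubini'[OF f2])
  also have "\<dots> = (\<integral>\<^sup>+x. emeasure lborel A * indicator ?B x \<partial>lborel)"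
    using nn_integral_lborel_translate[OF mA] by (simp add: nn_integral_multc)
  also have "\<dots> = emeasure lborel A * emeasure lborel ?B"
    by (intro nn_integral_cmult_indicator) simp
  finally have "emeasure (distr lborel borel U) A * emeasure lborel ?B = emeasure lborel A * emeasure lborel ?B" .
  moreover have "emeasure lborel ?B \<noteq> 0"
    using content_ball_pos[of 1 "0::'a"] by (auto simp: measure_def)
  moreover have "emeasure lborel ?B \<noteq> \<infinity>" using emeasure_lborel_ball_finite[of "0::'a" 1] by simp
  ultimately show "emeasure (distr lborel borel U) A = emeasure lborel A"
    unfolding mult.commute[of _ "emeasure lborel ?B"] by (simp add: ennreal_mult_cancel_left)
qed simp

interpretation lborel_product: product_sigma_finite "\<lambda>_. lborel :: real measure" ..

lemma measurable_basis_sum [measurable]: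
  fixes v :: "'i \<Rightarrow> 'a::euclidean_space"
  assumes "J \<subseteq> I"
  shows "(\<lambda>c. \<Sum>b\<in>J. c b *\<^sub>R v b) \<in> borel_measurable (\<Pi>\<^sub>M b\<in>I. (lborel :: real measure))"
proof (intro borel_measurable_sum borel_measurable_scaleR borel_measurable_const)
  fix b assume "b \<in> J"
  then have "(\<lambda>c. c b) \<in> measurable (\<Pi>\<^sub>M b\<in>I. (lborel :: real measure)) lborel"
    using assms by (intro measurable_component_singleton) auto
  then show "(\<lambda>c. c b) \<in> borel_measurable (\<Pi>\<^sub>M b\<in>I. (lborel :: real measure))" by simp
qed

text \<open>A bijection from \<open>Basis\<close> to \<open>B\<close> renames coordinates. With the
  standard vectors in place of \<open>B\<close>, the product measure is recognised as Lebesgue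
  measure on boxes; the orthogonal map that sends each standard vector to its partner then brings in
  \<open>B\<close>.\<close>

lemma distr_orthonormal_basis_eq_lborel:
  fixes B :: "'a::euclidean_space set"
  assumes B: "orthonormal_basis UNIV B"
  shows "distr (\<Pi>\<^sub>M b\<in>B. (lborel :: real measure)) borel (\<lambda>c. \<Sum>b\<in>B. c b *\<^sub>R b) = lborel"
proof -
  have fin: "finite B" and "card B = card (Basis :: 'a set)"
    using orthonormal_basis_independent[OF B] by auto
  then obtain \<pi> where \<pi>: "bij_betw \<pi> (Basis :: 'a set) B"
    using finite_same_card_bij[OF finite_Basis] by metis
  define \<rho> where "\<rho> = the_inv_into Basis \<pi>"
  have \<rho>: "\<rho> (\<pi> i) = i" if "i \<in> Basis" for i
    unfolding \<rho>_def using \<pi> that by (intro the_inv_into_f_f) (auto simp: bij_betw_def)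
  have \<pi>B: "\<pi> i \<in> B" if "i \<in> Basis" for i using \<pi> that by (auto simp: bij_betw_def)
  define U where "U x = (\<Sum>i\<in>Basis. (x \<bullet> i) *\<^sub>R \<pi> i)" for x
  have linU: "linear U"
    unfolding U_def by (intro linearI) (simp_all add: inner_add_left scaleR_add_left sum.distrib scaleR_sum_right)
  have \<pi>\<pi>: "\<pi> i \<bullet> \<pi> j = (if i = j then 1 else 0)" if "i \<in> Basis" "j \<in> Basis" for i j
    using orthonormal_basis_inner[OF B \<pi>B \<pi>B] that \<rho> by metis
  have "U x \<bullet> U y = x \<bullet> y" for x y
  proof -
    have "U x \<bullet> U y = (\<Sum>i\<in>Basis. \<Sum>j\<in>Basis. (x \<bullet> i) * ((y \<bullet> j) * (\<pi> i \<bullet> \<pi> j)))"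
      unfolding U_def inner_sum_left unfolding inner_sum_right by (simp add: mult_ac)
    also have "\<dots> = (\<Sum>i\<in>Basis. \<Sum>j\<in>Basis. if i = j then (x \<bullet> i) * (y \<bullet> j) else 0)"
      by (intro sum.cong) (simp_all add: \<pi>\<pi>)
    also have "\<dots> = (\<Sum>i\<in>Basis. (x \<bullet> i) * (y \<bullet> i))" by simp
    also have "\<dots> = x \<bullet> y" by (rule euclidean_inner[symmetric])
    finally show ?thesis .
  qed
  then have U: "orthogonal_transformation U" using linU by (simp add: orthogonal_transformation_def)
  have [measurable]: "U \<in> borel_measurable borel"
    using linU by (rule borel_measurable_linear)
  let ?P = "\<Pi>\<^sub>M b\<in>B. (lborel :: real measure)"
  have m: "(\<lambda>c. \<Sum>i\<in>Basis. c (\<pi> i) *\<^sub>R i) \<in> borel_measurable ?P"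
  proof (intro borel_measurable_sum borel_measurable_scaleR borel_measurable_const)
    fix i :: 'a assume "i \<in> Basis"
    then have "(\<lambda>c. c (\<pi> i)) \<in> measurable ?P lborel"
      by (intro measurable_component_singleton \<pi>B)
    then show "(\<lambda>c. c (\<pi> i)) \<in> borel_measurable ?P" by simp
  qed
  have N': "lborel = distr ?P borel (\<lambda>c. \<Sum>i\<in>Basis. c (\<pi> i) *\<^sub>R i)"
  proof (rule lborel_eqI)
    fix l u :: 'a assume le: "\<And>b. b \<in> Basis \<Longrightarrow> l \<bullet> b \<le> u \<bullet> b"
    have "(\<lambda>c. \<Sum>i\<in>Basis. c (\<pi> i) *\<^sub>R i) -` box l u \<inter> space ?P = (\<Pi>\<^sub>E b\<in>B. {l \<bullet> \<rho> b <..< u \<bullet> \<rho> b})"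
    proof -
      have "(\<Sum>i\<in>Basis. c (\<pi> i) *\<^sub>R i) \<in> box l u \<longleftrightarrow> (\<forall>b\<in>B. c b \<in> {l \<bullet> \<rho> b <..< u \<bullet> \<rho> b})" for c
      proof -
        have "(\<Sum>i\<in>Basis. c (\<pi> i) *\<^sub>R i) \<in> box l u \<longleftrightarrow> (\<forall>i\<in>Basis. c (\<pi> i) \<in> {l \<bullet> i <..< u \<bullet> i})"
          by (simp add: mem_box)
        also have "\<dots> \<longleftrightarrow> (\<forall>i\<in>Basis. c (\<pi> i) \<in> {l \<bullet> \<rho> (\<pi> i) <..< u \<bullet> \<rho> (\<pi> i)})" by (simp add: \<rho>)
        also have "\<dots> \<longleftrightarrow> (\<forall>b\<in>B. c b \<in> {l \<bullet> \<rho> b <..< u \<bullet> \<rho> b})"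
          using \<pi> by (auto simp: bij_betw_def)
        finally show ?thesis .
      qed
      then show ?thesis by (auto simp: space_PiM PiE_iff)
    qed
    then have "emeasure (distr ?P borel (\<lambda>c. \<Sum>i\<in>Basis. c (\<pi> i) *\<^sub>R i)) (box l u) =
       emeasure ?P (\<Pi>\<^sub>E b\<in>B. {l \<bullet> \<rho> b <..< u \<bullet> \<rho> b})"
      by (subst emeasure_distr[OF m]) auto
    also have "\<dots> = (\<Prod>b\<in>B. emeasure lborel {l \<bullet> \<rho> b <..< u \<bullet> \<rho> b})"
      by (rule lborel_product.emeasure_PiM[OF fin]) simp
    also have "\<dots> = (\<Prod>i\<in>Basis. emeasure lborel {l \<bullet> \<rho> (\<pi> i) <..< u \<bullet> \<rho> (\<pi> i)})"
      by (rule prod.reindex_bij_betw[OF \<pi>, symmetric])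
    also have "\<dots> = (\<Prod>i\<in>Basis. ennreal ((u - l) \<bullet> i))"
      by (intro prod.cong refl) (simp add: \<rho> le inner_diff_left)
    also have "\<dots> = ennreal (\<Prod>i\<in>Basis. (u - l) \<bullet> i)"
      using le by (intro prod_ennreal) (simp add: inner_diff_left)
    finally show "emeasure (distr ?P borel (\<lambda>c. \<Sum>i\<in>Basis. c (\<pi> i) *\<^sub>R i)) (box l u) =
      ennreal (\<Prod>i\<in>Basis. (u - l) \<bullet> i)" .
  qed simp
  have "U (\<Sum>i\<in>Basis. c (\<pi> i) *\<^sub>R i) = (\<Sum>b\<in>B. c b *\<^sub>R b)" for c
  proof -
    have "U (\<Sum>i\<in>Basis. c (\<pi> i) *\<^sub>R i) = (\<Sum>i\<in>Basis. c (\<pi> i) *\<^sub>R \<pi> i)" by (simp add: U_def)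
    also have "\<dots> = (\<Sum>b\<in>B. c b *\<^sub>R b)" by (rule sum.reindex_bij_betw[OF \<pi>])
    finally show ?thesis .
  qed
  then have "distr ?P borel (\<lambda>c. \<Sum>b\<in>B. c b *\<^sub>R b) = distr (distr ?P borel (\<lambda>c. \<Sum>i\<in>Basis. c (\<pi> i) *\<^sub>R i)) borel U"
    using m by (subst distr_distr) (auto simp: comp_def)
  also have "\<dots> = lborel" unfolding N'[symmetric] by (rule lborel_distr_orthogonal_transformation[OF U])
  finally show ?thesis .
qed

text \<open>The measure inside \<open>lebesgue_subspace\<close> before completion, with the basis as
  a parameter: computations need a basis adapted to the map, not the one chosen by
  \<open>onb\<close>.\<close>

definition subspace_measure :: "'a::euclidean_space set \<Rightarrow> 'a set \<Rightarrow> 'a measure" where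
  "subspace_measure E B = distr (\<Pi>\<^sub>M b\<in>B. (lborel :: real measure)) (restrict_space borel E) (\<lambda>c. \<Sum>b\<in>B. c b *\<^sub>R b)"

lemma space_subspace_measure [simp]: "space (subspace_measure E B) = E"
  and sets_subspace_measure [measurable_cong]: "sets (subspace_measure E B) = sets (restrict_space borel E)"
  by (simp_all add: subspace_measure_def space_restrict_space)

lemma measurable_basis_sum_subspace:
  assumes "orthonormal_basis E B"
  shows "(\<lambda>c. \<Sum>b\<in>B. c b *\<^sub>R b) \<in> measurable (\<Pi>\<^sub>M b\<in>B. (lborel :: real measure)) (restrict_space borel E)"
proof (rule measurable_restrict_space2)
  have "subspace E" "B \<subseteq> E" using assms by (auto simp: orthonormal_basis_def)
  then show "(\<lambda>c. \<Sum>b\<in>B. c b *\<^sub>R b) \<in> space (\<Pi>\<^sub>M b\<in>B. (lborel :: real measure)) \<rightarrow> E"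
    by (auto intro!: subspace_sum subspace_mul)
qed (rule measurable_basis_sum, simp)

lemma nn_integral_subspace_measure:
  assumes "orthonormal_basis E B" "f \<in> borel_measurable (restrict_space borel E)"
  shows "(\<integral>\<^sup>+x. f x \<partial>subspace_measure E B) = (\<integral>\<^sup>+c. f (\<Sum>b\<in>B. c b *\<^sub>R b) \<partial>(\<Pi>\<^sub>M b\<in>B. (lborel :: real measure)))"
  unfolding subspace_measure_def using measurable_basis_sum_subspace[OF assms(1)] assms(2)
  by (intro nn_integral_distr) simp_all

text \<open>The right-hand side below involves only the complementary basis \<open>C\<close>, which is why the measure
  does not depend on \<open>B\<close>.\<close>

lemma nn_integral_subspace_measure_lborel:
  fixes E :: "'a::euclidean_space set"
  assumes B: "orthonormal_basis E B" and f: "f \<in> borel_measurable (restrict_space borel E)"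
    and BC: "orthonormal_basis UNIV (B \<union> C)" and disj: "B \<inter> C = {}"
  shows "(\<integral>\<^sup>+x. f x \<partial>subspace_measure E B) =
    (\<integral>\<^sup>+x. f (closest_point E x) * (\<Prod>c\<in>C. indicator {0..1} (x \<bullet> c)) \<partial>lborel)"
proof -
  have fin: "finite B" "finite C" using orthonormal_basis_independent(2)[OF BC] by auto
  have sub: "subspace E" using B by (metis orthonormal_basis_def subspace_span)
  let ?s = "\<lambda>J c. \<Sum>b\<in>J. c b *\<^sub>R b"
  have lin: "linear (closest_point E)" by (rule closest_point_subspace(2)[OF sub])
  have "closest_point E \<in> borel_measurable borel"
    using lin by (rule borel_measurable_linear)
  then have "closest_point E \<in> measurable borel (restrict_space borel E)"
    using closest_point_subspace(1)[OF sub] by (intro measurable_restrict_space2) auto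
  from measurable_compose[OF this f]
  have fm [measurable]: "(\<lambda>x. f (closest_point E x)) \<in> borel_measurable borel" .
  \<comment> \<open>The function is extended constantly in the complementary directions and cut off
    there to a unit cube, which integrates to 1.\<close>
  define F where "F x = f (closest_point E x) * (\<Prod>c\<in>C. indicator {0..1} (x \<bullet> c))" for x
  have Fm [measurable]: "F \<in> borel_measurable borel" unfolding F_def by measurable
  have cp: "closest_point E (?s (B \<union> C) w) = ?s B w" for w
  proof -
    have "?s (B \<union> C) w \<bullet> b = w b" if "b \<in> B" for b
      using that fin by (simp add: inner_sum_left orthonormal_basis_inner[OF BC] if_distrib[of "\<lambda>t. _ * t"] cong: if_cong)
    then show ?thesis unfolding closest_point_orthonormal_basis[OF B] by simp
  qed
  have ip: "?s (B \<union> C) w \<bullet> c = w c" if "c \<in> C" for w c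
    using that fin by (simp add: inner_sum_left orthonormal_basis_inner[OF BC] if_distrib[of "\<lambda>t. _ * t"] cong: if_cong)
  have "(\<integral>\<^sup>+x. F x \<partial>lborel) = (\<integral>\<^sup>+w. F (?s (B \<union> C) w) \<partial>(\<Pi>\<^sub>M b\<in>B \<union> C. (lborel :: real measure)))"
    unfolding distr_orthonormal_basis_eq_lborel[OF BC, symmetric]
    by (rule nn_integral_distr) (simp_all add: measurable_basis_sum)
  also have "\<dots> = (\<integral>\<^sup>+x. (\<integral>\<^sup>+y. F (?s (B \<union> C) (merge B C (x, y))) \<partial>(\<Pi>\<^sub>M b\<in>C. (lborel :: real measure)))
      \<partial>(\<Pi>\<^sub>M b\<in>B. (lborel :: real measure)))"
    by (rule lborel_product.product_nn_integral_fold[OF disj fin])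
      (rule measurable_compose[OF measurable_basis_sum Fm], simp)
  also have "\<dots> = (\<integral>\<^sup>+x. f (?s B x) \<partial>(\<Pi>\<^sub>M b\<in>B. (lborel :: real measure)))"
  proof (rule nn_integral_cong)
    fix x
    have "F (?s (B \<union> C) (merge B C (x, y))) = f (?s B x) * (\<Prod>c\<in>C. indicator {0..1} (y c))" for y
    proof -
      have "?s B (merge B C (x, y)) = ?s B x" by (intro sum.cong) (simp_all add: merge_def)
      moreover have "(\<Prod>c\<in>C. indicator {0..1} (merge B C (x, y) c)) = (\<Prod>c\<in>C. indicator {0..1} (y c) :: ennreal)"
        using disj by (intro prod.cong) (auto simp: merge_def)
      ultimately show ?thesis by (simp add: F_def cp ip)
    qed
    then have "(\<integral>\<^sup>+y. F (?s (B \<union> C) (merge B C (x, y))) \<partial>(\<Pi>\<^sub>M b\<in>C. (lborel :: real measure))) =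
       f (?s B x) * (\<integral>\<^sup>+y. (\<Prod>c\<in>C. indicator {0..1} (y c)) \<partial>(\<Pi>\<^sub>M b\<in>C. (lborel :: real measure)))"
      by (simp add: nn_integral_cmult)
    also have "(\<integral>\<^sup>+y. (\<Prod>c\<in>C. indicator {0..1} (y c)) \<partial>(\<Pi>\<^sub>M b\<in>C. (lborel :: real measure))) =
       (\<Prod>c\<in>C. (\<integral>\<^sup>+t. indicator {0..1} (t::real) \<partial>lborel))"
      by (rule lborel_product.product_nn_integral_prod[OF fin(2)]) simp
    also have "\<dots> = 1" by simp
    finally show "(\<integral>\<^sup>+y. F (?s (B \<union> C) (merge B C (x, y))) \<partial>(\<Pi>\<^sub>M b\<in>C. (lborel :: real measure))) = f (?s B x)"
      by simp
  qed
  also have "\<dots> = (\<integral>\<^sup>+x. f x \<partial>subspace_measure E B)"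
    by (rule nn_integral_subspace_measure[OF B f, symmetric])
  finally show ?thesis by (simp add: F_def)
qed

lemma subspace_measure_basis_independent:
  fixes E :: "'a::euclidean_space set"
  assumes B: "orthonormal_basis E B" and B': "orthonormal_basis E B'"
  shows "subspace_measure E B = subspace_measure E B'"
proof (rule measure_eqI)
  \<comment> \<open>As \<open>C\<close> is orthogonal to all of \<open>E\<close>, it also completes
    \<open>B'\<close>; both integrals then equal the same integral over the whole space.\<close>
  obtain C where C: "orthonormal_basis UNIV (B \<union> C)" "B \<inter> C = {}" "\<And>x c. x \<in> E \<Longrightarrow> c \<in> C \<Longrightarrow> x \<bullet> c = 0"
    using orthonormal_basis_extend[OF B] by metis
  have C1: "norm c = 1" if "c \<in> C" for c using C(1) that by (simp add: orthonormal_basis_def)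
  have BE: "B \<subseteq> E" "B' \<subseteq> E" "span B' = E" "span B = E" using B B' by (auto simp: orthonormal_basis_def)
  have disj: "B' \<inter> C = {}"
  proof (intro equals0I)
    fix c assume "c \<in> B' \<inter> C"
    then show False using C(3)[of c c] C1[of c] BE by auto
  qed
  have "orthonormal_basis UNIV (B' \<union> C)"
  proof -
    have "orthogonal x y" "orthogonal y x" if "x \<in> B'" "y \<in> C" for x y
      using C(3)[of x y] that BE by (auto simp: orthogonal_def inner_commute)
    moreover have "pairwise orthogonal C" using C(1) by (auto simp: orthonormal_basis_def pairwise_def)
    ultimately have "pairwise orthogonal (B' \<union> C)"
      using B' by (auto simp: orthonormal_basis_def pairwise_def)
    moreover have "span (B' \<union> C) = UNIV"
      using C(1) BE by (simp add: orthonormal_basis_def span_Un)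
    ultimately show ?thesis using B' C1 by (auto simp: orthonormal_basis_def)
  qed
  note C' = this disj
  fix A assume "A \<in> sets (subspace_measure E B)"
  then have A: "A \<in> sets (restrict_space borel E)" by (simp add: sets_subspace_measure)
  then have mA: "(indicator A :: 'a \<Rightarrow> ennreal) \<in> borel_measurable (restrict_space borel E)" by simp
  have "emeasure (subspace_measure E B) A = (\<integral>\<^sup>+x. indicator A x \<partial>subspace_measure E B)"
    using A by (simp add: sets_subspace_measure)
  also have "\<dots> = (\<integral>\<^sup>+x. indicator A x \<partial>subspace_measure E B')"
    unfolding nn_integral_subspace_measure_lborel[OF B mA C(1,2)]
      nn_integral_subspace_measure_lborel[OF B' mA C'] ..
  also have "\<dots> = emeasure (subspace_measure E B') A"
    using A by (simp add: sets_subspace_measure)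
  finally show "emeasure (subspace_measure E B) A = emeasure (subspace_measure E B') A" .
qed (simp add: sets_subspace_measure)

lemma linear_measurable_restrict:
  fixes g :: "'a::euclidean_space \<Rightarrow> 'a"
  assumes "linear g" "g ` E \<subseteq> F"
  shows "g \<in> measurable (restrict_space borel E) (restrict_space borel F)"
proof (rule measurable_restrict_space3)
  show "g \<in> borel_measurable borel"
    using assms(1) by (rule borel_measurable_linear)
qed (use assms in auto)

text \<open>The complementary basis is moved by \<open>U\<close> as well. Projections and inner
  products are then equivariant, and invariance of Lebesgue measure on the whole space gives the
  claim.\<close>

lemma nn_integral_subspace_measure_orthogonal:
  fixes U :: "'a::euclidean_space \<Rightarrow> 'a" and E :: "'a::euclidean_space set"
  assumes U: "orthogonal_transformation U" and B: "orthonormal_basis E B"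
    and f: "f \<in> borel_measurable (restrict_space borel (U ` E))"
  shows "orthonormal_basis (U ` E) (U ` B)"
    "(\<integral>\<^sup>+x. f x \<partial>subspace_measure (U ` E) (U ` B)) = (\<integral>\<^sup>+x. f (U x) \<partial>subspace_measure E B)"
proof -
  have lin: "linear U" using U by (rule orthogonal_transformation_linear)
  have isom: "U x \<bullet> U y = x \<bullet> y" for x y using U by (simp add: orthogonal_transformation_def)
  have inj: "inj U" using U by (rule orthogonal_transformation_inj)
  have image: "orthonormal_basis (U ` E) (U ` B)" if "orthonormal_basis E B" for E B
    using that linear_span_image[OF lin, of B] orthogonal_transformation_norm[OF U]
    by (auto simp: orthonormal_basis_def pairwise_def orthogonal_def isom)
  show UB: "orthonormal_basis (U ` E) (U ` B)" by (rule image[OF B])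
  obtain C where C: "orthonormal_basis UNIV (B \<union> C)" "B \<inter> C = {}"
    using orthonormal_basis_extend[OF B] by metis
  have UC: "orthonormal_basis UNIV (U ` B \<union> U ` C)" "U ` B \<inter> U ` C = {}"
    using image[OF C(1)] orthogonal_transformation_surj[OF U] C(2) inj
    by (simp_all add: image_Un image_Int[symmetric])
  have sub: "subspace (U ` E)" "subspace E" using UB B by (metis orthonormal_basis_def subspace_span)+
  have cp: "closest_point (U ` E) (U x) = U (closest_point E x)" for x
    unfolding closest_point_orthonormal_basis[OF UB] closest_point_orthonormal_basis[OF B]
    by (simp add: sum.reindex inj_on_subset[OF inj] isom linear_sum[OF lin] linear_cmul[OF lin])
  have fU: "(\<lambda>x. f (U x)) \<in> borel_measurable (restrict_space borel E)"
    by (rule measurable_compose[OF linear_measurable_restrict[OF lin] f]) simp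
  have linE: "linear (closest_point (U ` E))" by (rule closest_point_subspace(2)[OF sub(1)])
  have [measurable]: "(\<lambda>x. f (closest_point (U ` E) x)) \<in> borel_measurable borel"
    using measurable_compose[OF linear_measurable_restrict[OF linE, of UNIV] f] closest_point_subspace(1)[OF sub(1)]
    by (simp add: image_subset_iff)
  have [measurable]: "U \<in> borel_measurable borel"
    using lin by (rule borel_measurable_linear)
  have "(\<integral>\<^sup>+x. f x \<partial>subspace_measure (U ` E) (U ` B)) =
     (\<integral>\<^sup>+x. f (closest_point (U ` E) x) * (\<Prod>c\<in>U ` C. indicator {0..1} (x \<bullet> c)) \<partial>distr lborel borel U)"
    unfolding lborel_distr_orthogonal_transformation[OF U]
    by (rule nn_integral_subspace_measure_lborel[OF UB f UC])
  also have "\<dots> = (\<integral>\<^sup>+x. f (U (closest_point E x)) * (\<Prod>c\<in>C. indicator {0..1} (x \<bullet> c)) \<partial>lborel)"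
    by (subst nn_integral_distr) (simp_all add: cp prod.reindex inj_on_subset[OF inj] isom)
  also have "\<dots> = (\<integral>\<^sup>+x. f (U x) \<partial>subspace_measure E B)"
    by (rule nn_integral_subspace_measure_lborel[OF B fU C, symmetric])
  finally show "(\<integral>\<^sup>+x. f x \<partial>subspace_measure (U ` E) (U ` B)) = (\<integral>\<^sup>+x. f (U x) \<partial>subspace_measure E B)" .
qed

section \<open>Axis scalings on a subspace\<close>

lemma closest_point_axis:
  fixes E :: "(real ^ 'n) set"
  assumes sub: "subspace E" and x: "x \<in> E"
  shows "closest_point E (axis a 1) \<bullet> x = x $ a"
  using closest_point_subspace(4)[OF sub, of "axis a 1" x] closest_point_subspace(3)[OF sub x]
  by (simp add: inner_axis')

lemma scaling_det_projection_matrix: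
  "scaling_det a t (projection_matrix E) = 1 + (t\<^sup>2 - 1) * closest_point E (axis a 1) $ a"
  by (simp add: scaling_det_def projection_matrix_entry)

text \<open>The scaling fixes the vectors of \<open>E\<close> orthogonal to \<open>u\<close>, since
  their \<open>a\<close>-th coordinate is 0. In a basis made of the direction \<open>b\<close> of
  \<open>u\<close> and of such vectors, only \<open>b\<close> is stretched, and its image stays
  orthogonal to the others. Fubini thus leaves a one-dimensional substitution. The bases are part of
  the conclusion because they depend on \<open>E\<close>.\<close>

lemma nn_integral_subspace_measure_axis_scaling:
  fixes E :: "(real ^ 'n) set"
  assumes sub: "subspace E" and t: "t > 0"
  obtains B B' where "orthonormal_basis E B" "orthonormal_basis (axis_scaling a t ` E) B'"
    "\<And>f. f \<in> borel_measurable (restrict_space borel (axis_scaling a t ` E)) \<Longrightarrow>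
      (\<integral>\<^sup>+x. f x \<partial>subspace_measure (axis_scaling a t ` E) B') =
      ennreal (sqrt (scaling_det a t (projection_matrix E))) * (\<integral>\<^sup>+x. f (axis_scaling a t x) \<partial>subspace_measure E B)"
proof -
  let ?D = "axis_scaling a t"
  define u where "u = closest_point E (axis a 1)"
  have u: "u \<in> E" unfolding u_def by (rule closest_point_subspace(1)[OF sub])
  have inner_u: "u \<bullet> x = x $ a" if "x \<in> E" for x unfolding u_def by (rule closest_point_axis[OF sub that])
  have fixed: "?D x = x" if "x $ a = 0" for x using that by (simp add: axis_scaling_def)
  show ?thesis
  proof (cases "u = 0")
    case True
    \<comment> \<open>If the axis is orthogonal to \<open>E\<close>, the scaling is the identity on
      \<open>E\<close>.\<close>
    then have D: "?D x = x" if "x \<in> E" for x using inner_u[OF that] by (intro fixed) simp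
    then have DE: "?D ` E = E" by (simp add: image_def)
    have det: "scaling_det a t (projection_matrix E) = 1"
      using True by (simp add: scaling_det_projection_matrix u_def)
    obtain B where B: "orthonormal_basis E B" using orthonormal_basis_exists[OF sub] .
    have "(\<integral>\<^sup>+x. f (?D x) \<partial>subspace_measure E B) = (\<integral>\<^sup>+x. f x \<partial>subspace_measure E B)" for f
      by (intro nn_integral_cong) (simp add: D)
    then show ?thesis using that[OF B, of B] B by (simp add: DE det)
  next
    case False
    define b where "b = u /\<^sub>R norm u"
    have b: "b \<in> E" "norm b = 1" using u sub False by (auto simp: b_def intro: subspace_scale)
    define F where "F = E \<inter> {x. u \<bullet> x = 0}"
    have "subspace F" unfolding F_def by (intro subspace_inter sub subspace_hyperplane)
    then obtain B0 where B0: "orthonormal_basis F B0" using orthonormal_basis_exists by blast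
    have B0F: "B0 \<subseteq> F" "finite B0" using B0 orthonormal_basis_independent(2)[OF B0] by (auto simp: orthonormal_basis_def)
    have b0: "b \<bullet> w = 0" "?D w = w" "w \<in> E" if "w \<in> F" for w
      using that inner_u[of w] by (auto simp: F_def b_def intro: fixed)
    have B: "orthonormal_basis E (insert b B0)"
    proof -
      have "x \<in> span (insert b B0)" if x: "x \<in> E" for x
      proof -
        have "x - (x \<bullet> b) *\<^sub>R b \<in> F"
          using x b False by (auto simp: F_def intro!: subspace_diff[OF sub] subspace_scale[OF sub])
             (simp add: b_def inner_diff_right inner_commute norm_eq_sqrt_inner)
        then have "x - (x \<bullet> b) *\<^sub>R b \<in> span B0" using B0 by (simp add: orthonormal_basis_def)
        then show ?thesis unfolding span_insert by blast
      qed
      moreover have "span (insert b B0) \<subseteq> E"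
        using b B0F b0 sub by (intro span_minimal) auto
      moreover have "pairwise orthogonal (insert b B0)"
        using B0 b0(1) B0F by (auto simp: orthonormal_basis_def pairwise_insert orthogonal_def inner_commute)
      ultimately show ?thesis using B0 b b0 B0F by (auto simp: orthonormal_basis_def)
    qed
    define r where "r = norm (?D b)"
    have D0: "?D x \<noteq> 0" if "x \<noteq> 0" for x
      using inj_axis_scaling[of t a] t that linear_0[OF linear_axis_scaling] by (metis injD less_irrefl)
    have "b \<noteq> 0" using b(2) by auto
    then have r: "r > 0" by (simp add: r_def D0)
    \<comment> \<open>By self-adjointness \<open>r\<^sup>2\<close> is the inner product of
      \<open>b\<close> with its double scaling, that is
      \<open>1 + (t\<^sup>2 - 1) * (b $ a)\<^sup>2\<close>; and
      \<open>(b $ a)\<^sup>2 = u $ a\<close> because \<open>u \<bullet> u = u $ a\<close>.\<close>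
    have r_eq: "r = sqrt (scaling_det a t (projection_matrix E))"
    proof -
      have "u \<bullet> u = u $ a" by (rule inner_u[OF u])
      then have "(b $ a)\<^sup>2 = u $ a"
        using False by (simp add: b_def power2_eq_square field_simps flip: power2_norm_eq_inner)
      moreover have "r\<^sup>2 = b \<bullet> b + (t\<^sup>2 - 1) * (b $ a)\<^sup>2"
        unfolding r_def power2_norm_eq_inner axis_scaling_inner axis_scaling_mult
        by (simp add: axis_scaling_def inner_add_right inner_axis power2_eq_square)
      moreover have "b \<bullet> b = 1" using b(2) by (simp add: norm_eq_1)
      ultimately have "r\<^sup>2 = scaling_det a t (projection_matrix E)"
        by (simp add: scaling_det_projection_matrix u_def)
      then show ?thesis using r by (metis less_imp_le real_sqrt_unique)
    qed
    define b' where "b' = ?D b /\<^sub>R r"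
    have Db: "?D b = r *\<^sub>R b'" using r by (simp add: b'_def)
    have b': "norm b' = 1" using r by (simp add: b'_def) (simp add: r_def)
    \<comment> \<open>The scaling is self-adjoint and fixes \<open>F\<close> pointwise, so it can be
      moved off \<open>b\<close>.\<close>
    have b'0: "b' \<bullet> w = 0" if "w \<in> F" for w
      using b0[OF that] by (simp add: b'_def axis_scaling_inner)
    have notin: "b \<notin> B0" "b' \<notin> B0" "?D b \<notin> B0"
    proof -
      have "?D b \<bullet> ?D b = 0" if "?D b \<in> F" using b0[OF that] by (simp only: axis_scaling_inner)
      then show "b \<notin> B0" "b' \<notin> B0" "?D b \<notin> B0"
        using b0(1)[of b] b'0[of b'] b(2) b' B0F D0[OF \<open>b \<noteq> 0\<close>] by (auto dest!: subsetD)
    qed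
    have B': "orthonormal_basis (?D ` E) (insert b' B0)"
    proof -
      have "?D ` E = span (?D ` insert b B0)"
        using B linear_span_image[OF linear_axis_scaling, of a t "insert b B0"] by (simp add: orthonormal_basis_def)
      also have "?D ` insert b B0 = insert (?D b) B0"
      proof -
        have "?D ` B0 = (\<lambda>x. x) ` B0" using b0(2) B0F by (intro image_cong refl) auto
        then show ?thesis by simp
      qed
      \<comment> \<open>Normalising the single vector \<open>?D b\<close> does not change the
        span.\<close>
      also have "span (insert (?D b) B0) = span ((\<lambda>x. (if x = ?D b then inverse r else 1) *\<^sub>R x) ` insert (?D b) B0)"
        using r B0F by (intro span_image_scale[symmetric]) auto
      also have "(\<lambda>x. (if x = ?D b then inverse r else 1) *\<^sub>R x) ` insert (?D b) B0 = insert b' B0"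
      proof -
        have "(\<lambda>x. (if x = ?D b then inverse r else 1) *\<^sub>R x) ` B0 = (\<lambda>x. x) ` B0"
          using notin by (intro image_cong refl) auto
        then show ?thesis by (simp add: b'_def)
      qed
      finally have "span (insert b' B0) = ?D ` E" ..
      moreover have "pairwise orthogonal (insert b' B0)"
        using B0 b'0 B0F by (auto simp: orthonormal_basis_def pairwise_insert orthogonal_def inner_commute)
      ultimately show ?thesis using B0 b' span_superset[of "insert b' B0"] by (auto simp: orthonormal_basis_def)
    qed
    have subD: "subspace (?D ` E)" using linear_axis_scaling sub by (rule linear_subspace_image)
    show ?thesis
    proof (rule that[OF B B'])
      fix f :: "real ^ 'n \<Rightarrow> ennreal"
      assume f: "f \<in> borel_measurable (restrict_space borel (?D ` E))"
      have Df: "(\<lambda>x. f (?D x)) \<in> borel_measurable (restrict_space borel E)"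
        by (rule measurable_compose[OF linear_measurable_restrict[OF linear_axis_scaling] f]) simp
      let ?s = "\<lambda>J c. \<Sum>b\<in>J. c b *\<^sub>R b"
      have ins: "?s (insert v B0) (c(v := y)) = y *\<^sub>R v + ?s B0 c" if "v \<notin> B0" for v c y
      proof -
        have "?s B0 (c(v := y)) = ?s B0 c" using that by (intro sum.cong) auto
        then show ?thesis using that B0F(2) by simp
      qed
      have "(\<integral>\<^sup>+x. f x \<partial>subspace_measure (?D ` E) (insert b' B0)) =
          (\<integral>\<^sup>+c. (\<integral>\<^sup>+y. f (y *\<^sub>R b' + ?s B0 c) \<partial>lborel) \<partial>(\<Pi>\<^sub>M b\<in>B0. (lborel :: real measure)))"
        unfolding nn_integral_subspace_measure[OF B' f]
        by (subst lborel_product.product_nn_integral_insert[OF B0F(2) notin(2)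
              measurable_compose[OF measurable_basis_sum_subspace[OF B'] f]])
          (simp only: ins[OF notin(2)])
      also have "\<dots> = (\<integral>\<^sup>+c. ennreal r * (\<integral>\<^sup>+y. f (?D (y *\<^sub>R b + ?s B0 c)) \<partial>lborel) \<partial>(\<Pi>\<^sub>M b\<in>B0. (lborel :: real measure)))"
      proof (rule nn_integral_cong)
        fix c
        have s0: "?s B0 c \<in> F"
          using B0F \<open>subspace F\<close> by (auto intro!: subspace_sum subspace_scale)
        have Ds: "?D (y *\<^sub>R b + ?s B0 c) = (r * y) *\<^sub>R b' + ?s B0 c" for y
          by (simp add: linear_add[OF linear_axis_scaling] linear_cmul[OF linear_axis_scaling] b0(2)[OF s0] Db)
        have "y *\<^sub>R b' + ?s B0 c \<in> ?D ` E" for y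
        proof -
          have "b' \<in> ?D ` E" using B' by (auto simp: orthonormal_basis_def)
          moreover have "?s B0 c \<in> ?D ` E" using imageI[OF b0(3)[OF s0], of ?D] unfolding b0(2)[OF s0] .
          ultimately show ?thesis by (intro subspace_add[OF subD] subspace_scale[OF subD])
        qed
        then have "(\<lambda>y. y *\<^sub>R b' + ?s B0 c) \<in> measurable borel (restrict_space borel (?D ` E))"
          by (intro measurable_restrict_space2) auto
        from nn_integral_real_affine[OF measurable_compose[OF this f], of r 0] r
        show "(\<integral>\<^sup>+y. f (y *\<^sub>R b' + ?s B0 c) \<partial>lborel) = ennreal r * (\<integral>\<^sup>+y. f (?D (y *\<^sub>R b + ?s B0 c)) \<partial>lborel)"
          unfolding Ds by simp
      qed
      also have "\<dots> = (\<integral>\<^sup>+c. (\<integral>\<^sup>+y. ennreal r * f (?D (y *\<^sub>R b + ?s B0 c)) \<partial>lborel) \<partial>(\<Pi>\<^sub>M b\<in>B0. (lborel :: real measure)))"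
      proof (rule nn_integral_cong)
        fix c
        have "?s B0 c \<in> E" using B0F \<open>subspace F\<close> by (intro b0(3) subspace_sum subspace_scale) auto
        then have "y *\<^sub>R b + ?s B0 c \<in> E" for y using b by (intro subspace_add[OF sub] subspace_scale[OF sub])
        then have "(\<lambda>y. y *\<^sub>R b + ?s B0 c) \<in> measurable borel (restrict_space borel E)"
          by (intro measurable_restrict_space2) auto
        from measurable_compose[OF this Df]
        show "ennreal r * (\<integral>\<^sup>+y. f (?D (y *\<^sub>R b + ?s B0 c)) \<partial>lborel) =
          (\<integral>\<^sup>+y. ennreal r * f (?D (y *\<^sub>R b + ?s B0 c)) \<partial>lborel)"
          by (intro nn_integral_cmult[symmetric]) simp
      qed
      also have "\<dots> = (\<integral>\<^sup>+x. ennreal r * f (?D x) \<partial>subspace_measure E (insert b B0))"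
      proof -
        have m: "(\<lambda>x. ennreal r * f (?D x)) \<in> borel_measurable (restrict_space borel E)" using Df by simp
        show ?thesis
          unfolding nn_integral_subspace_measure[OF B m]
          by (subst lborel_product.product_nn_integral_insert[OF B0F(2) notin(1)
              measurable_compose[OF measurable_basis_sum_subspace[OF B] m]])
            (simp only: ins[OF notin(1)])
      qed
      also have "\<dots> = ennreal r * (\<integral>\<^sup>+x. f (?D x) \<partial>subspace_measure E (insert b B0))"
        using Df by (intro nn_integral_cmult) (simp cong: measurable_cong_sets add: sets_subspace_measure)
      finally show "(\<integral>\<^sup>+x. f x \<partial>subspace_measure (?D ` E) (insert b' B0)) =
        ennreal (sqrt (scaling_det a t (projection_matrix E))) * (\<integral>\<^sup>+x. f (?D x) \<partial>subspace_measure E (insert b B0))"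
        by (simp only: r_eq)
    qed
  qed
qed

subsection \<open>Change of variables on the Grassmannian\<close>

text \<open>The integrand need not be measurable; \<open>nn_integral\<close> is then a lower integral, for which the
  change of variables formula still holds.\<close>

lemma nn_integral_change_of_variables_le:
  assumes eq: "\<And>h. h \<in> borel_measurable N \<Longrightarrow> (\<integral>\<^sup>+x. h x \<partial>N) = c * (\<integral>\<^sup>+x. h (T x) * w x \<partial>M)"
  shows "(\<integral>\<^sup>+x. f x \<partial>N) \<le> c * (\<integral>\<^sup>+x. f (T x) * w x \<partial>M)"
  unfolding nn_integral_def[of N f]
proof (rule SUP_least, clarify)
  fix s assume s: "simple_function N s" "s \<le> f"
  have "integral\<^sup>S N s = (\<integral>\<^sup>+x. s x \<partial>N)" using s by (simp add: nn_integral_eq_simple_integral)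
  \<comment> \<open>The hypothesis applies because simple functions are measurable. Approximation
    from below gives only this direction; users obtain the other one from the inverse map.\<close>
  also have "\<dots> = c * (\<integral>\<^sup>+x. s (T x) * w x \<partial>M)" by (rule eq[OF borel_measurable_simple_function[OF s(1)]])
  also have "\<dots> \<le> c * (\<integral>\<^sup>+x. f (T x) * w x \<partial>M)"
    using s(2) by (intro nn_integral_mono mult_right_mono mult_left_mono) (auto simp: le_fun_def)
  finally show "integral\<^sup>S N s \<le> c * (\<integral>\<^sup>+x. f (T x) * w x \<partial>M)" .
qed

lemma nn_integral_lebesgue_subspace:
  "(\<integral>\<^sup>+x. f x \<partial>lebesgue_subspace E) = (\<integral>\<^sup>+x. f x \<partial>subspace_measure E (onb E))"
  unfolding lebesgue_subspace_def subspace_measure_def by (rule nn_integral_completion)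

text \<open>Basis independence replaces \<open>onb\<close> by the adapted bases. The formula then
  extends from measurable to arbitrary integrands by two inequalities: one for \<open>g\<close> with
  factor \<open>r\<close>, one for its inverse with factor \<open>1 / r\<close>.\<close>

lemma nn_integral_lebesgue_subspace_image:
  fixes g :: "real ^ 'n \<Rightarrow> real ^ 'n"
  assumes g: "linear g" "inj g" and sub: "subspace E" and "r > 0"
    and B: "orthonormal_basis E B" and B': "orthonormal_basis (g ` E) B'"
    and eq: "\<And>h. h \<in> borel_measurable (restrict_space borel (g ` E)) \<Longrightarrow>
      (\<integral>\<^sup>+x. h x \<partial>subspace_measure (g ` E) B') = ennreal r * (\<integral>\<^sup>+x. h (g x) \<partial>subspace_measure E B)"
  shows "(\<integral>\<^sup>+x. f x \<partial>lebesgue_subspace (g ` E)) = ennreal r * (\<integral>\<^sup>+x. f (g x) \<partial>lebesgue_subspace E)"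
proof -
  have subg: "subspace (g ` E)" using g(1) sub by (rule linear_subspace_image)
  define L L' where "L = subspace_measure E B" and "L' = subspace_measure (g ` E) B'"
  have L: "(\<integral>\<^sup>+x. f x \<partial>lebesgue_subspace E) = (\<integral>\<^sup>+x. f x \<partial>L)"
    "(\<integral>\<^sup>+x. f x \<partial>lebesgue_subspace (g ` E)) = (\<integral>\<^sup>+x. f x \<partial>L')" for f
    unfolding nn_integral_lebesgue_subspace L_def L'_def
      subspace_measure_basis_independent[OF orthonormal_basis_onb[OF sub] B]
      subspace_measure_basis_independent[OF orthonormal_basis_onb[OF subg] B'] by simp_all
  have m: "borel_measurable L = borel_measurable (restrict_space borel E)"
    "borel_measurable L' = borel_measurable (restrict_space borel (g ` E))"
    unfolding L_def L'_def by (rule measurable_cong_sets[OF sets_subspace_measure refl])+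
  have inv_g: "inv g (g x) = x" for x using g(2) by simp
  have lin_inv: "linear (inv g)"
    using g by (intro inj_linear_imp_inv_linear)
  have le: "(\<integral>\<^sup>+x. f x \<partial>L') \<le> ennreal r * (\<integral>\<^sup>+x. f (g x) * 1 \<partial>L)" for f
    by (rule nn_integral_change_of_variables_le) (use eq m in \<open>simp add: L_def L'_def\<close>)
  have ge: "(\<integral>\<^sup>+x. f x \<partial>L) \<le> ennreal (1 / r) * (\<integral>\<^sup>+x. f (inv g x) * 1 \<partial>L')" for f
  proof (rule nn_integral_change_of_variables_le)
    fix h :: "real ^ 'n \<Rightarrow> ennreal" assume h: "h \<in> borel_measurable L"
    have "inv g \<in> measurable (restrict_space borel (g ` E)) (restrict_space borel E)"
      using lin_inv inv_g by (intro linear_measurable_restrict) auto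
    then have "(\<lambda>x. h (inv g x)) \<in> borel_measurable (restrict_space borel (g ` E))"
      by (rule measurable_compose) (rule h[unfolded m])
    from eq[OF this] have "(\<integral>\<^sup>+x. h (inv g x) \<partial>L') = ennreal r * (\<integral>\<^sup>+x. h x \<partial>L)"
      by (simp only: inv_g L_def L'_def)
    moreover have "ennreal (1 / r) * ennreal r = 1"
      using \<open>r > 0\<close> by (simp add: ennreal_mult[symmetric])
    ultimately show "(\<integral>\<^sup>+x. h x \<partial>L) = ennreal (1 / r) * (\<integral>\<^sup>+x. h (inv g x) * 1 \<partial>L')"
      by (simp add: mult.assoc[symmetric])
  qed
  have "ennreal r * (\<integral>\<^sup>+x. f (g x) \<partial>L) \<le> ennreal r * (ennreal (1 / r) * (\<integral>\<^sup>+x. f (g (inv g x)) * 1 \<partial>L'))"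
    by (intro mult_left_mono ge[of "\<lambda>x. f (g x)"]) simp
  also have "(\<integral>\<^sup>+x. f (g (inv g x)) * 1 \<partial>L') = (\<integral>\<^sup>+x. f x \<partial>L')"
    by (intro nn_integral_cong) (auto simp: L'_def inv_g)
  also have "ennreal r * (ennreal (1 / r) * (\<integral>\<^sup>+x. f x \<partial>L')) = (\<integral>\<^sup>+x. f x \<partial>L')"
    using \<open>r > 0\<close> by (simp add: mult.assoc[symmetric] ennreal_mult[symmetric])
  finally show ?thesis unfolding L using le[of f] by (intro antisym) simp_all
qed

section \<open>The Haar measure as an invariant law of projections\<close>

locale haar_grassmannian =
  fixes \<mu> :: "(real ^ 'n) set measure" and k :: nat
  assumes haar: "is_haar_grassmannian k \<mu>"
begin

lemma space_haar: "space \<mu> = grassmannian k"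
  and sets_haar: "sets \<mu> = sets (vimage_algebra (grassmannian k) projection_matrix borel)"
  and prob_haar: "prob_space \<mu>"
  using haar sets_grassmannian_borel by (auto simp: is_haar_grassmannian_def)

lemma measurable_projection_matrix [measurable]: "projection_matrix \<in> borel_measurable \<mu>"
  using measurable_vimage_algebra1[of projection_matrix "grassmannian k" borel]
  by (simp add: measurable_cong_sets[OF sets_haar refl])

lemma measurable_haarI:
  assumes "\<And>x. x \<in> space N \<Longrightarrow> T x \<in> grassmannian k"
    and "(\<lambda>x. projection_matrix (T x)) \<in> borel_measurable N"
  shows "T \<in> measurable N \<mu>"
proof -
  have "T \<in> measurable N (vimage_algebra (grassmannian k) projection_matrix borel)"
    using assms by (intro measurable_vimage_algebra2) auto
  then show ?thesis by (simp add: measurable_cong_sets[OF refl sets_haar])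
qed

lemma sets_haarE:
  assumes "A \<in> sets \<mu>"
  obtains A' where "A' \<in> sets borel" "A = projection_matrix -` A' \<inter> grassmannian k"
  using assms by (auto simp: sets_haar sets_vimage_algebra2)

lemma measurable_orthogonal_image:
  assumes U: "orthogonal_transformation U"
  shows "(\<lambda>E. U ` E) \<in> measurable \<mu> \<mu>"
proof (rule measurable_haarI)
  have lin: "linear U" "inj U" using U by (auto intro: orthogonal_transformation_linear orthogonal_transformation_inj)
  show "U ` E \<in> grassmannian k" if "E \<in> space \<mu>" for E
    using that lin by (simp add: space_haar linear_image_grassmannian)
  have "continuous_on UNIV (\<lambda>P. matrix U ** P ** transpose (matrix U))"
    unfolding matrix_matrix_mult_def by (intro continuous_intros)
  from measurable_compose[OF measurable_projection_matrix borel_measurable_continuous_onI[OF this]]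
  show "(\<lambda>E. projection_matrix (U ` E)) \<in> borel_measurable \<mu>"
    by (subst measurable_cong[where g="\<lambda>E. matrix U ** projection_matrix E ** transpose (matrix U)"])
      (auto simp: space_haar grassmannian_def projection_matrix_orthogonal_image[OF U])
qed

text \<open>The Haar condition speaks of images, \<open>distr\<close> of preimages; the preimage
  under \<open>U\<close> is the image under \<open>inv U\<close>, which is orthogonal too.\<close>

lemma distr_orthogonal_image:
  assumes U: "orthogonal_transformation U"
  shows "distr \<mu> \<mu> (\<lambda>E. U ` E) = \<mu>"
proof (rule measure_eqI)
  fix A assume "A \<in> sets (distr \<mu> \<mu> (\<lambda>E. U ` E))"
  then have A: "A \<in> sets \<mu>" by simp
  have inv: "orthogonal_transformation (inv U)" by (rule orthogonal_transformation_inv[OF U])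
  have 1: "inv U ` (U ` E) = E" "U ` (inv U ` E) = E" for E
    using orthogonal_transformation_bij[OF U]
    by (simp_all add: image_inv_f_f bij_is_inj image_f_inv_f bij_is_surj)
  have "inv U ` E \<in> grassmannian k" if "E \<in> grassmannian k" for E
    using measurable_space[OF measurable_orthogonal_image[OF inv], of E] that by (simp add: space_haar)
  then have "(\<lambda>E. U ` E) -` A \<inter> space \<mu> = (\<lambda>E. inv U ` E) ` A"
    using sets.sets_into_space[OF A] 1 by (auto simp: space_haar image_iff subset_iff) metis
  then have "emeasure (distr \<mu> \<mu> (\<lambda>E. U ` E)) A = emeasure \<mu> ((\<lambda>E. inv U ` E) ` A)"
    using A by (simp add: emeasure_distr[OF measurable_orthogonal_image[OF U]])
  also have "\<dots> = emeasure \<mu> A" using haar inv A by (simp add: is_haar_grassmannian_def)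
  finally show "emeasure (distr \<mu> \<mu> (\<lambda>E. U ` E)) A = emeasure \<mu> A" .
qed simp

sublocale projection_law \<mu> projection_matrix k
proof (intro projection_law.intro projection_law_axioms.intro prob_haar measurable_projection_matrix)
  show "projection_matrix E \<in> projection_matrices k" if "E \<in> space \<mu>" for E
    using that by (simp add: space_haar projection_matrix_in)
  fix Q :: "real ^ 'n ^ 'n" assume Q: "orthogonal_matrix Q"
  define U where "U = (*v) Q"
  have mat: "matrix U = Q" by (simp add: U_def)
  have U: "orthogonal_transformation U"
    using Q by (simp add: orthogonal_transformation_matrix mat) (simp add: U_def)
  have "distr \<mu> borel (\<lambda>E. Q ** projection_matrix E ** transpose Q) = distr \<mu> borel (\<lambda>E. projection_matrix (U ` E))"
    by (intro distr_cong) (auto simp: space_haar grassmannian_def projection_matrix_orthogonal_image[OF U] mat)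
  also have "\<dots> = distr (distr \<mu> \<mu> (\<lambda>E. U ` E)) borel projection_matrix"
    by (subst distr_distr[OF measurable_projection_matrix measurable_orthogonal_image[OF U]]) (simp add: comp_def)
  also have "\<dots> = distr \<mu> borel projection_matrix" by (simp add: distr_orthogonal_image[OF U])
  finally show "distr \<mu> borel (\<lambda>E. Q ** projection_matrix E ** transpose Q) = distr \<mu> borel projection_matrix" .
qed

text \<open>Everything that must pass through compositions is bundled here. The number
  \<open>\<delta>\<close> stands for the absolute determinant but is pinned down by Lebesgue
  integrals, so preservation of volume can be read off directly. The clause on subspaces covers all
  integrands, the clause on \<open>\<mu>\<close> only measurable ones.\<close>

definition change_of_variables :: "(real ^ 'n \<Rightarrow> real ^ 'n) \<Rightarrow> real \<Rightarrow> ((real ^ 'n) set \<Rightarrow> real) \<Rightarrow> bool" where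
  "change_of_variables g \<delta> J \<longleftrightarrow> linear g \<and> inj g \<and> \<delta> > 0 \<and>
     (\<forall>h\<in>borel_measurable borel. (\<integral>\<^sup>+x. h x \<partial>lborel) = ennreal \<delta> * (\<integral>\<^sup>+x. h (g x) \<partial>lborel)) \<and>
     (\<lambda>E. g ` E) \<in> measurable \<mu> \<mu> \<and> J \<in> borel_measurable \<mu> \<and>
     (\<forall>E\<in>grassmannian k. J E > 0 \<and>
        (\<forall>f. (\<integral>\<^sup>+x. f x \<partial>lebesgue_subspace (g ` E)) = ennreal (J E) * (\<integral>\<^sup>+x. f (g x) \<partial>lebesgue_subspace E))) \<and>
     (\<forall>\<Phi>\<in>borel_measurable \<mu>. (\<integral>\<^sup>+E. \<Phi> E \<partial>\<mu>) =
        ennreal (\<delta> powr real k) * (\<integral>\<^sup>+E. \<Phi> (g ` E) * ennreal (J E powr (- real CARD('n))) \<partial>\<mu>))"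

end

lemma nn_integral_lborel_axis_scaling:
  fixes h :: "real ^ 'n \<Rightarrow> ennreal"
  assumes t: "t > 0" and [measurable]: "h \<in> borel_measurable borel"
  shows "(\<integral>\<^sup>+x. h x \<partial>lborel) = ennreal t * (\<integral>\<^sup>+x. h (axis_scaling a t x) \<partial>lborel)"
proof -
  define c :: "real ^ 'n \<Rightarrow> real" where "c j = (if j = axis a 1 then t else 1)" for j
  have a: "axis a 1 \<in> (Basis :: (real ^ 'n) set)" by (simp add: axis_in_Basis_iff)
  have [measurable]: "axis_scaling a t \<in> borel_measurable borel"
    by (rule borel_measurable_linear[OF linear_axis_scaling])
  have "0 + (\<Sum>j\<in>Basis. (c j * (x \<bullet> j)) *\<^sub>R j) = axis_scaling a t x" for x
  proof -
    have "(\<Sum>j\<in>Basis. (c j * (x \<bullet> j)) *\<^sub>R j) =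
        (\<Sum>j\<in>Basis. (x \<bullet> j) *\<^sub>R j + (if j = axis a 1 then ((t - 1) * (x \<bullet> j)) *\<^sub>R j else 0))"
      by (intro sum.cong) (auto simp: c_def algebra_simps)
    also have "\<dots> = x + ((t - 1) * (x \<bullet> axis a 1)) *\<^sub>R axis a 1"
      unfolding sum.distrib euclidean_representation using a by (simp add: sum.delta)
    finally show ?thesis by (simp add: axis_scaling_def inner_axis)
  qed
  moreover have "(\<Prod>j\<in>Basis. \<bar>c j\<bar>) = t"
  proof -
    have "(\<Prod>j\<in>Basis. \<bar>c j\<bar>) = (\<Prod>j\<in>(Basis :: (real ^ 'n) set). if j = axis a 1 then t else 1)"
      using t by (intro prod.cong) (auto simp: c_def)
    then show ?thesis using a by (simp add: prod.delta)
  qed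
  ultimately have "lborel = density (distr lborel borel (axis_scaling a t)) (\<lambda>_. ennreal t)"
    using lborel_affine_euclidean[of c 0] t by (simp add: c_def)
  then have "(\<integral>\<^sup>+x. h x \<partial>lborel) = (\<integral>\<^sup>+x. h x \<partial>density (distr lborel borel (axis_scaling a t)) (\<lambda>_. ennreal t))"
    by (rule arg_cong)
  also have "\<dots> = ennreal t * (\<integral>\<^sup>+x. h (axis_scaling a t x) \<partial>lborel)"
    by (simp add: nn_integral_density nn_integral_distr nn_integral_cmult)
  finally show ?thesis .
qed

text \<open>A positive finite factor maps 0 to 0 and \<open>\<infinity>\<close> to
  \<open>\<infinity>\<close>, so the conventions for negative exponents are respected.\<close>

lemma epowr_mult_left:
  assumes "c > 0"
  shows "(ennreal c * x) epowr r = ennreal (c powr r) * x epowr r"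
proof (cases "r = 0 \<or> x = 0 \<or> x = \<infinity>")
  case True
  with assms show ?thesis by (auto simp: epowr_def ennreal_mult_top)
next
  case False
  then obtain y where y: "x = ennreal y" "y > 0" by (cases x) (auto simp: zero_less_iff_neq_zero[symmetric])
  then show ?thesis using assms False
    by (simp add: epowr_def ennreal_mult[symmetric] powr_mult)
qed

context haar_grassmannian
begin

lemma change_of_variables_compose:
  assumes f: "change_of_variables f \<delta> J" and g: "change_of_variables g \<delta>' J'"
  shows "change_of_variables (f \<circ> g) (\<delta> * \<delta>') (\<lambda>E. J (g ` E) * J' E)"
proof -
  have f1: "linear f" "inj f" "\<delta> > 0"
    and f2: "\<And>h. h \<in> borel_measurable borel \<Longrightarrow> (\<integral>\<^sup>+x. h x \<partial>lborel) = ennreal \<delta> * (\<integral>\<^sup>+x. h (f x) \<partial>lborel)"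
    and f3: "(\<lambda>E. f ` E) \<in> measurable \<mu> \<mu>" and f4: "J \<in> borel_measurable \<mu>"
    and f5: "\<And>E. E \<in> grassmannian k \<Longrightarrow> J E > 0"
    and f6: "\<And>E h. E \<in> grassmannian k \<Longrightarrow>
      (\<integral>\<^sup>+x. h x \<partial>lebesgue_subspace (f ` E)) = ennreal (J E) * (\<integral>\<^sup>+x. h (f x) \<partial>lebesgue_subspace E)"
    and f7: "\<And>\<Phi>. \<Phi> \<in> borel_measurable \<mu> \<Longrightarrow> (\<integral>\<^sup>+E. \<Phi> E \<partial>\<mu>) =
        ennreal (\<delta> powr real k) * (\<integral>\<^sup>+E. \<Phi> (f ` E) * ennreal (J E powr (- real CARD('n))) \<partial>\<mu>)"
    using f unfolding change_of_variables_def by blast+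
  have g1: "linear g" "inj g" "\<delta>' > 0"
    and g2: "\<And>h. h \<in> borel_measurable borel \<Longrightarrow> (\<integral>\<^sup>+x. h x \<partial>lborel) = ennreal \<delta>' * (\<integral>\<^sup>+x. h (g x) \<partial>lborel)"
    and g3: "(\<lambda>E. g ` E) \<in> measurable \<mu> \<mu>" and g4: "J' \<in> borel_measurable \<mu>"
    and g5: "\<And>E. E \<in> grassmannian k \<Longrightarrow> J' E > 0"
    and g6: "\<And>E h. E \<in> grassmannian k \<Longrightarrow>
      (\<integral>\<^sup>+x. h x \<partial>lebesgue_subspace (g ` E)) = ennreal (J' E) * (\<integral>\<^sup>+x. h (g x) \<partial>lebesgue_subspace E)"
    and g7: "\<And>\<Phi>. \<Phi> \<in> borel_measurable \<mu> \<Longrightarrow> (\<integral>\<^sup>+E. \<Phi> E \<partial>\<mu>) =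
        ennreal (\<delta>' powr real k) * (\<integral>\<^sup>+E. \<Phi> (g ` E) * ennreal (J' E powr (- real CARD('n))) \<partial>\<mu>)"
    using g unfolding change_of_variables_def by blast+
  note [measurable] = f3 f4 g3 g4
  have gE: "g ` E \<in> grassmannian k" if "E \<in> grassmannian k" for E
    by (rule linear_image_grassmannian[OF g1(1,2) that])
  show ?thesis
    unfolding change_of_variables_def
  proof (intro conjI ballI allI)
    show "linear (f \<circ> g)" using g1(1) f1(1) by (rule linear_compose)
    show "inj (f \<circ> g)" using f1(2) g1(2) by (rule inj_compose)
    show "\<delta> * \<delta>' > 0" using f1 g1 by simp
    show "(\<lambda>E. (f \<circ> g) ` E) \<in> measurable \<mu> \<mu>"
      using measurable_compose[OF g3 f3] by (simp add: image_comp)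
    show "(\<lambda>E. J (g ` E) * J' E) \<in> borel_measurable \<mu>" by measurable
    fix h :: "real ^ 'n \<Rightarrow> ennreal" assume h: "h \<in> borel_measurable borel"
    have "(\<lambda>x. h (f x)) \<in> borel_measurable borel"
      by (rule measurable_compose[OF borel_measurable_linear[OF f1(1)] h])
    from g2[OF this] f2[OF h] show "(\<integral>\<^sup>+x. h x \<partial>lborel) = ennreal (\<delta> * \<delta>') * (\<integral>\<^sup>+x. h ((f \<circ> g) x) \<partial>lborel)"
      using f1 g1 by (simp add: ennreal_mult mult.assoc)
  next
    fix E :: "(real ^ 'n) set" assume E: "E \<in> grassmannian k"
    show "J (g ` E) * J' E > 0" using f5[OF gE[OF E]] g5[OF E] by simp
    fix h :: "real ^ 'n \<Rightarrow> ennreal"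
    show "(\<integral>\<^sup>+x. h x \<partial>lebesgue_subspace ((f \<circ> g) ` E)) =
        ennreal (J (g ` E) * J' E) * (\<integral>\<^sup>+x. h ((f \<circ> g) x) \<partial>lebesgue_subspace E)"
      using f6[OF gE[OF E], of h] g6[OF E, of "\<lambda>x. h (f x)"] f5[OF gE[OF E]] g5[OF E]
      by (simp add: image_image ennreal_mult mult.assoc)
  next
    fix \<Phi> :: "(real ^ 'n) set \<Rightarrow> ennreal" assume \<Phi> [measurable]: "\<Phi> \<in> borel_measurable \<mu>"
    have "(\<lambda>E. \<Phi> (f ` E) * ennreal (J E powr (- real CARD('n)))) \<in> borel_measurable \<mu>" by measurable
    from g7[OF this] f7[OF \<Phi>]
    have "(\<integral>\<^sup>+E. \<Phi> E \<partial>\<mu>) = ennreal (\<delta> powr real k) * (ennreal (\<delta>' powr real k) *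
       (\<integral>\<^sup>+E. \<Phi> (f ` g ` E) * ennreal (J (g ` E) powr (- real CARD('n))) * ennreal (J' E powr (- real CARD('n))) \<partial>\<mu>))"
      by simp
    also have "(\<integral>\<^sup>+E. \<Phi> (f ` g ` E) * ennreal (J (g ` E) powr (- real CARD('n))) * ennreal (J' E powr (- real CARD('n))) \<partial>\<mu>) =
       (\<integral>\<^sup>+E. \<Phi> ((f \<circ> g) ` E) * ennreal ((J (g ` E) * J' E) powr (- real CARD('n))) \<partial>\<mu>)"
    proof (rule nn_integral_cong)
      fix E assume "E \<in> space \<mu>"
      then have E: "E \<in> grassmannian k" by (simp add: space_haar)
      show "\<Phi> (f ` g ` E) * ennreal (J (g ` E) powr (- real CARD('n))) * ennreal (J' E powr (- real CARD('n))) =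
         \<Phi> ((f \<circ> g) ` E) * ennreal ((J (g ` E) * J' E) powr (- real CARD('n)))"
        using f5[OF gE[OF E]] g5[OF E]
        by (simp add: image_image powr_mult ennreal_mult mult.assoc)
    qed
    finally show "(\<integral>\<^sup>+E. \<Phi> E \<partial>\<mu>) = ennreal ((\<delta> * \<delta>') powr real k) *
       (\<integral>\<^sup>+E. \<Phi> ((f \<circ> g) ` E) * ennreal ((J (g ` E) * J' E) powr (- real CARD('n))) \<partial>\<mu>)"
      using f1 g1 by (simp add: powr_mult ennreal_mult mult.assoc)
  qed
qed

lemma change_of_variables_orthogonal:
  assumes U: "orthogonal_transformation U"
  shows "change_of_variables U 1 (\<lambda>_. 1)"
proof -
  have lin: "linear U" "inj U" using U by (auto intro: orthogonal_transformation_linear orthogonal_transformation_inj)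
  note Um = borel_measurable_linear[OF lin(1)]
  show ?thesis
    unfolding change_of_variables_def
  proof (intro conjI ballI allI)
    fix h :: "real ^ 'n \<Rightarrow> ennreal" assume h: "h \<in> borel_measurable borel"
    show "(\<integral>\<^sup>+x. h x \<partial>lborel) = ennreal 1 * (\<integral>\<^sup>+x. h (U x) \<partial>lborel)"
      using nn_integral_distr[of U lborel borel h] Um h
      by (simp add: lborel_distr_orthogonal_transformation[OF U])
  next
    fix E :: "(real ^ 'n) set" and h :: "real ^ 'n \<Rightarrow> ennreal"
    assume "E \<in> grassmannian k"
    then have sub: "subspace E" by (simp add: grassmannian_def)
    then obtain B where B: "orthonormal_basis E B" using orthonormal_basis_exists by blast
    have UB: "orthonormal_basis (U ` E) (U ` B)"
      by (rule nn_integral_subspace_measure_orthogonal(1)[OF U B, of "\<lambda>_. 0"]) simp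
    show "(\<integral>\<^sup>+x. h x \<partial>lebesgue_subspace (U ` E)) = ennreal 1 * (\<integral>\<^sup>+x. h (U x) \<partial>lebesgue_subspace E)"
      by (rule nn_integral_lebesgue_subspace_image[OF lin sub _ B UB])
        (simp_all add: nn_integral_subspace_measure_orthogonal(2)[OF U B])
  next
    fix \<Phi> :: "(real ^ 'n) set \<Rightarrow> ennreal" assume \<Phi>: "\<Phi> \<in> borel_measurable \<mu>"
    show "(\<integral>\<^sup>+E. \<Phi> E \<partial>\<mu>) = ennreal (1 powr real k) * (\<integral>\<^sup>+E. \<Phi> (U ` E) * ennreal (1 powr (- real CARD('n))) \<partial>\<mu>)"
      using nn_integral_distr[OF measurable_orthogonal_image[OF U], of \<Phi>] \<Phi>
      by (simp add: distr_orthogonal_image[OF U])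
  qed (use lin measurable_orthogonal_image[OF U] in simp_all)
qed

lemma change_of_variables_axis_scaling:
  assumes t: "t > 0"
  shows "change_of_variables (axis_scaling a t) t (\<lambda>E. sqrt (scaling_det a t (projection_matrix E)))"
proof -
  let ?D = "axis_scaling a t"
  let ?d = "\<lambda>E. scaling_det a t (projection_matrix E)"
  have lin: "linear ?D" "inj ?D" using t by (simp_all add: linear_axis_scaling inj_axis_scaling)
  have dpos: "?d E > 0" if "E \<in> grassmannian k" for E
    by (rule scaling_det_pos[OF projection_matrix_in[OF that] t])
  have am [measurable]: "(\<lambda>E. scaling_action a t (projection_matrix E)) \<in> borel_measurable \<mu>"
    using t by measurable
  have Dm [measurable]: "(\<lambda>E. ?D ` E) \<in> measurable \<mu> \<mu>"
  proof (rule measurable_haarI)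
    show "?D ` E \<in> grassmannian k" if "E \<in> space \<mu>" for E
      using that lin by (simp add: space_haar linear_image_grassmannian)
    show "(\<lambda>E. projection_matrix (?D ` E)) \<in> borel_measurable \<mu>"
      by (subst measurable_cong[where g="\<lambda>E. scaling_action a t (projection_matrix E)"])
        (auto simp: space_haar projection_matrix_axis_scaling_image t)
  qed
  \<comment> \<open>Taken on the empty set because only the measurability clause is wanted.\<close>
  have "test_function {} (scaling_det a t)" by (rule test_function_scaling_det) simp
  then have "scaling_det a t \<in> borel_measurable borel" by (simp add: test_function_def)
  then have dm [measurable]: "?d \<in> borel_measurable \<mu>" by measurable
  have wm [measurable]: "(\<lambda>E. scaling_weight k a t (projection_matrix E)) \<in> borel_measurable \<mu>"
    using t by measurable
  show ?thesis
    unfolding change_of_variables_def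
  proof (intro conjI ballI allI)
    show "(\<integral>\<^sup>+x. h x \<partial>lborel) = ennreal t * (\<integral>\<^sup>+x. h (?D x) \<partial>lborel)"
      if "h \<in> borel_measurable borel" for h :: "real ^ 'n \<Rightarrow> ennreal"
      by (rule nn_integral_lborel_axis_scaling[OF t that])
    show "sqrt (?d E) > 0" if "E \<in> grassmannian k" for E using dpos[OF that] by simp
    show "(\<lambda>E. sqrt (?d E)) \<in> borel_measurable \<mu>" by measurable
  next
    fix E :: "(real ^ 'n) set" and h :: "real ^ 'n \<Rightarrow> ennreal"
    assume E: "E \<in> grassmannian k"
    then have sub: "subspace E" by (simp add: grassmannian_def)
    show "(\<integral>\<^sup>+x. h x \<partial>lebesgue_subspace (?D ` E)) = ennreal (sqrt (?d E)) * (\<integral>\<^sup>+x. h (?D x) \<partial>lebesgue_subspace E)"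
    proof (rule nn_integral_subspace_measure_axis_scaling[OF sub t, of a])
      fix B B'
      assume B: "orthonormal_basis E B" "orthonormal_basis (?D ` E) B'"
        and eq: "\<And>f. f \<in> borel_measurable (restrict_space borel (?D ` E)) \<Longrightarrow>
          (\<integral>\<^sup>+x. f x \<partial>subspace_measure (?D ` E) B') = ennreal (sqrt (?d E)) * (\<integral>\<^sup>+x. f (?D x) \<partial>subspace_measure E B)"
      show ?thesis
        by (rule nn_integral_lebesgue_subspace_image[OF lin sub _ B eq]) (simp add: dpos[OF E])
    qed
  next
    fix \<Phi> :: "(real ^ 'n) set \<Rightarrow> ennreal" assume \<Phi> [measurable]: "\<Phi> \<in> borel_measurable \<mu>"
    \<comment> \<open>Measurable sets of subspaces are preimages of Borel sets of matrices, so the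
      law on the Grassmannian is read off from the law of the projection.\<close>
    have law: "distr (density \<mu> (\<lambda>E. ennreal (scaling_weight k a t (projection_matrix E)))) \<mu> (\<lambda>E. ?D ` E) = \<mu>"
    proof (rule measure_eqI)
      fix A assume "A \<in> sets (distr (density \<mu> (\<lambda>E. ennreal (scaling_weight k a t (projection_matrix E)))) \<mu> (\<lambda>E. ?D ` E))"
      then have A [measurable]: "A \<in> sets \<mu>" by simp
      obtain A' where A' [measurable]: "A' \<in> sets borel" and A_eq: "A = projection_matrix -` A' \<inter> grassmannian k"
        using sets_haarE[OF A] .
      have ind: "indicator A (?D ` E) = (indicator A' (scaling_action a t (projection_matrix E)) :: ennreal)"
        "indicator A E = (indicator A' (projection_matrix E) :: ennreal)" if "E \<in> space \<mu>" for E
        using that linear_image_grassmannian[OF lin] projection_matrix_axis_scaling_image[OF _ t, of E k a]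
        by (auto simp: A_eq space_haar indicator_def)
      let ?N = "density \<mu> (\<lambda>E. ennreal (scaling_weight k a t (projection_matrix E)))"
      have "emeasure (distr ?N \<mu> (\<lambda>E. ?D ` E)) A = (\<integral>\<^sup>+E. indicator A E \<partial>distr ?N \<mu> (\<lambda>E. ?D ` E))" by simp
      also have "\<dots> = (\<integral>\<^sup>+E. indicator A (?D ` E) \<partial>?N)" by (intro nn_integral_distr) simp_all
      also have "\<dots> = (\<integral>\<^sup>+E. ennreal (scaling_weight k a t (projection_matrix E)) * indicator A (?D ` E) \<partial>\<mu>)"
        by (intro nn_integral_density) measurable
      also have "\<dots> = (\<integral>\<^sup>+E. indicator A' (scaling_action a t (projection_matrix E)) * ennreal (scaling_weight k a t (projection_matrix E)) \<partial>\<mu>)"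
        by (intro nn_integral_cong) (simp add: ind mult.commute)
      also have "\<dots> = (\<integral>\<^sup>+E. indicator A' (projection_matrix E) \<partial>\<mu>)"
        by (rule nn_integral_scaling[OF t]) simp
      also have "\<dots> = (\<integral>\<^sup>+E. indicator A E \<partial>\<mu>)" by (intro nn_integral_cong) (simp add: ind)
      also have "\<dots> = emeasure \<mu> A" by simp
      finally show "emeasure (distr ?N \<mu> (\<lambda>E. ?D ` E)) A = emeasure \<mu> A" .
    qed simp
    have "(\<integral>\<^sup>+E. \<Phi> E \<partial>\<mu>) = (\<integral>\<^sup>+E. \<Phi> E \<partial>distr (density \<mu> (\<lambda>E. ennreal (scaling_weight k a t (projection_matrix E)))) \<mu> (\<lambda>E. ?D ` E))"
      unfolding law ..
    also have "\<dots> = (\<integral>\<^sup>+E. \<Phi> (?D ` E) \<partial>density \<mu> (\<lambda>E. ennreal (scaling_weight k a t (projection_matrix E))))"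
      by (intro nn_integral_distr) simp_all
    also have "\<dots> = (\<integral>\<^sup>+E. ennreal (scaling_weight k a t (projection_matrix E)) * \<Phi> (?D ` E) \<partial>\<mu>)"
      by (intro nn_integral_density) measurable
    also have "\<dots> = (\<integral>\<^sup>+E. ennreal (t powr real k) * (\<Phi> (?D ` E) * ennreal (sqrt (?d E) powr (- real CARD('n)))) \<partial>\<mu>)"
    proof (rule nn_integral_cong)
      fix E assume "E \<in> space \<mu>"
      then have "?d E > 0" using dpos by (simp add: space_haar)
      then have "sqrt (?d E) powr (- real CARD('n)) = ?d E powr (- real CARD('n) / 2)"
        by (simp add: powr_half_sqrt[symmetric] powr_powr)
      then show "ennreal (scaling_weight k a t (projection_matrix E)) * \<Phi> (?D ` E) =
         ennreal (t powr real k) * (\<Phi> (?D ` E) * ennreal (sqrt (?d E) powr (- real CARD('n))))"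
        by (simp add: scaling_weight_def ennreal_mult mult_ac)
    qed
    also have "\<dots> = ennreal (t powr real k) * (\<integral>\<^sup>+E. \<Phi> (?D ` E) * ennreal (sqrt (?d E) powr (- real CARD('n))) \<partial>\<mu>)"
      by (intro nn_integral_cmult) measurable
    finally show "(\<integral>\<^sup>+E. \<Phi> E \<partial>\<mu>) =
        ennreal (t powr real k) * (\<integral>\<^sup>+E. \<Phi> (?D ` E) * ennreal (sqrt (?d E) powr (- real CARD('n))) \<partial>\<mu>)" .
  qed (use lin t Dm in simp_all)
qed

end

section \<open>Reduction of invertible maps to orthogonal maps and scalings\<close>

context haar_grassmannian
begin

definition has_change_of_variables :: "(real ^ 'n \<Rightarrow> real ^ 'n) \<Rightarrow> bool" where
  "has_change_of_variables g \<longleftrightarrow> (\<exists>\<delta> J. change_of_variables g \<delta> J)"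

lemma has_change_of_variables_compose:
  "has_change_of_variables f \<Longrightarrow> has_change_of_variables g \<Longrightarrow> has_change_of_variables (f \<circ> g)"
  unfolding has_change_of_variables_def using change_of_variables_compose by blast

lemma has_change_of_variables_orthogonal:
  "orthogonal_transformation U \<Longrightarrow> has_change_of_variables U"
  unfolding has_change_of_variables_def using change_of_variables_orthogonal by blast

text \<open>A negative factor is split into its absolute value and a reflection, which is
  orthogonal.\<close>

lemma has_change_of_variables_axis_scaling:
  assumes "c \<noteq> 0" shows "has_change_of_variables (axis_scaling a c)"
proof -
  define \<sigma> where "\<sigma> = axis_scaling a (sgn c)"
  have "(\<sigma> x $ i) * (\<sigma> y $ i) = x $ i * y $ i" for x y i
    using assms by (simp add: \<sigma>_def axis_scaling_component sgn_if)
  then have "orthogonal_transformation \<sigma>"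
    by (simp add: orthogonal_transformation_def inner_vec_def) (simp add: \<sigma>_def linear_axis_scaling)
  then have "has_change_of_variables (axis_scaling a \<bar>c\<bar> \<circ> \<sigma>)"
    using change_of_variables_axis_scaling[of "\<bar>c\<bar>" a] assms
    by (intro has_change_of_variables_compose[OF _ has_change_of_variables_orthogonal])
      (auto simp: has_change_of_variables_def)
  moreover have "axis_scaling a \<bar>c\<bar> \<circ> \<sigma> = axis_scaling a c"
    by (rule ext) (simp add: \<sigma>_def axis_scaling_mult abs_mult_sgn)
  ultimately show ?thesis by simp
qed

lemma has_change_of_variables_diagonal:
  assumes "\<And>i. c i \<noteq> 0"
  shows "has_change_of_variables (\<lambda>x. \<chi> i. c i * x $ i)"
proof -
  have "has_change_of_variables (\<lambda>x. \<chi> i. (if i \<in> S then c i else 1) * x $ i)" if "finite S" for S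
    using that
  proof induction
    case empty
    have "(\<lambda>x. \<chi> i. (if i \<in> {} then c i else 1) * x $ i) = (\<lambda>x. x)" by (simp add: vec_eq_iff)
    then show ?case by (simp only:) (intro has_change_of_variables_orthogonal orthogonal_transformation_id)
  next
    case (insert j S)
    have "(\<lambda>x. \<chi> i. (if i \<in> insert j S then c i else 1) * x $ i) =
        axis_scaling j (c j) \<circ> (\<lambda>x. \<chi> i. (if i \<in> S then c i else 1) * x $ i)"
      using insert.hyps by (auto simp: fun_eq_iff vec_eq_iff axis_scaling_component)
    then show ?case
      using has_change_of_variables_compose[OF has_change_of_variables_axis_scaling[OF assms, of j j] insert.IH]
      by (simp only:)
  qed
  from this[of UNIV] show ?thesis by simp
qed

text \<open>An axis scaling conjugated by an orthogonal map that carries the axis to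
  \<open>v\<close>; which axis is used is arbitrary.\<close>

lemma has_change_of_variables_direction_scaling:
  assumes v: "norm v = 1" and c: "c \<noteq> 0"
  shows "has_change_of_variables (\<lambda>x. x + ((c - 1) * (x \<bullet> v)) *\<^sub>R v)"
proof -
  fix a :: 'n
  have axis: "norm (axis a (1::real)) = 1" by simp
  obtain U where U: "orthogonal_transformation U" "U (axis a (1::real)) = v"
    using orthogonal_transformation_exists_1[OF axis v] by metis
  have inv: "orthogonal_transformation (inv U)" by (rule orthogonal_transformation_inv[OF U(1)])
  have lin: "linear U" by (rule orthogonal_transformation_linear[OF U(1)])
  have 1: "U (inv U x) = x" for x using orthogonal_transformation_surj[OF U(1)] by (rule surj_f_inv_f)
  have "inv U x \<bullet> axis a 1 = x \<bullet> v" for x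
    using U 1 by (metis orthogonal_transformation_def)
  then have "inv U x $ a = x \<bullet> v" for x by (simp add: inner_axis)
  then have "(\<lambda>x. x + ((c - 1) * (x \<bullet> v)) *\<^sub>R v) = U \<circ> (axis_scaling a c \<circ> inv U)"
    by (simp add: fun_eq_iff axis_scaling_def linear_add[OF lin] linear_cmul[OF lin] 1 U(2))
  then show ?thesis
    by (simp only: has_change_of_variables_compose[OF has_change_of_variables_orthogonal[OF U(1)]
        has_change_of_variables_compose[OF has_change_of_variables_axis_scaling[OF c]
          has_change_of_variables_orthogonal[OF inv]]])
qed

text \<open>The shear with factor \<open>3/2\<close> has singular values \<open>2\<close> and \<open>1/2\<close>, with rational singular
  directions \<open>(2, 1)\<close> and \<open>(1, -2)\<close> up to normalisation.\<close>

lemma has_change_of_variables_shear: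
  assumes "m \<noteq> l"
  shows "has_change_of_variables (\<lambda>x. \<chi> i. if i = m then x $ m + x $ l else x $ i)"
proof -
  define e f :: "real ^ 'n" where "e = axis m 1" and "f = axis l 1"
  have ef: "e \<bullet> e = 1" "f \<bullet> f = 1" "e \<bullet> f = 0" "f \<bullet> e = 0"
    using assms by (simp_all add: e_def f_def inner_axis_axis)
  define v w where "v = (1 / sqrt 5) *\<^sub>R (2 *\<^sub>R e + f)" and "w = (1 / sqrt 5) *\<^sub>R (e - 2 *\<^sub>R f)"
  have "v \<bullet> v = 1" "w \<bullet> w = 1" "v \<bullet> w = 0"
    by (simp_all add: v_def w_def inner_add_left inner_add_right inner_diff_left inner_diff_right ef)
  then have vw: "norm v = 1" "norm w = 1" "v \<bullet> v = 1" "w \<bullet> w = 1" "v \<bullet> w = 0" "w \<bullet> v = 0"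
    by (simp_all add: norm_eq_1 inner_commute)
  \<comment> \<open>\<open>V\<close> and \<open>W\<close> stretch \<open>v\<close> by 2 and
    \<open>w\<close> by \<open>1/2\<close>, and \<open>V'\<close>, \<open>W'\<close> are their
    inverses. \<open>Q\<close> below is then the orthogonal factor of the polar decomposition of the
    shear \<open>s\<close>.\<close>
  define V W V' W' where "V x = x + ((2 - 1) * (x \<bullet> v)) *\<^sub>R v" and "W x = x + ((1 / 2 - 1) * (x \<bullet> w)) *\<^sub>R w"
    and "V' x = x + ((1 / 2 - 1) * (x \<bullet> v)) *\<^sub>R v" and "W' x = x + ((2 - 1) * (x \<bullet> w)) *\<^sub>R w" for x
  define s where "s x = x + (3 / 2 * (x \<bullet> f)) *\<^sub>R e" for x
  define Q where "Q x = W' (V' (s x))" for x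
  have VV': "V (V' x) = x" "W (W' x) = x" for x
    by (simp_all add: V_def V'_def W_def W'_def inner_add_left vw algebra_simps)
  have s_eq: "s = V \<circ> (W \<circ> Q)" by (simp add: fun_eq_iff Q_def VV')
  have "linear (\<lambda>x. x + (c * (x \<bullet> y)) *\<^sub>R z)" for c and y z :: "real ^ 'n"
    by (intro linearI) (simp_all add: inner_add_left algebra_simps)
  then have "linear V'" "linear W'" "linear s"
    unfolding V'_def[abs_def] W'_def[abs_def] s_def[abs_def] by blast+
  then have "linear Q"
    using linear_compose[of s V'] linear_compose[of "V' \<circ> s" W'] by (simp add: Q_def[abs_def] comp_def)
  moreover have "norm (Q x) = norm x" for x
  proof -
    define y where "y = s x"
    \<comment> \<open>The squared lengths along \<open>v\<close> and \<open>w\<close> are multiplied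
      by \<open>1/4\<close> and 4, which changes them by \<open>-3/4\<close> and 3 times their
      value.\<close>
    have "Q x \<bullet> Q x = y \<bullet> y - 3 / 4 * (y \<bullet> v)\<^sup>2 + 3 * (y \<bullet> w)\<^sup>2"
      unfolding Q_def y_def[symmetric] W'_def V'_def
      by (simp add: inner_add_left inner_add_right vw inner_commute[of v y] inner_commute[of w y]
          power2_eq_square algebra_simps)
    moreover have "(y \<bullet> v)\<^sup>2 = (2 * (y \<bullet> e) + y \<bullet> f)\<^sup>2 / 5" "(y \<bullet> w)\<^sup>2 = (y \<bullet> e - 2 * (y \<bullet> f))\<^sup>2 / 5"
      by (simp_all add: v_def w_def inner_add_right inner_diff_right power_divide)
    moreover have "y \<bullet> e = x \<bullet> e + 3 / 2 * (x \<bullet> f)" "y \<bullet> f = x \<bullet> f"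
      "y \<bullet> y = x \<bullet> x + 3 * (x \<bullet> f) * (x \<bullet> e) + 9 / 4 * (x \<bullet> f)\<^sup>2"
      by (simp_all add: y_def s_def inner_add_left inner_add_right ef inner_commute[of e x] power2_eq_square algebra_simps)
    ultimately have "Q x \<bullet> Q x = x \<bullet> x"
      by (simp add: power2_eq_square algebra_simps)
    then show ?thesis by (simp add: norm_eq_sqrt_inner)
  qed
  ultimately have "orthogonal_transformation Q" by (simp add: orthogonal_transformation)
  then have s: "has_change_of_variables s"
    unfolding s_eq V_def[abs_def] W_def[abs_def]
    by (intro has_change_of_variables_compose[OF has_change_of_variables_direction_scaling[OF vw(1)]]
        has_change_of_variables_compose[OF has_change_of_variables_direction_scaling[OF vw(2)]]
        has_change_of_variables_orthogonal) simp_all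
  \<comment> \<open>The unit shear itself has irrational singular values, related to the golden
    ratio. Conjugation by an axis scaling converts the factor \<open>3/2\<close> to 1.\<close>
  have "(\<lambda>x. \<chi> i. if i = m then x $ m + x $ l else x $ i) = axis_scaling m (2 / 3) \<circ> (s \<circ> axis_scaling m (3 / 2))"
  proof (rule ext, unfold vec_eq_iff, rule allI)
    fix x :: "real ^ 'n" and i
    have "axis m 1 $ i = (if i = m then 1 else 0 :: real)" by (simp add: axis_def)
    then show "(\<chi> i. if i = m then x $ m + x $ l else x $ i) $ i = (axis_scaling m (2 / 3) \<circ> (s \<circ> axis_scaling m (3 / 2))) x $ i"
      using assms by (cases "i = m") (simp_all add: axis_scaling_component s_def e_def f_def inner_axis)
  qed
  moreover have "has_change_of_variables (axis_scaling m (2 / 3) \<circ> (s \<circ> axis_scaling m (3 / 2)))"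
    by (rule has_change_of_variables_compose[OF has_change_of_variables_axis_scaling
        has_change_of_variables_compose[OF s has_change_of_variables_axis_scaling]]) simp_all
  ultimately show ?thesis by (simp only:)
qed

text \<open>Induction over elementary maps. The guard \<open>inj g\<close> is needed because that
  induction also passes through singular maps; an injective composition in finite dimension has
  injective factors.\<close>

lemma has_change_of_variables_linear:
  assumes "linear g" "inj g"
  shows "has_change_of_variables g"
proof -
  have "inj g \<longrightarrow> has_change_of_variables g"
    using assms(1)
  proof (rule induct_linear_elementary; intro impI)
    fix f g :: "real ^ 'n \<Rightarrow> real ^ 'n"
    assume lin: "linear f" "linear g" and "inj f \<longrightarrow> has_change_of_variables f"
      "inj g \<longrightarrow> has_change_of_variables g" and inj: "inj (f \<circ> g)"
    moreover from inj have g: "inj g" by (rule inj_on_imageI2)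
    moreover have "inj f"
    proof (rule injI)
      fix x y assume "f x = f y"
      moreover obtain x' y' where "x = g x'" "y = g y'"
        using linear_inj_imp_surj[OF lin(2) g] by (meson surjD)
      ultimately show "x = y" using injD[OF inj, of x' y'] by simp
    qed
    ultimately show "has_change_of_variables (f \<circ> g)" by (blast intro: has_change_of_variables_compose)
  next
    \<comment> \<open>A map with a vanishing coordinate misses an axis vector, so it cannot be
      injective.\<close>
    fix f :: "real ^ 'n \<Rightarrow> real ^ 'n" and i
    assume f: "linear f" "\<And>x. f x $ i = 0" "inj f"
    then obtain x where "f x = axis i 1"
      using linear_inj_imp_surj[OF f(1,3)] by (metis surjD)
    then have "f x $ i = 1" by simp
    with f(2) show "has_change_of_variables f" by simp
  next
    fix c :: "'n \<Rightarrow> real"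
    assume inj: "inj (\<lambda>x. \<chi> i. c i * x $ i :: real ^ 'n)"
    have "c i \<noteq> 0" for i
    proof
      assume "c i = 0"
      then have "(\<chi> j. c j * (axis i 1 :: real ^ 'n) $ j) = (\<chi> j. c j * (0 :: real ^ 'n) $ j)"
        by (auto simp: vec_eq_iff axis_def)
      from injD[OF inj this] show False by simp
    qed
    then show "has_change_of_variables (\<lambda>x. \<chi> i. c i * x $ i)" by (rule has_change_of_variables_diagonal)
  next
    fix m l :: 'n
    let ?\<tau> = "Transposition.transpose m l"
    have "(\<Sum>i\<in>UNIV. x $ ?\<tau> i * y $ ?\<tau> i) = (\<Sum>i\<in>UNIV. x $ i * y $ i)" for x y :: "real ^ 'n"
      by (rule sum.reindex_bij_betw[OF bij_transpose])
    then have "orthogonal_transformation (\<lambda>x :: real ^ 'n. \<chi> i. x $ ?\<tau> i)"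
      by (simp add: orthogonal_transformation_def inner_vec_def) (intro linearI; simp add: vec_eq_iff)
    then show "has_change_of_variables (\<lambda>x. \<chi> i. x $ ?\<tau> i)" by (rule has_change_of_variables_orthogonal)
  next
    fix m l :: 'n assume "m \<noteq> l"
    then show "has_change_of_variables (\<lambda>x. \<chi> i. if i = m then x $ m + x $ l else x $ i)"
      by (rule has_change_of_variables_shear)
  qed
  with assms(2) show ?thesis by blast
qed

section \<open>Volume-preserving maps and the functional\<close>

lemma volume_preserving_change_of_variables:
  assumes g: "volume_preserving_linear g"
  obtains J where "change_of_variables g 1 J"
proof -
  have lin: "linear g" using g by (simp add: volume_preserving_linear_def)
  \<comment> \<open>One set of measure 1 determines \<open>\<delta>\<close>; compactness makes its
    image Borel.\<close>
  define S where "S = cbox (0 :: real ^ 'n) One"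
  have S: "emeasure lebesgue S = 1" "S \<in> sets borel"
    by (simp_all add: S_def emeasure_lborel_cbox_eq inner_diff_left)
  have gS: "emeasure lebesgue (g ` S) = 1"
    using g S by (simp add: volume_preserving_linear_def)
  \<comment> \<open>Otherwise the image of the cube would lie in a proper subspace, hence be null
    instead of having measure 1.\<close>
  have inj: "inj g"
  proof (rule ccontr)
    assume "\<not> inj g"
    then have not_surj: "\<not> surj g" using linear_surj_imp_inj[OF lin] by blast
    have span: "span (range g) = range g"
      using linear_subspace_image[OF lin subspace_UNIV] by (rule span_eq_iff[THEN iffD2])
    have "span (range g) \<noteq> UNIV" unfolding span by (rule not_surj)
    then have "dim (range g) \<noteq> DIM(real ^ 'n)" by (simp only: dim_eq_full not_False_eq_True)
    then have "dim (range g) < DIM(real ^ 'n)" using dim_subset_UNIV[of "range g"] by linarith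
    then have "negligible (range g)" by (rule negligible_lowdim)
    then have "negligible (g ` S)" by (rule negligible_subset) auto
    then show False using gS by (simp add: negligible_iff_null_sets null_sets_def)
  qed
  then obtain \<delta> J where cov: "change_of_variables g \<delta> J"
    using has_change_of_variables_linear[OF lin] by (auto simp: has_change_of_variables_def)
  have "compact (g ` S)"
    using lin by (intro compact_continuous_image linear_continuous_on) (auto simp: S_def linear_conv_bounded_linear)
  then have gSb: "g ` S \<in> sets borel" by (intro borel_closed compact_imp_closed)
  have \<delta>: "\<delta> > 0"
    and int: "\<And>h. h \<in> borel_measurable borel \<Longrightarrow> (\<integral>\<^sup>+x. h x \<partial>lborel) = ennreal \<delta> * (\<integral>\<^sup>+x. h (g x) \<partial>lborel)"
    using cov unfolding change_of_variables_def by blast+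
  have "emeasure lborel (g ` S) = ennreal \<delta> * (\<integral>\<^sup>+x. indicator (g ` S) (g x) \<partial>lborel)"
    using int[of "indicator (g ` S)"] gSb by simp
  moreover have "(\<integral>\<^sup>+x. indicator (g ` S) (g x) \<partial>lborel) = (\<integral>\<^sup>+x. indicator S x \<partial>lborel)"
    using inj by (intro nn_integral_cong) (auto simp: indicator_def inj_image_mem_iff)
  ultimately have "ennreal \<delta> = 1" using S gS gSb by simp
  then have "\<delta> = 1" using \<delta> by simp
  then show ?thesis using that cov by blast
qed

text \<open>The \<open>i\<close>-th factor contributes \<open>J E\<close> to the power
  \<open>\<alpha> i / p i\<close>; these multiply to the power \<open>CARD('n)\<close>, which the
  weight cancels. It is an inequality because the product of norms is not known to be measurable in
  \<open>E\<close>.\<close>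

lemma grassmannian_functional_le:
  assumes p: "(\<Sum>i=1..m. \<alpha> i / p i) = real CARD('n)" and cov: "change_of_variables g 1 J"
  shows "grassmannian_functional \<mu> m p \<alpha> (\<lambda>i t. f i (inv g t)) \<le> grassmannian_functional \<mu> m p \<alpha> f"
proof -
  have inj: "inj g" and J: "\<And>E. E \<in> grassmannian k \<Longrightarrow> J E > 0"
    and sub: "\<And>E h. E \<in> grassmannian k \<Longrightarrow>
      (\<integral>\<^sup>+x. h x \<partial>lebesgue_subspace (g ` E)) = ennreal (J E) * (\<integral>\<^sup>+x. h (g x) \<partial>lebesgue_subspace E)"
    and int: "\<And>\<Phi>. \<Phi> \<in> borel_measurable \<mu> \<Longrightarrow> (\<integral>\<^sup>+E. \<Phi> E \<partial>\<mu>) =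
        1 * (\<integral>\<^sup>+E. \<Phi> (g ` E) * ennreal (J E powr (- real CARD('n))) \<partial>\<mu>)"
    using cov unfolding change_of_variables_def by simp_all
  define \<Psi> where "\<Psi> E = (\<Prod>i=1..m. Lp_norm (lebesgue_subspace E) (p i) (\<lambda>t. f i (inv g t)) epowr \<alpha> i)" for E
  define \<Phi> where "\<Phi> E = (\<Prod>i=1..m. Lp_norm (lebesgue_subspace E) (p i) (f i) epowr \<alpha> i)" for E
  have \<Psi>: "\<Psi> (g ` E) = ennreal (J E powr real CARD('n)) * \<Phi> E" if E: "E \<in> grassmannian k" for E
  proof -
    have Lp: "Lp_norm (lebesgue_subspace (g ` E)) (p i) (\<lambda>t. f i (inv g t)) epowr \<alpha> i =
        ennreal (J E powr (\<alpha> i / p i)) * Lp_norm (lebesgue_subspace E) (p i) (f i) epowr \<alpha> i" for i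
      unfolding Lp_norm_def sub[OF E] using J[OF E] inj
      by (simp add: epowr_mult_left powr_powr)
    have "\<Psi> (g ` E) = (\<Prod>i=1..m. ennreal (J E powr (\<alpha> i / p i))) * \<Phi> E"
      unfolding \<Psi>_def \<Phi>_def Lp by (rule prod.distrib)
    also have "(\<Prod>i=1..m. ennreal (J E powr (\<alpha> i / p i))) = ennreal (\<Prod>i=1..m. J E powr (\<alpha> i / p i))"
      by (rule prod_ennreal) simp
    also have "(\<Prod>i=1..m. J E powr (\<alpha> i / p i)) = J E powr real CARD('n)"
      using J[OF E] by (simp add: p[symmetric] powr_sum)
    finally show ?thesis .
  qed
  have "(\<integral>\<^sup>+E. \<Psi> E \<partial>\<mu>) \<le> 1 * (\<integral>\<^sup>+E. \<Psi> (g ` E) * ennreal (J E powr (- real CARD('n))) \<partial>\<mu>)"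
    by (rule nn_integral_change_of_variables_le) (rule int)
  also have "\<dots> = (\<integral>\<^sup>+E. \<Phi> E \<partial>\<mu>)"
  proof -
    have "\<Psi> (g ` E) * ennreal (J E powr (- real CARD('n))) = \<Phi> E" if "E \<in> space \<mu>" for E
    proof -
      have E: "E \<in> grassmannian k" using that by (simp add: space_haar)
      have "ennreal (J E powr real CARD('n)) * ennreal (J E powr (- real CARD('n))) = 1"
        using J[OF E] by (simp add: ennreal_mult[symmetric] powr_add[symmetric])
      then show ?thesis unfolding \<Psi>[OF E] by (simp add: mult_ac)
    qed
    then show ?thesis by (simp cong: nn_integral_cong)
  qed
  finally show ?thesis by (simp only: grassmannian_functional_def \<Psi>_def \<Phi>_def)
qed

text \<open>Needed for the reverse inequality. The general existence result leaves the constant of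
  the inverse open, so it is determined by integrating the indicator of the unit cube.\<close>

lemma change_of_variables_inv:
  assumes cov: "change_of_variables g 1 J"
  obtains J' where "change_of_variables (inv g) 1 J'"
proof -
  have lin: "linear g" and inj: "inj g"
    and int: "\<And>h. h \<in> borel_measurable borel \<Longrightarrow> (\<integral>\<^sup>+x. h x \<partial>lborel) = (\<integral>\<^sup>+x. h (g x) \<partial>lborel)"
    using cov unfolding change_of_variables_def by simp_all
  have lin_inv: "linear (inv g)" by (rule inj_linear_imp_inv_linear[OF lin inj])
  have "inj (inv g)" using linear_inj_imp_surj[OF lin inj] by (rule surj_imp_inj_inv)
  then obtain \<delta> J' where cov': "change_of_variables (inv g) \<delta> J'"
    using has_change_of_variables_linear[OF lin_inv] by (auto simp: has_change_of_variables_def)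
  have \<delta>: "\<delta> > 0"
    and int': "\<And>h. h \<in> borel_measurable borel \<Longrightarrow> (\<integral>\<^sup>+x. h x \<partial>lborel) = ennreal \<delta> * (\<integral>\<^sup>+x. h (inv g x) \<partial>lborel)"
    using cov' unfolding change_of_variables_def by blast+
  define h :: "real ^ 'n \<Rightarrow> ennreal" where "h = indicator (cbox 0 One)"
  have h: "h \<in> borel_measurable borel" "(\<integral>\<^sup>+x. h x \<partial>lborel) = 1"
    by (simp_all add: h_def emeasure_lborel_cbox_eq inner_diff_left)
  have "(\<lambda>x. h (inv g x)) \<in> borel_measurable borel"
    by (rule measurable_compose[OF borel_measurable_linear[OF lin_inv] h(1)])
  from int[OF this] have "(\<integral>\<^sup>+x. h (inv g x) \<partial>lborel) = (\<integral>\<^sup>+x. h x \<partial>lborel)"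
    using inj by simp
  with int'[OF h(1)] have "ennreal \<delta> = 1" by (simp add: h(2))
  then have "\<delta> = 1" using \<delta> by simp
  then show ?thesis using that cov' by blast
qed

end

theorem theorem3p1:
  fixes \<mu> :: "(real ^ 'n) set measure"
    and k m :: nat
    and p \<alpha> :: "nat \<Rightarrow> real"
    and f :: "nat \<Rightarrow> real ^ 'n \<Rightarrow> real"
    and g :: "real ^ 'n \<Rightarrow> real ^ 'n"
  assumes "1 \<le> k" "k \<le> CARD('n) - 1"
    and "m \<ge> 1"
    and "is_haar_grassmannian k \<mu>"
    and "\<And>i. i \<in> {1..m} \<Longrightarrow> p i \<noteq> 0"
    and "\<And>i. i \<in> {1..m} \<Longrightarrow> bounded (range (f i))"
    and "\<And>i. i \<in> {1..m} \<Longrightarrow> in_Lp lebesgue (p i) (f i)"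
    and "grassmannian_functional \<mu> m p \<alpha> f < \<infinity>"
    and "(\<Sum>i=1..m. \<alpha> i / p i) = real CARD('n)"
    and "volume_preserving_linear g"
  shows "grassmannian_functional \<mu> m p \<alpha> (\<lambda>i t. f i (inv g t)) = grassmannian_functional \<mu> m p \<alpha> f"
proof -
  interpret haar_grassmannian \<mu> k by standard fact
  obtain J where cov: "change_of_variables g 1 J"
    using volume_preserving_change_of_variables[OF \<open>volume_preserving_linear g\<close>] .
  obtain J' where cov': "change_of_variables (inv g) 1 J'"
    using change_of_variables_inv[OF cov] .
  have "bij g"
    using cov linear_inj_imp_surj[of g] by (auto simp: change_of_variables_def bij_def)
  \<comment> \<open>In the inequality for \<open>inv g\<close>, applied to the transported
    functions, the two substitutions cancel and \<open>f\<close> reappears.\<close>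
  then have "inv g (inv (inv g) t) = t" for t by (simp add: inv_inv_eq bij_is_inj)
  then show ?thesis
    using grassmannian_functional_le[OF assms(9) cov, of f]
      grassmannian_functional_le[OF assms(9) cov', of "\<lambda>i t. f i (inv g t)"]
    by (intro antisym) simp_all
qed

end
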